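(* Let $(a,b,c)$ and $(a',b',c')$ be admissible triples. Then, as functions on $\mathrm{SL}(2,\mathbb{C})\times \mathrm{SL}(2,\mathbb{C})$, $$\chi^{a,b,c}\,\chi^{a',b',c'}=\sum_{j_1,j_2,k,l,m}\mathrm{C}_{j_1klm}\,\mathrm{C}_{j_2klm}\,\frac{\Theta(a,a',k)\,\Theta(b,b',l)\,\Theta(c,c',m)}{\Delta(k)\,\Delta(l)\,\Delta(m)}\;\chi^{k,l,m},$$ where the sum is over all nonnegative integers $j_1,j_2,k,l,m$ such that the triples $(a,a',k)$, $(b,b',l)$, $(c,c',m)$, $(k,l,m)$ and, for $i=1,2$, $(a',b,j_i)$, $(c,j_i,k)$, $(c',j_i,l)$, $(b,j_i,l)$ are all admissible, and the coefficients are $$\mathrm{C}_{j_iklm}=\frac{\Delta(j_i)}{\Theta(a',b,j_i)}\;S(a,a',j_i;c\,|\,b,k)\;S(b',b,j_i;c'\,|\,a',l)\;S(k,l,c';c\,|\,j_i,m),$$ with $S$ the $6j$-symbols defined in the context.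
   Context: Let $G=\mathrm{SL}(2,\mathbb{C})$ and $V=\mathbb{C}^2$ with standard basis $e_1,e_2$. A triple $(a,b,c)$ of nonnegative integers is admissible if $\alpha=\tfrac12(-a+b+c)$, $\beta=\tfrac12(a-b+c)$, $\gamma=\tfrac12(a+b-c)$ are all nonnegative integers. Let $P_n:V^{\otimes n}\to V^{\otimes n}$ be the symmetrizer $v_1\otimes\cdots\otimes v_n\mapsto\frac1{n!}\sum_{\sigma\in\Sigma_n}v_{\sigma(1)}\otimes\cdots\otimes v_{\sigma(n)}$, and let $V_n\subset V^{\otimes n}$ be its image (isomorphic to $\mathrm{Sym}^nV$). Let $\mathrm{cup}:\mathbb{C}\to V\otimes V$, $1\mapsto e_1\otimes e_2-e_2\otimes e_1$, and $\mathrm{cap}:V\otimes V\to\mathbb{C}$, $v\otimes w\mapsto\det[v\ w]$. Define nested versions by $\mathrm{cup}_0=\mathrm{cap}_0=1$, $\mathrm{cup}_n=(\mathrm{id}_{V^{\otimes (n-1)}}\otimes\mathrm{cup}\otimes\mathrm{id}_{V^{\otimes (n-1)}})\circ\mathrm{cup}_{n-1}:\mathbb{C}\to V^{\otimes n}\otimes V^{\otimes n}$, $\mathrm{cap}_n=\mathrm{cap}_{n-1}\circ(\mathrm{id}_{V^{\otimes (n-1)}}\otimes\mathrm{cap}\otimes\mathrm{id}_{V^{\otimes (n-1)}}):V^{\otimes n}\otimes V^{\otimes n}\to\mathbb{C}$. For an admissible triple define $\iota^{a,b}_c=(P_a\otimes P_b)\circ(\mathrm{id}_{V^{\otimes\beta}}\otimes\mathrm{cup}_\gamma\otimes\mathrm{id}_{V^{\otimes\alpha}})|_{V_c}:V_c\to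 V_a\otimes V_b$ and $\pi^c_{a,b}=P_c\circ(\mathrm{id}_{V^{\otimes\beta}}\otimes\mathrm{cap}_\gamma\otimes\mathrm{id}_{V^{\otimes\alpha}})|_{V_a\otimes V_b}:V_a\otimes V_b\to V_c$. The central function $\chi^{a,b,c}:G\times G\to\mathbb{C}$ is $\chi^{a,b,c}(\mathbf{x}_1,\mathbf{x}_2)=\mathrm{tr}_{V_c}\big(\pi^c_{a,b}\circ(\mathbf{x}_1^{\otimes a}\otimes\mathbf{x}_2^{\otimes b})\circ\iota^{a,b}_c\big)$. Constants: $\Delta(n)=n+1=\dim V_n$, and for an admissible triple $\Theta(a,b,c)=\mathrm{tr}_{V_c}(\pi^c_{a,b}\circ\iota^{a,b}_c)=\frac{\alpha!\,\beta!\,\gamma!\,(\alpha+\beta+\gamma+1)!}{a!\,b!\,c!}$ (symmetric in $a,b,c$, and nonzero). $6j$-symbols: let $(p,e,d)$ and $(q,r,e)$ be admissible. The numbers $S(p,q,r;d\,|\,e,f)$ are the (unique) coefficients in the identity of $G$-equivariant maps $V_d\to V_p\otimes V_q\otimes V_r$ $$(\mathrm{id}_{V_p}\otimes\iota^{q,r}_e)\circ\iota^{p,e}_d=\sum_f S(p,q,r;d\,|\,e,f)\;(\iota^{p,q}_f\otimes\mathrm{id}_{V_r})\circ\iota^{f,r}_d,$$ where $f$ runs over the nonnegative integers for which $(p,q,f)$ and $(f,r,d)$ are admissible. (A common array notation for this is $S(p,q,r;d\,|\,e,f)=\left[\begin{smallmatrix}p&q&f\\ d&r&e\end{smallmatr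ix}\right]$.)
   Formalization: The condition that (b,j_i,l) be admissible is dropped from the index set of the sum; with it the formula is false, e.g. for (0,0,0) and (0,1,1) the sum is empty while the left side is tr(x_2). *)

theory Defs
  imports "HOL-Analysis.Analysis" "HOL-Library.Function_Algebras" "HOL-Combinatorics.List_Permutation"
begin

text \<open>
  Let \<open>V = \<complex>\<^sup>2\<close>, rendered as \<open>complex^2\<close> with standard basis \<open>std 1\<close>, \<open>std 2\<close>. An element of the
  tensor algebra of \<open>V\<close> is given by its coordinates: the coordinate at the word \<open>[i\<^sub>1, \<dots>, i\<^sub>n]\<close>
  is the coefficient of \<open>std i\<^sub>1 \<otimes> \<dots> \<otimes> std i\<^sub>n\<close>. The \<open>n\<close>-th tensor power of \<open>V\<close> consists of the
  functions supported on words of length \<open>n\<close>; the scalars \<open>\<complex>\<close> are its zeroth tensor power.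
  Addition of tensors is pointwise.
\<close>

type_synonym tensor = "2 list \<Rightarrow> complex"

definition tscale :: "complex \<Rightarrow> tensor \<Rightarrow> tensor" where
  "tscale c t = (\<lambda>w. c * t w)"

interpretation tensor: vector_space tscale
  by standard (auto simp: tscale_def fun_eq_iff algebra_simps)

definition std :: "2 \<Rightarrow> complex^2" where
  "std i = axis i 1"

definition tensor_power :: "nat \<Rightarrow> tensor set" where
  "tensor_power n = {t. \<forall>w. length w \<noteq> n \<longrightarrow> t w = 0}"

text \<open>The decomposable tensor \<open>v\<^sub>1 \<otimes> \<dots> \<otimes> v\<^sub>n\<close>; in particular \<open>pure []\<close> is the scalar \<open>1\<close>.\<close>

definition pure :: "(complex^2) list \<Rightarrow> tensor" where
  "pure vs = (\<lambda>w. if length w = length vs then \<Prod>i<length vs. vs ! i $ w ! i else 0)"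

text \<open>
  The product of the tensor algebra. If \<open>s\<close> has degree \<open>m\<close>, only the summand \<open>i = m\<close> can be
  nonzero, so this is the tensor product of homogeneous tensors.
\<close>

definition tprod :: "tensor \<Rightarrow> tensor \<Rightarrow> tensor"  (infixr \<open>\<otimes>\<^sub>T\<close> 75) where
  "s \<otimes>\<^sub>T t = (\<lambda>w. \<Sum>i\<le>length w. s (take i w) * t (drop i w))"

text \<open>
  The linear map on the \<open>n\<close>-th tensor power whose value at the basis vector
  \<open>std i\<^sub>1 \<otimes> \<dots> \<otimes> std i\<^sub>n\<close> is \<open>F [i\<^sub>1, \<dots>, i\<^sub>n]\<close>.
\<close>

definition lin_ext :: "nat \<Rightarrow> (2 list \<Rightarrow> tensor) \<Rightarrow> tensor \<Rightarrow> tensor" where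
  "lin_ext n F t = (\<Sum>w\<in>{w. length w = n}. tscale (t w) (F w))"

text \<open>
  \<open>tmap m n f g\<close> is the tensor product of a linear map \<open>f\<close> defined on the \<open>m\<close>-th and a linear
  map \<open>g\<close> defined on the \<open>n\<close>-th tensor power.
\<close>

definition tmap ::
  "nat \<Rightarrow> nat \<Rightarrow> (tensor \<Rightarrow> tensor) \<Rightarrow> (tensor \<Rightarrow> tensor) \<Rightarrow> tensor \<Rightarrow> tensor" where
  "tmap m n f g =
     lin_ext (m + n) (\<lambda>w. f (pure (map std (take m w))) \<otimes>\<^sub>T g (pure (map std (drop m w))))"

definition id_tmap_id :: "nat \<Rightarrow> nat \<Rightarrow> nat \<Rightarrow> (tensor \<Rightarrow> tensor) \<Rightarrow> tensor \<Rightarrow> tensor" where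
  "id_tmap_id k m n f = tmap k (m + n) id (tmap m n f id)"

definition symmetrizer :: "nat \<Rightarrow> tensor \<Rightarrow> tensor" where
  "symmetrizer n = lin_ext n (\<lambda>w.
     tscale (1 / fact n) (\<Sum>\<sigma> | \<sigma> permutes {..<n}. pure (permute_list \<sigma> (map std w))))"

definition Sym :: "nat \<Rightarrow> tensor set" where
  "Sym n = symmetrizer n ` tensor_power n"

definition group_power :: "complex^2^2 \<Rightarrow> nat \<Rightarrow> tensor \<Rightarrow> tensor" where
  "group_power x n = lin_ext n (\<lambda>w. pure (map (\<lambda>i. x *v std i) w))"

definition cup1 :: "tensor \<Rightarrow> tensor" where
  "cup1 = lin_ext 0 (\<lambda>_. pure [std 1, std 2] - pure [std 2, std 1])"

definition cap1 :: "tensor \<Rightarrow> tensor" where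
  "cap1 = lin_ext 2 (\<lambda>w. tscale (det (transpose (vector [std (w ! 0), std (w ! 1)]))) (pure []))"

fun cup :: "nat \<Rightarrow> tensor \<Rightarrow> tensor" where
  "cup 0 = id"
| "cup (Suc n) = id_tmap_id n 0 n cup1 \<circ> cup n"

fun cap :: "nat \<Rightarrow> tensor \<Rightarrow> tensor" where
  "cap 0 = id"
| "cap (Suc n) = cap n \<circ> id_tmap_id n 2 n cap1"

text \<open>\<open>\<alpha> = (- a + b + c) / 2\<close>, \<open>\<beta> = (a - b + c) / 2\<close>, \<open>\<gamma> = (a + b - c) / 2\<close> are natural numbers.\<close>

definition admissible :: "nat \<Rightarrow> nat \<Rightarrow> nat \<Rightarrow> bool" where
  "admissible a b c \<longleftrightarrow>
     (\<exists>\<alpha> \<beta> \<gamma>. 2 * \<alpha> + a = b + c \<and> 2 * \<beta> + b = a + c \<and> 2 * \<gamma> + c = a + b)"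

text \<open>
  The maps \<open>iota a b c\<close> and \<open>proj a b c\<close> are only meant for admissible triples, where the
  natural-number subtractions and divisions below are exact. They are given by formulas valid on
  whole tensor powers; the restrictions to \<open>Sym c\<close> and to the tensor product of \<open>Sym a\<close> and
  \<open>Sym b\<close> are expressed by the arguments to which they are applied.
\<close>

definition iota :: "nat \<Rightarrow> nat \<Rightarrow> nat \<Rightarrow> tensor \<Rightarrow> tensor" where
  "iota a b c =
     (let \<alpha> = (b + c - a) div 2; \<beta> = (a + c - b) div 2; \<gamma> = (a + b - c) div 2
      in tmap a b (symmetrizer a) (symmetrizer b) \<circ> id_tmap_id \<beta> 0 \<alpha> (cup \<gamma>))"

definition proj :: "nat \<Rightarrow> nat \<Rightarrow> nat \<Rightarrow> tensor \<Rightarrow> tensor" where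
  "proj a b c =
     (let \<alpha> = (b + c - a) div 2; \<beta> = (a + c - b) div 2; \<gamma> = (a + b - c) div 2
      in symmetrizer c \<circ> id_tmap_id \<beta> (2 * \<gamma>) \<alpha> (cap \<gamma>))"

text \<open>
  The trace of an endomorphism \<open>f\<close> of a finite-dimensional subspace \<open>W\<close> of tensors, computed in
  an arbitrary basis of \<open>W\<close>.
\<close>

definition trace_on :: "tensor set \<Rightarrow> (tensor \<Rightarrow> tensor) \<Rightarrow> complex" where
  "trace_on W f =
     (let B = (SOME B. tensor.independent B \<and> tensor.span B = W)
      in \<Sum>b\<in>B. tensor.representation B (f b) b)"

definition SL2 :: "(complex^2^2) set" where
  "SL2 = {x. det x = 1}"

definition central_function ::
  "nat \<Rightarrow> nat \<Rightarrow> nat \<Rightarrow> complex^2^2 \<Rightarrow> complex^2^2 \<Rightarrow> complex" where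
  "central_function a b c x\<^sub>1 x\<^sub>2 =
     trace_on (Sym c) (proj a b c \<circ> tmap a b (group_power x\<^sub>1 a) (group_power x\<^sub>2 b) \<circ> iota a b c)"

definition \<Delta> :: "nat \<Rightarrow> complex" where
  "\<Delta> n = of_nat (n + 1)"

definition \<Theta> :: "nat \<Rightarrow> nat \<Rightarrow> nat \<Rightarrow> complex" where
  "\<Theta> a b c = trace_on (Sym c) (proj a b c \<circ> iota a b c)"

text \<open>
  \<open>sixj p q r d e f\<close> is the coefficient \<open>S(p,q,r;d|e,f)\<close>. It is meaningful when \<open>(p,e,d)\<close> and
  \<open>(q,r,e)\<close> are admissible; the coefficient function is normalised to vanish outside the range of
  summation.
\<close>

definition sixj_range :: "nat \<Rightarrow> nat \<Rightarrow> nat \<Rightarrow> nat \<Rightarrow> nat set" where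
  "sixj_range p q r d = {f. admissible p q f \<and> admissible f r d}"

definition sixj :: "nat \<Rightarrow> nat \<Rightarrow> nat \<Rightarrow> nat \<Rightarrow> nat \<Rightarrow> nat \<Rightarrow> complex" where
  "sixj p q r d e = (THE S.
     (\<forall>f. f \<notin> sixj_range p q r d \<longrightarrow> S f = 0) \<and>
     (\<forall>t\<in>Sym d. tmap p e id (iota q r e) (iota p e d t) =
        (\<Sum>f\<in>sixj_range p q r d. tscale (S f) (tmap f r (iota p q f) id (iota f r d t)))))"

definition prod_coeff ::
  "nat \<Rightarrow> nat \<Rightarrow> nat \<Rightarrow> nat \<Rightarrow> nat \<Rightarrow> nat \<Rightarrow> nat \<Rightarrow> nat \<Rightarrow> nat \<Rightarrow> nat \<Rightarrow> complex" where
  "prod_coeff a b c a' b' c' j k l m =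
     \<Delta> j / \<Theta> a' b j * sixj a a' j c b k * sixj b' b j c' a' l * sixj k l c' c j m"

text \<open>
  The index set for the product of two central functions: all \<open>(j\<^sub>1, j\<^sub>2, k, l, m)\<close> for which
  every triple required by the 6j-symbols in \<open>prod_coeff\<close> is admissible. It is finite. The source
  also lists the triple \<open>(b, j\<^sub>i, l)\<close>, which occurs in none of these symbols. It is omitted because
  with it the product formula fails: the parities of the other triples give
  \<open>b + j\<^sub>i + l \<equiv> b + c' (mod 2)\<close>, so the sum would be empty whenever \<open>b + c'\<close> is odd, for instance
  for the product of the central functions of \<open>(0,0,0)\<close> and \<open>(0,1,1)\<close>, which is not zero.
\<close>

definition prod_index ::
  "nat \<Rightarrow> nat \<Rightarrow> nat \<Rightarrow> nat \<Rightarrow> nat \<Rightarrow> nat \<Rightarrow> (nat \<times> nat \<times> nat \<times> nat \<times> nat) set" where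
  "prod_index a b c a' b' c' =
     {(j\<^sub>1, j\<^sub>2, k, l, m).
        admissible a a' k \<and> admissible b b' l \<and> admissible c c' m \<and> admissible k l m \<and>
        (\<forall>j\<in>{j\<^sub>1, j\<^sub>2}. admissible a' b j \<and> admissible c j k \<and> admissible c' j l)}"

end

theory Submission
  imports Defs
begin

text \<open>
  In suitable unit vectors of the spaces \<open>V\<^sub>n\<close>, the maps \<open>iota a b c\<close> and \<open>proj a b c\<close> are transposes of each other,
  so \<open>\<chi>\<^bsup>a,b,c\<^esup>\<close> is the value at \<open>(x\<^sub>1, x\<^sub>2)\<close> of a quadratic form in the matrix of \<open>iota a b c\<close>, and the product of two
  central functions is a quadratic form in \<open>\<Psi> = iota a b c \<otimes> iota a' b' c'\<close>. Joining the strands \<open>b\<close> and \<open>a'\<close> by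
  an edge \<open>j\<close> and recoupling three times expands \<open>\<Psi>\<close>, with the coefficients \<open>prod_coeff\<close> up to a sign that does not
  depend on \<open>j\<close>, in maps \<open>V\<^sub>c \<otimes> V\<^sub>c\<^sub>' \<rightarrow> V\<^sub>m \<rightarrow> V\<^sub>k \<otimes> V\<^sub>l \<rightarrow> (V\<^sub>a \<otimes> V\<^sub>a\<^sub>') \<otimes> (V\<^sub>b \<otimes> V\<^sub>b\<^sub>')\<close>. By Schur's lemma these are orthogonal
  for distinct \<open>(k, l, m)\<close>, and each of them contributes a multiple of \<open>\<chi>\<^bsup>k,l,m\<^esup>\<close>.
\<close>

section \<open>Words in two letters\<close>

text \<open>The coordinate approach rests on a single array of real numbers: with the square roots
  of the binomial coefficients absorbed into the basis, \<open>cg\<close> describes a trivalent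
  vertex whichever of its legs are read as inputs. Traces and 6j-symbols, which are defined through
  an arbitrary basis and a definite description, then become finite sums in \<open>cg\<close>, and
  \<open>\<Theta>\<close> is a sum of squares, hence nonzero. The delicate point is the signs. The
  recouplings need vertices in orientations other than the given ones, so bending signs accumulate,
  some of them depending on \<open>j\<close> or on summation indices. The index-dependent ones
  cancel in pairs, and the parity conditions contained in admissibility remove \<open>j\<close> from
  the rest. The representation theory is elementary: the invariance of a vertex is read off from a
  product of brackets, Schur's lemma is tested on one diagonal and one unipotent matrix, and
  completeness follows from a dimension count.\<close>

definition words :: "nat \<Rightarrow> 2 list set" where
  "words n = {w. length w = n}"

abbreviation ht :: "2 list \<Rightarrow> nat" where
  "ht w \<equiv> count_list w 2"

text \<open>The nonempty ones are the orbits of the symmetric group on words; their sums span the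
  symmetric tensors.\<close>

definition cls :: "nat \<Rightarrow> nat \<Rightarrow> 2 list set" where
  "cls n k = {w \<in> words n. ht w = k}"

lemma length_words: "w \<in> words n \<Longrightarrow> length w = n"
  by (simp add: words_def)

lemma words_0 [simp]: "words 0 = {[]}"
  by (auto simp: words_def)

lemma words_Suc: "words (Suc n) = (\<lambda>w. 1 # w) ` words n \<union> (\<lambda>w. 2 # w) ` words n"
proof -
  have "\<exists>v\<in>words n. w = 1 # v \<or> w = 2 # v" if "w \<in> words (Suc n)" for w
  proof -
    from that obtain x v where "w = x # v" "length v = n"
      by (auto simp: words_def length_Suc_conv)
    then show ?thesis
      using exhaust_2[of x] by (auto simp: words_def)
  qed
  moreover have "1 # v \<in> words (Suc n)" "2 # v \<in> words (Suc n)" if "v \<in> words n" for v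
    using that by (auto simp: words_def)
  ultimately show ?thesis
    by blast
qed

lemma finite_words [simp]: "finite (words n)"
  by (induction n) (auto simp: words_Suc)

lemma finite_cls [simp]: "finite (cls n k)"
  by (simp add: cls_def)

lemma ht_le_words: "w \<in> words n \<Longrightarrow> ht w \<le> n"
  using count_le_length[of w 2] by (simp add: length_words)

lemma ht_le: "ht w \<le> length w"
  by (rule count_le_length)

lemma sum_words_Suc:
  fixes f :: "2 list \<Rightarrow> 'a::comm_monoid_add"
  shows "(\<Sum>w\<in>words (Suc n). f w) = (\<Sum>w\<in>words n. f (1 # w) + f (2 # w))"
proof -
  have "(\<Sum>w\<in>words (Suc n). f w)
      = (\<Sum>w\<in>(\<lambda>w. 1 # w) ` words n. f w) + (\<Sum>w\<in>(\<lambda>w. 2 # w) ` words n. f w)"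
    unfolding words_Suc by (rule sum.union_disjoint) auto
  then show ?thesis
    by (simp add: sum.reindex inj_on_def sum.distrib)
qed

lemma sum_words_append:
  fixes f :: "2 list \<Rightarrow> 'a::comm_monoid_add"
  shows "(\<Sum>w\<in>words (m + n). f w) = (\<Sum>u\<in>words m. \<Sum>v\<in>words n. f (u @ v))"
  by (induction m arbitrary: f) (simp_all add: sum_words_Suc sum.distrib)

lemma sum_binomial_Suc:
  fixes f :: "nat \<Rightarrow> 'a::comm_semiring_1"
  shows "(\<Sum>k\<le>Suc n. of_nat (Suc n choose k) * f k)
       = (\<Sum>k\<le>n. of_nat (n choose k) * (f k + f (Suc k)))"
proof -
  have "(\<Sum>k\<le>Suc n. of_nat (Suc n choose k) * f k)
      = f 0 + (\<Sum>k\<le>n. of_nat ((n choose k) + (n choose Suc k)) * f (Suc k))"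
    by (simp only: sum.atMost_Suc_shift binomial_Suc_Suc binomial_n_0 of_nat_1 mult_1_left)
  also have "\<dots> = (f 0 + (\<Sum>k\<le>n. of_nat (n choose Suc k) * f (Suc k)))
      + (\<Sum>k\<le>n. of_nat (n choose k) * f (Suc k))"
    by (simp add: sum.distrib algebra_simps)
  also have "f 0 + (\<Sum>k\<le>n. of_nat (n choose Suc k) * f (Suc k))
      = (\<Sum>k\<le>Suc n. of_nat (n choose k) * f k)"
    by (simp add: sum.atMost_Suc_shift del: sum.atMost_Suc)
  also have "\<dots> = (\<Sum>k\<le>n. of_nat (n choose k) * f k)"
    by (simp add: binomial_eq_0)
  finally show ?thesis
    by (simp add: sum.distrib algebra_simps)
qed

lemma sum_words_ht:
  fixes f :: "nat \<Rightarrow> 'a::comm_semiring_1"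
  shows "(\<Sum>w\<in>words n. f (ht w)) = (\<Sum>k\<le>n. of_nat (n choose k) * f k)"
proof (induction n arbitrary: f)
  case (Suc n)
  have "(\<Sum>w\<in>words (Suc n). f (ht w)) = (\<Sum>w\<in>words n. f (ht w) + f (Suc (ht w)))"
    by (simp add: sum_words_Suc)
  also have "\<dots> = (\<Sum>k\<le>Suc n. of_nat (Suc n choose k) * f k)"
    using Suc[of "\<lambda>h. f h + f (Suc h)"] by (simp only: sum_binomial_Suc)
  finally show ?case .
qed auto

lemma card_cls: "card (cls n k) = n choose k"
proof -
  have "card (cls n k) = (\<Sum>w\<in>words n. if ht w = k then 1 else 0 :: nat)"
    unfolding cls_def card_eq_sum by (rule sum.inter_filter) simp
  also have "\<dots> = (\<Sum>h\<le>n. of_nat (n choose h) * (if h = k then 1 else 0))"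
    by (rule sum_words_ht)
  also have "\<dots> = n choose k"
    by (cases "k \<le> n") (auto simp: if_distrib binomial_eq_0 cong: if_cong)
  finally show ?thesis .
qed

lemma sum_words_cls:
  fixes f :: "2 list \<Rightarrow> 'a::comm_monoid_add"
  shows "(\<Sum>w\<in>words n. f w) = (\<Sum>k\<le>n. \<Sum>w\<in>cls n k. f w)"
  unfolding cls_def by (rule sum.group[symmetric]) (auto simp: ht_le_words)

section \<open>Clebsch-Gordan coefficients\<close>

text \<open>
  With \<open>a = \<beta> + \<gamma>\<close>, \<open>b = \<alpha> + \<gamma>\<close>, \<open>c = \<alpha> + \<beta>\<close>, let \<open>s\<close>, \<open>t\<close>, \<open>u\<close> be the numbers of letters \<open>2\<close> on the
  \<open>\<beta>\<close> strands from \<open>V\<^sub>c\<close> to \<open>V\<^sub>a\<close>, on the left ends of the \<open>\<gamma>\<close> cups, and on the \<open>\<alpha>\<close> strands from \<open>V\<^sub>c\<close> to \<open>V\<^sub>b\<close>.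
  The right end of a cup carries the other letter, whence \<open>\<gamma> - t\<close>.
\<close>

definition cg_coeff :: "nat \<Rightarrow> nat \<Rightarrow> nat \<Rightarrow> nat \<Rightarrow> nat \<Rightarrow> nat \<Rightarrow> real" where
  "cg_coeff \<alpha> \<beta> \<gamma> i j k = (\<Sum>(s, t, u)\<in>{..\<beta>} \<times> {..\<gamma>} \<times> {..\<alpha>}.
     if i = s + t \<and> j = u + (\<gamma> - t) \<and> k = s + u
     then (- 1) ^ t * of_nat (\<beta> choose s) * of_nat (\<gamma> choose t) * of_nat (\<alpha> choose u) else 0)"

lemma neg_one_power_diff: "t \<le> n \<Longrightarrow> (- 1 :: 'a::comm_ring_1) ^ (n - t) = (- 1) ^ n * (- 1) ^ t"
  by (auto simp: minus_one_power_iff)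

text \<open>Mirror image of the vertex: \<open>s\<close> and \<open>u\<close> trade places and every
  cup is read from its right end, so \<open>t\<close> becomes \<open>\<gamma> - t\<close>. Each of
  the \<open>\<gamma>\<close> cups is antisymmetric and contributes one factor -1.\<close>

lemma cg_coeff_swap: "cg_coeff \<beta> \<alpha> \<gamma> j i k = (- 1) ^ \<gamma> * cg_coeff \<alpha> \<beta> \<gamma> i j k"
  unfolding cg_coeff_def sum_distrib_left
  by (rule sum.reindex_bij_witness[of _ "\<lambda>(s, t, u). (u, \<gamma> - t, s)" "\<lambda>(s, t, u). (u, \<gamma> - t, s)"])
     (auto simp: neg_one_power_diff binomial_symmetric[symmetric])

text \<open>Bending the leg \<open>V_b\<close> down on the right: the \<open>\<gamma>\<close> cups
  become strands running through and the \<open>\<alpha>\<close> strands become cups, so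
  \<open>t\<close> and \<open>u\<close> trade places. The sign changes from (-1)^t to (-1)^u, and
  \<open>j = u + (\<gamma> - t)\<close> makes the quotient depend on \<open>j\<close> and
  \<open>\<gamma>\<close> only.\<close>

lemma cg_coeff_bend_right:
  assumes "j \<le> \<alpha> + \<gamma>"
  shows "cg_coeff \<gamma> \<beta> \<alpha> k (\<alpha> + \<gamma> - j) i = (- 1) ^ (j + \<gamma>) * cg_coeff \<alpha> \<beta> \<gamma> i j k"
proof -
  have sign: "(- 1 :: real) ^ (u + (\<gamma> - t) + \<gamma>) * (- 1) ^ t = (- 1) ^ u" if "t \<le> \<gamma>" for t u
    using that by (auto simp: minus_one_power_iff)
  show ?thesis
    unfolding cg_coeff_def sum_distrib_left using assms
  proof (intro sum.reindex_bij_witness[of _ "\<lambda>(s, t, u). (s, u, t)" "\<lambda>(s, t, u). (s, u, t)"], goal_cases)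
    case (5 p)
    obtain s u t where p: "p = (s, u, t)" by (cases p)
    \<comment> \<open>With \<open>j \<le> \<alpha> + \<gamma>\<close> and the ranges of
      \<open>t\<close> and \<open>u\<close> all subtractions are exact, so the two support
      conditions are the same equations.\<close>
    have "k = s + u \<and> \<alpha> + \<gamma> - j = t + (\<alpha> - u) \<and> i = s + t
        \<longleftrightarrow> i = s + t \<and> j = u + (\<gamma> - t) \<and> k = s + u"
      using 5 by (auto simp: p)
    then show ?case
      using 5 sign[of t u] by (auto simp: p simp del: Nat.add_diff_assoc)
  qed auto
qed

text \<open>Bending \<open>V_a\<close> down on the left: cups and \<open>\<beta>\<close> strands are
  exchanged. A strand that comes from a cup carries the letter of its right end, whence
  \<open>\<gamma> - t\<close>, and the left end of a new cup carries the letter opposite to that of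
  the old strand, whence \<open>\<beta> - s\<close>.\<close>

lemma cg_coeff_bend_left:
  assumes "i \<le> \<beta> + \<gamma>"
  shows "cg_coeff \<alpha> \<gamma> \<beta> (\<beta> + \<gamma> - i) k j = (- 1) ^ (\<beta> + i) * cg_coeff \<alpha> \<beta> \<gamma> i j k"
proof -
  have sign: "(- 1 :: real) ^ (\<beta> + ((\<beta> - s) + t)) * (- 1) ^ t = (- 1) ^ s" if "s \<le> \<beta>" for s t
    using that by (auto simp: minus_one_power_iff)
  show ?thesis
    unfolding cg_coeff_def sum_distrib_left using assms
  proof (intro sum.reindex_bij_witness[of _ "\<lambda>(s, t, u). (\<gamma> - t, \<beta> - s, u)"
        "\<lambda>(s, t, u). (\<beta> - t, \<gamma> - s, u)"], goal_cases)
    case (5 p)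
    obtain s t u where p: "p = (s, t, u)" by (cases p)
    have "\<beta> + \<gamma> - i = s + t \<and> k = u + (\<beta> - t) \<and> j = s + u
        \<longleftrightarrow> i = (\<beta> - t) + (\<gamma> - s) \<and> j = u + (\<gamma> - (\<gamma> - s)) \<and> k = (\<beta> - t) + u"
      using 5 by (auto simp: p)
    then show ?case
      using 5 sign[of t "\<gamma> - s"] by (auto simp: p binomial_symmetric[symmetric] simp del: Nat.add_diff_assoc)
  qed auto
qed

section \<open>Generating polynomial of a vertex\<close>

lemma cg_contract:
  fixes F :: "nat \<Rightarrow> nat \<Rightarrow> nat \<Rightarrow> complex"
  shows "(\<Sum>i\<le>\<beta>+\<gamma>. \<Sum>j\<le>\<alpha>+\<gamma>. \<Sum>k\<le>\<alpha>+\<beta>. of_real (cg_coeff \<alpha> \<beta> \<gamma> i j k) * F i j k)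
    = (\<Sum>s\<le>\<beta>. \<Sum>t\<le>\<gamma>. \<Sum>u\<le>\<alpha>. (- 1) ^ t * of_nat (\<beta> choose s) * of_nat (\<gamma> choose t) *
        of_nat (\<alpha> choose u) * F (s + t) (u + (\<gamma> - t)) (s + u))"
proof -
  let ?I = "{..\<beta>+\<gamma>} \<times> {..\<alpha>+\<gamma>} \<times> {..\<alpha>+\<beta>}" and ?Q = "{..\<beta>} \<times> {..\<gamma>} \<times> {..\<alpha>}"
  define h where "h = (\<lambda>(s, t, u). (s + t, u + (\<gamma> - t), s + u))"
  define c :: "nat \<times> nat \<times> nat \<Rightarrow> complex" where "c = (\<lambda>(s, t, u). (- 1) ^ t * of_nat (\<beta> choose s) *
    of_nat (\<gamma> choose t) * of_nat (\<alpha> choose u))"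
  define G where "G = (\<lambda>(i, j, k). F i j k)"
  have cg: "complex_of_real (cg_coeff \<alpha> \<beta> \<gamma> i j k) = (\<Sum>q\<in>?Q. if (i, j, k) = h q then c q else 0)"
    for i j k
    unfolding cg_coeff_def of_real_sum h_def c_def
    by (intro sum.cong) (auto split: if_splits)
  have "(\<Sum>i\<le>\<beta>+\<gamma>. \<Sum>j\<le>\<alpha>+\<gamma>. \<Sum>k\<le>\<alpha>+\<beta>. of_real (cg_coeff \<alpha> \<beta> \<gamma> i j k) * F i j k)
      = (\<Sum>p\<in>?I. (\<Sum>q\<in>?Q. if p = h q then c q else 0) * G p)"
    by (simp add: sum.cartesian_product cg G_def case_prod_unfold)
  also have "\<dots> = (\<Sum>q\<in>?Q. \<Sum>p\<in>?I. if p = h q then c q * G p else 0)"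
    unfolding sum_distrib_right by (subst sum.swap) (intro sum.cong, auto)
  also have "\<dots> = (\<Sum>q\<in>?Q. c q * G (h q))"
  proof (rule sum.cong[OF refl])
    fix q assume "q \<in> ?Q"
    then have "h q \<in> ?I" by (auto simp: h_def)
    then show "(\<Sum>p\<in>?I. if p = h q then c q * G p else 0) = c q * G (h q)"
      by simp
  qed
  also have "\<dots> = (\<Sum>s\<le>\<beta>. \<Sum>t\<le>\<gamma>. \<Sum>u\<le>\<alpha>. (- 1) ^ t * of_nat (\<beta> choose s) * of_nat (\<gamma> choose t) *
        of_nat (\<alpha> choose u) * F (s + t) (u + (\<gamma> - t)) (s + u))"
    by (simp only: sum.cartesian_product c_def G_def h_def split_def fst_conv snd_conv)
  finally show ?thesis .
qed

lemma sum_product3: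
  fixes f :: "'a \<Rightarrow> 'd::comm_semiring_0"
  shows "(\<Sum>s\<in>A. f s) * (\<Sum>t\<in>B. g t) * (\<Sum>u\<in>C. h u) = (\<Sum>s\<in>A. \<Sum>t\<in>B. \<Sum>u\<in>C. f s * g t * h u)"
proof -
  have "(\<Sum>s\<in>A. f s) * (\<Sum>t\<in>B. g t) * (\<Sum>u\<in>C. h u)
      = (\<Sum>s\<in>A. (\<Sum>t\<in>B. f s * g t) * (\<Sum>u\<in>C. h u))"
    by (subst sum_product[of f A g B]) (rule sum_distrib_right)
  then show ?thesis
    by (simp only: sum_product)
qed

text \<open>In the symbolic method a vertex is a product of brackets: one determinant per cup and
  one pairing per through strand. Expanding the three powers binomially recovers the indices
  \<open>t\<close>, \<open>s\<close>, \<open>u\<close>. This form makes the invariance under SL(2)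
  visible.\<close>

lemma cg_generating:
  fixes A1 B1 A2 B2 D E :: complex
  shows "(\<Sum>i\<le>\<beta>+\<gamma>. \<Sum>j\<le>\<alpha>+\<gamma>. \<Sum>k\<le>\<alpha>+\<beta>. of_real (cg_coeff \<alpha> \<beta> \<gamma> i j k) *
      (A1 ^ (\<beta>+\<gamma>-i) * B1 ^ i * (A2 ^ (\<alpha>+\<gamma>-j) * B2 ^ j) * (D ^ (\<alpha>+\<beta>-k) * E ^ k)))
    = (A1 * B2 - B1 * A2) ^ \<gamma> * (A1 * D + B1 * E) ^ \<beta> * (A2 * D + B2 * E) ^ \<alpha>"
proof -
  have s: "(A1 * D + B1 * E) ^ \<beta> = (\<Sum>s\<le>\<beta>. of_nat (\<beta> choose s) * (B1 * E) ^ s * (A1 * D) ^ (\<beta> - s))"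
    using binomial_ring[of "B1 * E" "A1 * D" \<beta>] by (simp only: add.commute)
  have u: "(A2 * D + B2 * E) ^ \<alpha> = (\<Sum>u\<le>\<alpha>. of_nat (\<alpha> choose u) * (B2 * E) ^ u * (A2 * D) ^ (\<alpha> - u))"
    using binomial_ring[of "B2 * E" "A2 * D" \<alpha>] by (simp only: add.commute)
  have t: "(A1 * B2 - B1 * A2) ^ \<gamma> = (\<Sum>t\<le>\<gamma>. of_nat (\<gamma> choose t) * (- (B1 * A2)) ^ t * (A1 * B2) ^ (\<gamma> - t))"
    using binomial_ring[of "- (B1 * A2)" "A1 * B2" \<gamma>] by simp
  have "(A1 * B2 - B1 * A2) ^ \<gamma> * (A1 * D + B1 * E) ^ \<beta> * (A2 * D + B2 * E) ^ \<alpha>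
     = (\<Sum>s\<le>\<beta>. \<Sum>t\<le>\<gamma>. \<Sum>u\<le>\<alpha>. (of_nat (\<beta> choose s) * (B1 * E) ^ s * (A1 * D) ^ (\<beta> - s)) *
         (of_nat (\<gamma> choose t) * (- (B1 * A2)) ^ t * (A1 * B2) ^ (\<gamma> - t)) *
         (of_nat (\<alpha> choose u) * (B2 * E) ^ u * (A2 * D) ^ (\<alpha> - u)))"
    unfolding s t u by (subst sum_product3[symmetric]) (simp only: mult_ac)
  also have "\<dots> = (\<Sum>s\<le>\<beta>. \<Sum>t\<le>\<gamma>. \<Sum>u\<le>\<alpha>. (- 1) ^ t * of_nat (\<beta> choose s) * of_nat (\<gamma> choose t) *
        of_nat (\<alpha> choose u) * (A1 ^ (\<beta>+\<gamma>-(s+t)) * B1 ^ (s+t) * (A2 ^ (\<alpha>+\<gamma>-(u+(\<gamma>-t))) * B2 ^ (u+(\<gamma>-t)))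
        * (D ^ (\<alpha>+\<beta>-(s+u)) * E ^ (s+u))))"
  proof (intro sum.cong refl)
    fix s t u assume "s \<in> {..\<beta>}" "t \<in> {..\<gamma>}" "u \<in> {..\<alpha>}"
    then have e: "\<beta>+\<gamma>-(s+t) = (\<beta>-s)+(\<gamma>-t)" "\<alpha>+\<gamma>-(u+(\<gamma>-t)) = (\<alpha>-u)+t" "\<alpha>+\<beta>-(s+u) = (\<alpha>-u)+(\<beta>-s)"
      by auto
    show "(of_nat (\<beta> choose s) * (B1 * E) ^ s * (A1 * D) ^ (\<beta> - s)) *
         (of_nat (\<gamma> choose t) * (- (B1 * A2)) ^ t * (A1 * B2) ^ (\<gamma> - t)) *
         (of_nat (\<alpha> choose u) * (B2 * E) ^ u * (A2 * D) ^ (\<alpha> - u)) =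
       (- 1) ^ t * of_nat (\<beta> choose s) * of_nat (\<gamma> choose t) *
        of_nat (\<alpha> choose u) * (A1 ^ (\<beta>+\<gamma>-(s+t)) * B1 ^ (s+t) * (A2 ^ (\<alpha>+\<gamma>-(u+(\<gamma>-t))) * B2 ^ (u+(\<gamma>-t)))
        * (D ^ (\<alpha>+\<beta>-(s+u)) * E ^ (s+u)))"
      unfolding e power_add power_mult_distrib power_minus[of "B1 * A2"] by (simp only: mult_ac)
  qed
  also have "\<dots> = (\<Sum>i\<le>\<beta>+\<gamma>. \<Sum>j\<le>\<alpha>+\<gamma>. \<Sum>k\<le>\<alpha>+\<beta>. of_real (cg_coeff \<alpha> \<beta> \<gamma> i j k) *
      (A1 ^ (\<beta>+\<gamma>-i) * B1 ^ i * (A2 ^ (\<alpha>+\<gamma>-j) * B2 ^ j) * (D ^ (\<alpha>+\<beta>-k) * E ^ k)))"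
    by (rule cg_contract[symmetric])
  finally show ?thesis ..
qed

section \<open>The group action on symmetric tensors\<close>

text \<open>The entries of the tensor power of \<open>x\<close> in the basis of words.\<close>

definition ent :: "complex^2^2 \<Rightarrow> 2 list \<Rightarrow> 2 list \<Rightarrow> complex" where
  "ent x v w = (\<Prod>i<length w. x $ (v ! i) $ (w ! i))"

lemma ent_Nil [simp]: "ent x [] [] = 1"
  by (simp add: ent_def)

lemma ent_Cons [simp]: "ent x (a # v) (b # w) = x $ a $ b * ent x v w"
  unfolding ent_def length_Cons prod.lessThan_Suc_shift by simp

lemma ent_transpose: "length v = length w \<Longrightarrow> ent (transpose x) v w = ent x w v"
  by (simp add: ent_def transpose_def)

text \<open>The tensor power acts letter by letter: a letter \<open>b\<close> of \<open>w\<close>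
  contributes the linear form given by column \<open>b\<close> of \<open>x\<close>, evaluated at
  \<open>(A, B)\<close>.\<close>

lemma sum_ent:
  fixes A B :: complex
  shows "(\<Sum>v\<in>words (length w). ent x v w * (A ^ (length w - ht v) * B ^ ht v))
    = (x $ 1 $ 1 * A + x $ 2 $ 1 * B) ^ (length w - ht w) * (x $ 1 $ 2 * A + x $ 2 $ 2 * B) ^ ht w"
proof (induction w)
  case (Cons b w)
  let ?f = "\<lambda>v. ent x v w * (A ^ (length w - ht v) * B ^ ht v)"
  have "(\<Sum>v\<in>words (length (b # w)). ent x v (b # w) * (A ^ (length (b # w) - ht v) * B ^ ht v))
     = (\<Sum>v\<in>words (length w). (x $ 1 $ b * A + x $ 2 $ b * B) * ?f v)"
    unfolding length_Cons sum_words_Suc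
  proof (rule sum.cong[OF refl])
    fix v assume "v \<in> words (length w)"
    then have "Suc (length w) - ht v = Suc (length w - ht v)"
      by (simp add: Suc_diff_le ht_le_words)
    then show "ent x (1 # v) (b # w) * (A ^ (Suc (length w) - ht (1 # v)) * B ^ ht (1 # v)) +
        ent x (2 # v) (b # w) * (A ^ (Suc (length w) - ht (2 # v)) * B ^ ht (2 # v))
      = (x $ 1 $ b * A + x $ 2 $ b * B) * ?f v"
      by (simp add: algebra_simps)
  qed
  also have "\<dots> = (x $ 1 $ b * A + x $ 2 $ b * B) *
      ((x $ 1 $ 1 * A + x $ 2 $ 1 * B) ^ (length w - ht w) * (x $ 1 $ 2 * A + x $ 2 $ 2 * B) ^ ht w)"
    by (simp add: Cons.IH flip: sum_distrib_left)
  also have "\<dots> = (x $ 1 $ 1 * A + x $ 2 $ 1 * B) ^ (length (b # w) - ht (b # w)) *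
      (x $ 1 $ 2 * A + x $ 2 $ 2 * B) ^ ht (b # w)"
    using exhaust_2[of b] ht_le[of w] by (auto simp: Suc_diff_le)
  finally show ?case .
qed simp

text \<open>On orbit sums \<open>x\<close> has the entries
  \<open>grp n x i k / (n choose i)\<close>; the undivided block sum is kept because it is
  compatible with transposition.\<close>

definition grp :: "nat \<Rightarrow> complex^2^2 \<Rightarrow> nat \<Rightarrow> nat \<Rightarrow> complex" where
  "grp n x i k = (\<Sum>v\<in>cls n i. \<Sum>w\<in>cls n k. ent x v w)"

lemma grp_transpose: "grp n (transpose x) i k = grp n x k i"
proof -
  have "grp n (transpose x) i k = (\<Sum>v\<in>cls n i. \<Sum>w\<in>cls n k. ent x w v)"
    unfolding grp_def by (intro sum.cong refl ent_transpose) (simp add: cls_def words_def)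
  then show ?thesis
    unfolding grp_def by (simp only: sum.swap[of _ "cls n i"])
qed

lemma grp_col:
  "(\<Sum>i\<le>n. grp n x i k * z ^ i)
    = of_nat (n choose k) * ((x $ 1 $ 1 + x $ 2 $ 1 * z) ^ (n - k) * (x $ 1 $ 2 + x $ 2 $ 2 * z) ^ k)"
proof -
  have "(\<Sum>i\<le>n. grp n x i k * z ^ i) = (\<Sum>i\<le>n. \<Sum>v\<in>cls n i. \<Sum>w\<in>cls n k. ent x v w * z ^ ht v)"
    unfolding grp_def sum_distrib_right by (intro sum.cong refl) (simp add: cls_def)
  also have "\<dots> = (\<Sum>v\<in>words n. \<Sum>w\<in>cls n k. ent x v w * z ^ ht v)"
    by (rule sum_words_cls[symmetric])
  also have "\<dots> = (\<Sum>w\<in>cls n k. \<Sum>v\<in>words n. ent x v w * z ^ ht v)"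
    by (rule sum.swap)
  also have "\<dots> = (\<Sum>w\<in>cls n k. (x $ 1 $ 1 + x $ 2 $ 1 * z) ^ (n - k) * (x $ 1 $ 2 + x $ 2 $ 2 * z) ^ k)"
  proof (rule sum.cong[OF refl])
    fix w assume "w \<in> cls n k"
    then show "(\<Sum>v\<in>words n. ent x v w * z ^ ht v)
        = (x $ 1 $ 1 + x $ 2 $ 1 * z) ^ (n - k) * (x $ 1 $ 2 + x $ 2 $ 2 * z) ^ k"
      using sum_ent[of x w 1 z] by (simp add: cls_def words_def)
  qed
  finally show ?thesis
    by (simp add: card_cls)
qed

lemma grp_row:
  "(\<Sum>k\<le>n. grp n x i k * z ^ k)
    = of_nat (n choose i) * ((x $ 1 $ 1 + x $ 1 $ 2 * z) ^ (n - i) * (x $ 2 $ 1 + x $ 2 $ 2 * z) ^ i)"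
  using grp_col[of n "transpose x" i z] by (simp add: grp_transpose) (simp add: transpose_def)

section \<open>Invariance of a vertex under the group\<close>

lemma polyfun3_eqD:
  fixes F G :: "nat \<Rightarrow> nat \<Rightarrow> nat \<Rightarrow> complex"
  assumes eq: "\<And>x y z. (\<Sum>i\<le>a. \<Sum>j\<le>b. \<Sum>k\<le>c. F i j k * (x ^ i * y ^ j * z ^ k))
      = (\<Sum>i\<le>a. \<Sum>j\<le>b. \<Sum>k\<le>c. G i j k * (x ^ i * y ^ j * z ^ k))"
    and "i \<le> a" "j \<le> b" "k \<le> c"
  shows "F i j k = G i j k"
proof -
  have r: "(\<Sum>i\<le>a. \<Sum>j\<le>b. \<Sum>k\<le>c. H i j k * (x ^ i * y ^ j * z ^ k))
     = (\<Sum>i\<le>a. (\<Sum>j\<le>b. (\<Sum>k\<le>c. H i j k * z ^ k) * y ^ j) * x ^ i)"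
    for H :: "nat \<Rightarrow> nat \<Rightarrow> nat \<Rightarrow> complex" and x y z
    by (simp add: sum_distrib_right sum_distrib_left mult_ac)
  have 1: "(\<Sum>j\<le>b. (\<Sum>k\<le>c. F i j k * z ^ k) * y ^ j) = (\<Sum>j\<le>b. (\<Sum>k\<le>c. G i j k * z ^ k) * y ^ j)" for y z
    using eq[unfolded r] \<open>i \<le> a\<close> polyfun_eq_coeffs[of "\<lambda>i. \<Sum>j\<le>b. (\<Sum>k\<le>c. F i j k * z ^ k) * y ^ j" a
        "\<lambda>i. \<Sum>j\<le>b. (\<Sum>k\<le>c. G i j k * z ^ k) * y ^ j"] by blast
  have 2: "(\<Sum>k\<le>c. F i j k * z ^ k) = (\<Sum>k\<le>c. G i j k * z ^ k)" for z
    using 1 polyfun_eq_coeffs[of "\<lambda>j. \<Sum>k\<le>c. F i j k * z ^ k" b "\<lambda>j. \<Sum>k\<le>c. G i j k * z ^ k"] \<open>j \<le> b\<close> by blast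
  show ?thesis
    using 2 polyfun_eq_coeffs[of "\<lambda>k. F i j k" c "\<lambda>k. G i j k"] \<open>k \<le> c\<close> by blast
qed

lemma sum_swap3:
  "(\<Sum>i\<in>I. \<Sum>p\<in>P. \<Sum>q\<in>Q. f i p q) = (\<Sum>p\<in>P. \<Sum>q\<in>Q. \<Sum>i\<in>I. f i p q)"
  by (subst sum.swap, rule sum.cong[OF refl], rule sum.swap)

lemma sum_swap4:
  "(\<Sum>i\<in>I. \<Sum>j\<in>J. \<Sum>p\<in>P. \<Sum>q\<in>Q. f i j p q) = (\<Sum>p\<in>P. \<Sum>q\<in>Q. \<Sum>i\<in>I. \<Sum>j\<in>J. f i j p q)"
  by (simp only: sum_swap3[of _ Q P J] sum_swap3[of _ Q P I])

lemma sum_factor2: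
  fixes R :: "'a \<Rightarrow> 'b \<Rightarrow> 'c::comm_semiring_0"
  shows "(\<Sum>i\<in>I. \<Sum>j\<in>J. (\<Sum>p\<in>P. \<Sum>q\<in>Q. g i p * h j q * R p q) * (u i * v j))
    = (\<Sum>p\<in>P. \<Sum>q\<in>Q. R p q * ((\<Sum>i\<in>I. g i p * u i) * (\<Sum>j\<in>J. h j q * v j)))"
proof -
  have "(\<Sum>i\<in>I. \<Sum>j\<in>J. (\<Sum>p\<in>P. \<Sum>q\<in>Q. g i p * h j q * R p q) * (u i * v j))
     = (\<Sum>i\<in>I. \<Sum>j\<in>J. \<Sum>p\<in>P. \<Sum>q\<in>Q. R p q * ((g i p * u i) * (h j q * v j)))"
    unfolding sum_distrib_right by (simp only: mult_ac)
  also have "\<dots> = (\<Sum>p\<in>P. \<Sum>q\<in>Q. \<Sum>i\<in>I. \<Sum>j\<in>J. R p q * ((g i p * u i) * (h j q * v j)))"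
    by (rule sum_swap4)
  also have "\<dots> = (\<Sum>p\<in>P. \<Sum>q\<in>Q. R p q * ((\<Sum>i\<in>I. g i p * u i) * (\<Sum>j\<in>J. h j q * v j)))"
    unfolding sum_product by (simp only: sum_distrib_left)
  finally show ?thesis .
qed

lemma sum_pull_last:
  fixes F :: "'a \<Rightarrow> 'b \<Rightarrow> 'c \<Rightarrow> 'd::comm_semiring_0"
  shows "(\<Sum>i\<in>I. \<Sum>j\<in>J. \<Sum>k\<in>K. F i j k * (u i j * v k)) = (\<Sum>k\<in>K. (\<Sum>i\<in>I. \<Sum>j\<in>J. F i j k * u i j) * v k)"
  unfolding sum_distrib_right mult.assoc by (rule sum_swap3[symmetric])

text \<open>Both sides are compared through their generating polynomials in \<open>z1\<close>,
  \<open>z2\<close>, \<open>y\<close>. On the left the transpose of \<open>x\<close> acts on the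
  points (1, z1) and (1, z2), on the right \<open>x\<close> acts on the point (1, y). The pairings
  agree by adjointness, and the bracket is multiplied by \<open>det x = 1\<close>.\<close>

lemma cg_coeff_equivariant:
  assumes "det x = 1" and abc: "a = \<beta> + \<gamma>" "b = \<alpha> + \<gamma>" "c = \<alpha> + \<beta>" and "i \<le> a" "j \<le> b" "k \<le> c"
  shows "(\<Sum>p\<le>a. \<Sum>q\<le>b. (grp a x i p / of_nat (a choose p)) * (grp b x j q / of_nat (b choose q)) *
      of_real (cg_coeff \<alpha> \<beta> \<gamma> p q k))
    = (\<Sum>r\<le>c. of_real (cg_coeff \<alpha> \<beta> \<gamma> i j r) * (grp c x r k / of_nat (c choose r)))" (is "?F i j k = ?G i j k")
proof (rule polyfun3_eqD[where F = ?F and G = ?G, OF _ assms(5-7)])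
  fix z1 z2 y :: complex
  let ?R = "\<lambda>i j k. complex_of_real (cg_coeff \<alpha> \<beta> \<gamma> i j k)"
  let ?x11 = "x $ 1 $ 1" and ?x12 = "x $ 1 $ 2" and ?x21 = "x $ 2 $ 1" and ?x22 = "x $ 2 $ 2"
  have col: "(\<Sum>i\<le>n. grp n x i p / of_nat (n choose p) * z ^ i)
      = (?x11 + ?x21 * z) ^ (n - p) * (?x12 + ?x22 * z) ^ p" if "p \<in> {..n}" for n p z
    using grp_col[of n x p z] that
    by (simp add: mult.commute[of "_ / _"] sum_divide_distrib[symmetric] mult.commute field_simps)
  have row: "(\<Sum>k\<le>n. grp n x i k / of_nat (n choose i) * z ^ k)
      = (?x11 + ?x12 * z) ^ (n - i) * (?x21 + ?x22 * z) ^ i" if "i \<in> {..n}" for n i z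
    using grp_row[of n x i z] that
    by (simp add: mult.commute[of "_ / _"] sum_divide_distrib[symmetric] mult.commute field_simps)
  \<comment> \<open>The bracket of the two transformed points is \<open>det x\<close> times the
    original bracket.\<close>
  have det: "(?x11 + ?x21 * z1) * (?x12 + ?x22 * z2) - (?x12 + ?x22 * z1) * (?x11 + ?x21 * z2) = z2 - z1"
  proof -
    have "(?x11 + ?x21 * z1) * (?x12 + ?x22 * z2) - (?x12 + ?x22 * z1) * (?x11 + ?x21 * z2)
      = (?x11 * ?x22 - ?x12 * ?x21) * (z2 - z1)"
      by algebra
    then show ?thesis using assms(1) by (simp add: det_2)
  qed
  have "(\<Sum>i\<le>a. \<Sum>j\<le>b. \<Sum>k\<le>c. ?F i j k * (z1 ^ i * z2 ^ j * y ^ k))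
     = (\<Sum>k\<le>c. (\<Sum>i\<le>a. \<Sum>j\<le>b. ?F i j k * (z1 ^ i * z2 ^ j)) * y ^ k)"
    by (rule sum_pull_last)
  also have "\<dots> = (\<Sum>k\<le>c. (\<Sum>p\<le>a. \<Sum>q\<le>b. ?R p q k *
      (((?x11 + ?x21 * z1) ^ (a - p) * (?x12 + ?x22 * z1) ^ p) *
       ((?x11 + ?x21 * z2) ^ (b - q) * (?x12 + ?x22 * z2) ^ q))) * y ^ k)"
    unfolding sum_factor2 by (intro sum.cong refl arg_cong2[where f = "(*)"] col) auto
  also have "\<dots> = (\<Sum>p\<le>a. \<Sum>q\<le>b. \<Sum>k\<le>c. ?R p q k *
      (((?x11 + ?x21 * z1) ^ (a - p) * (?x12 + ?x22 * z1) ^ p) *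
       ((?x11 + ?x21 * z2) ^ (b - q) * (?x12 + ?x22 * z2) ^ q) * (1 ^ (c - k) * y ^ k)))"
    by (simp only: sum_pull_last power_one mult_1_left)
  also have "\<dots> = (z2 - z1) ^ \<gamma> * (?x11 + ?x21 * z1 + (?x12 + ?x22 * z1) * y) ^ \<beta>
      * (?x11 + ?x21 * z2 + (?x12 + ?x22 * z2) * y) ^ \<alpha>"
    unfolding abc cg_generating det by simp
  also have "\<dots> = (z2 - z1) ^ \<gamma> * (1 * (?x11 + ?x12 * y) + z1 * (?x21 + ?x22 * y)) ^ \<beta>
      * (1 * (?x11 + ?x12 * y) + z2 * (?x21 + ?x22 * y)) ^ \<alpha>"
    by (simp add: algebra_simps)
  also have "\<dots> = (1 * z2 - z1 * 1) ^ \<gamma> * (1 * (?x11 + ?x12 * y) + z1 * (?x21 + ?x22 * y)) ^ \<beta>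
      * (1 * (?x11 + ?x12 * y) + z2 * (?x21 + ?x22 * y)) ^ \<alpha>"
    by simp
  also have "\<dots> = (\<Sum>i\<le>a. \<Sum>j\<le>b. \<Sum>r\<le>c. ?R i j r *
      (1 ^ (a - i) * z1 ^ i * (1 ^ (b - j) * z2 ^ j) *
       ((?x11 + ?x12 * y) ^ (c - r) * (?x21 + ?x22 * y) ^ r)))"
    unfolding abc cg_generating[symmetric] ..
  also have "\<dots> = (\<Sum>i\<le>a. \<Sum>j\<le>b. \<Sum>r\<le>c. ?R i j r *
      (z1 ^ i * z2 ^ j * (\<Sum>k\<le>c. grp c x r k / of_nat (c choose r) * y ^ k)))"
    by (intro sum.cong refl) (simp only: row power_one mult_1_left)
  also have "\<dots> = (\<Sum>i\<le>a. \<Sum>j\<le>b. \<Sum>k\<le>c. ?G i j k * (z1 ^ i * z2 ^ j * y ^ k))"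
    unfolding sum_distrib_left sum_distrib_right
    by (rule sum.cong[OF refl], rule sum.cong[OF refl], subst sum.swap) (simp only: mult_ac)
  finally show "(\<Sum>i\<le>a. \<Sum>j\<le>b. \<Sum>k\<le>c. ?F i j k * (z1 ^ i * z2 ^ j * y ^ k))
      = (\<Sum>i\<le>a. \<Sum>j\<le>b. \<Sum>k\<le>c. ?G i j k * (z1 ^ i * z2 ^ j * y ^ k))" .
qed

section \<open>Equivariance and Schur's lemma\<close>

definition sqrt_choose :: "nat \<Rightarrow> nat \<Rightarrow> real" where
  "sqrt_choose n k = sqrt (of_nat (n choose k))"

lemma sqrt_choose_pos: "k \<le> n \<Longrightarrow> sqrt_choose n k > 0"
  by (simp add: sqrt_choose_def)

lemma sqrt_choose_nonzero: "k \<le> n \<Longrightarrow> sqrt_choose n k \<noteq> 0"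
  using sqrt_choose_pos[of k n] by simp

lemma sqrt_choose_mult: "sqrt_choose n k * sqrt_choose n k = of_nat (n choose k)"
  by (simp add: sqrt_choose_def)

lemma of_nat_choose: "of_nat (n choose k) = complex_of_real (sqrt_choose n k) * complex_of_real (sqrt_choose n k)"
  by (simp only: of_real_mult[symmetric] sqrt_choose_mult of_real_of_nat_eq)

lemma sqrt_choose_diff: "k \<le> n \<Longrightarrow> sqrt_choose n (n - k) = sqrt_choose n k"
  by (simp add: sqrt_choose_def binomial_symmetric[of k])

text \<open>
  After rescaling the basis vectors of \<open>V\<^sub>n\<close> to unit vectors, the matrix of \<open>proj a b c\<close> is the transpose of
  that of \<open>iota a b c\<close>; its entries are the numbers \<open>cg a b c i j k\<close>. The vertex can be rotated at no more
  cost than a sign, see \<open>cg_swap\<close>, \<open>cg_bend_right\<close> and \<open>cg_bend_left\<close>.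
\<close>

definition cg :: "nat \<Rightarrow> nat \<Rightarrow> nat \<Rightarrow> nat \<Rightarrow> nat \<Rightarrow> nat \<Rightarrow> real" where
  "cg a b c i j k = (if admissible a b c
     then cg_coeff ((b + c - a) div 2) ((a + c - b) div 2) ((a + b - c) div 2) i j k
       / (sqrt_choose a i * sqrt_choose b j * sqrt_choose c k)
     else 0)"

lemma admissible_iff: "admissible a b c \<longleftrightarrow> even (a + b + c) \<and> a \<le> b + c \<and> b \<le> a + c \<and> c \<le> a + b"
proof
  assume *: "even (a + b + c) \<and> a \<le> b + c \<and> b \<le> a + c \<and> c \<le> a + b"
  then obtain s where "a + b + c = 2 * s" unfolding dvd_def by blast
  with * have "2 * (s - a) + a = b + c \<and> 2 * (s - b) + b = a + c \<and> 2 * (s - c) + c = a + b"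
    by auto
  then show "admissible a b c"
    unfolding admissible_def by blast
next
  assume "admissible a b c"
  then obtain \<alpha> \<beta> \<gamma> where *: "2 * \<alpha> + a = b + c" "2 * \<beta> + b = a + c" "2 * \<gamma> + c = a + b"
    unfolding admissible_def by blast
  then have "a + b + c = 2 * (\<alpha> + \<beta> + \<gamma>)" by simp
  then have "even (a + b + c)" by simp
  with * show "even (a + b + c) \<and> a \<le> b + c \<and> b \<le> a + c \<and> c \<le> a + b" by simp
qed

lemma admissibleE:
  assumes "admissible a b c"
  obtains \<alpha> \<beta> \<gamma> where "a = \<beta> + \<gamma>" "b = \<alpha> + \<gamma>" "c = \<alpha> + \<beta>"
proof -
  obtain \<alpha> \<beta> \<gamma> where "2 * \<alpha> + a = b + c" "2 * \<beta> + b = a + c" "2 * \<gamma> + c = a + b"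
    using assms unfolding admissible_def by blast
  then have "a = \<beta> + \<gamma>" "b = \<alpha> + \<gamma>" "c = \<alpha> + \<beta>" by auto
  then show ?thesis by (rule that)
qed

lemma admissible_sum [simp]: "admissible (\<beta> + \<gamma>) (\<alpha> + \<gamma>) (\<alpha> + \<beta>)"
  by (auto simp: admissible_iff)

lemma cg_eq: "cg (\<beta> + \<gamma>) (\<alpha> + \<gamma>) (\<alpha> + \<beta>) i j k
    = cg_coeff \<alpha> \<beta> \<gamma> i j k / (sqrt_choose (\<beta> + \<gamma>) i * sqrt_choose (\<alpha> + \<gamma>) j * sqrt_choose (\<alpha> + \<beta>) k)"
proof -
  have "(\<alpha> + \<gamma> + (\<alpha> + \<beta>) - (\<beta> + \<gamma>)) div 2 = \<alpha>" "(\<beta> + \<gamma> + (\<alpha> + \<beta>) - (\<alpha> + \<gamma>)) div 2 = \<beta>"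
    "(\<beta> + \<gamma> + (\<alpha> + \<gamma>) - (\<alpha> + \<beta>)) div 2 = \<gamma>"
    by auto
  then show ?thesis by (simp only: cg_def admissible_sum if_True)
qed

lemma cg_swap: "cg b a c j i k = (- 1) ^ ((a + b - c) div 2) * cg a b c i j k"
proof (cases "admissible a b c")
  case True
  then obtain \<alpha> \<beta> \<gamma> where e: "a = \<beta> + \<gamma>" "b = \<alpha> + \<gamma>" "c = \<alpha> + \<beta>" by (rule admissibleE)
  have g: "(a + b - c) div 2 = \<gamma>" by (simp add: e)
  have "cg b a c j i k = cg (\<alpha> + \<gamma>) (\<beta> + \<gamma>) (\<beta> + \<alpha>) j i k"
    by (simp only: e add.commute)
  also have "\<dots> = cg_coeff \<beta> \<alpha> \<gamma> j i k / (sqrt_choose b j * sqrt_choose a i * sqrt_choose c k)"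
    by (simp only: cg_eq) (simp only: e add.commute)
  finally show ?thesis
    by (simp add: g cg_coeff_swap[of \<beta> \<alpha> \<gamma> j i k] e cg_eq mult_ac)
qed (auto simp: cg_def admissible_iff)

lemma cg_bend_right:
  assumes "j \<le> b"
  shows "cg c b a k (b - j) i = (- 1) ^ (j + (a + b - c) div 2) * cg a b c i j k"
proof (cases "admissible a b c")
  case True
  then obtain \<alpha> \<beta> \<gamma> where e: "a = \<beta> + \<gamma>" "b = \<alpha> + \<gamma>" "c = \<alpha> + \<beta>" by (rule admissibleE)
  have g: "(a + b - c) div 2 = \<gamma>" by (simp add: e)
  have "cg c b a k (b - j) i = cg (\<beta> + \<alpha>) (\<gamma> + \<alpha>) (\<gamma> + \<beta>) k (b - j) i"
    by (simp only: e add.commute)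
  also have "\<dots> = cg_coeff \<gamma> \<beta> \<alpha> k (b - j) i / (sqrt_choose c k * sqrt_choose b (b - j) * sqrt_choose a i)"
    by (simp only: cg_eq) (simp only: e add.commute)
  finally show ?thesis
    using assms by (simp add: g cg_coeff_bend_right[of j \<alpha> \<gamma> \<beta> k i] e cg_eq sqrt_choose_diff mult_ac)
qed (auto simp: cg_def admissible_iff)

lemma cg_bend_left:
  assumes "i \<le> a"
  shows "cg a c b (a - i) k j = (- 1) ^ ((a + c - b) div 2 + i) * cg a b c i j k"
proof (cases "admissible a b c")
  case True
  then obtain \<alpha> \<beta> \<gamma> where e: "a = \<beta> + \<gamma>" "b = \<alpha> + \<gamma>" "c = \<alpha> + \<beta>" by (rule admissibleE)
  have g: "(a + c - b) div 2 = \<beta>" by (simp add: e)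
  have "cg a c b (a - i) k j = cg (\<gamma> + \<beta>) (\<alpha> + \<beta>) (\<alpha> + \<gamma>) (a - i) k j"
    by (simp only: e add.commute)
  also have "\<dots> = cg_coeff \<alpha> \<gamma> \<beta> (a - i) k j / (sqrt_choose a (a - i) * sqrt_choose c k * sqrt_choose b j)"
    by (simp only: cg_eq) (simp only: e add.commute)
  finally show ?thesis
    using assms by (simp add: g cg_coeff_bend_left[of i \<beta> \<gamma> \<alpha> k j] e cg_eq sqrt_choose_diff mult_ac)
qed (auto simp: cg_def admissible_iff)

text \<open>The matrix of \<open>x\<close> on \<open>V_n\<close> in unit vectors. Splitting the
  binomial divisor of \<open>grp\<close> into two square roots keeps the compatibility with
  transposition, which takes the place of an inner product.\<close>

definition rho :: "nat \<Rightarrow> complex^2^2 \<Rightarrow> nat \<Rightarrow> nat \<Rightarrow> complex" where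
  "rho n x i k = grp n x i k / of_real (sqrt_choose n i * sqrt_choose n k)"

lemma rho_transpose: "rho n (transpose x) i k = rho n x k i"
  by (simp add: rho_def grp_transpose mult.commute)

lemma cg_equivariant:
  assumes "det x = 1" "i \<le> a" "j \<le> b" "k \<le> c"
  shows "(\<Sum>p\<le>a. \<Sum>q\<le>b. rho a x i p * rho b x j q * of_real (cg a b c p q k))
    = (\<Sum>r\<le>c. of_real (cg a b c i j r) * rho c x r k)"
proof (cases "admissible a b c")
  case True
  then obtain \<alpha> \<beta> \<gamma> where e: "a = \<beta> + \<gamma>" "b = \<alpha> + \<gamma>" "c = \<alpha> + \<beta>" by (rule admissibleE)
  let ?d = "complex_of_real (sqrt_choose a i * sqrt_choose b j * sqrt_choose c k)"
  have "(\<Sum>p\<le>a. \<Sum>q\<le>b. rho a x i p * rho b x j q * of_real (cg a b c p q k))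
     = (\<Sum>p\<le>a. \<Sum>q\<le>b. (grp a x i p / of_nat (a choose p)) * (grp b x j q / of_nat (b choose q)) *
      of_real (cg_coeff \<alpha> \<beta> \<gamma> p q k)) / ?d"
    unfolding sum_divide_distrib e by (simp add: cg_eq rho_def of_nat_choose mult_ac)
  also have "\<dots> = (\<Sum>r\<le>c. of_real (cg_coeff \<alpha> \<beta> \<gamma> i j r) * (grp c x r k / of_nat (c choose r))) / ?d"
    by (subst cg_coeff_equivariant[OF assms(1) e assms(2-4)]) rule
  also have "\<dots> = (\<Sum>r\<le>c. of_real (cg a b c i j r) * rho c x r k)"
    unfolding sum_divide_distrib e by (simp add: cg_eq rho_def of_nat_choose mult_ac)
  finally show ?thesis .
qed (simp add: cg_def)

text \<open>\<open>X\<close> is the matrix of an intertwiner from the space indexed by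
  \<open>B\<close> to the one indexed by \<open>A\<close>. The index types are left free so that
  pairs and triples of indices can stand for tensor products.\<close>

definition equi :: "'a set \<Rightarrow> (complex^2^2 \<Rightarrow> 'a \<Rightarrow> 'a \<Rightarrow> complex) \<Rightarrow> 'b set \<Rightarrow>
    (complex^2^2 \<Rightarrow> 'b \<Rightarrow> 'b \<Rightarrow> complex) \<Rightarrow> ('a \<Rightarrow> 'b \<Rightarrow> complex) \<Rightarrow> bool" where
  "equi A R B S X \<longleftrightarrow> (\<forall>x. det x = 1 \<longrightarrow> (\<forall>i\<in>A. \<forall>k\<in>B.
     (\<Sum>p\<in>A. R x i p * X p k) = (\<Sum>r\<in>B. X i r * S x r k)))"

lemma sum_mult_assoc:
  fixes f :: "'a \<Rightarrow> 'c::comm_semiring_0"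
  shows "(\<Sum>p\<in>A. f p * (\<Sum>r\<in>B. g p r * h r)) = (\<Sum>r\<in>B. (\<Sum>p\<in>A. f p * g p r) * h r)"
  unfolding sum_distrib_left sum_distrib_right mult.assoc by (rule sum.swap)

lemma equi_compose:
  assumes X: "equi A R B S X" and Y: "equi B S C T Y"
  shows "equi A R C T (\<lambda>i k. \<Sum>r\<in>B. X i r * Y r k)"
  unfolding equi_def
proof (intro allI impI ballI)
  fix x :: "complex^2^2" and i k assume x: "det x = 1" and ik: "i \<in> A" "k \<in> C"
  have "(\<Sum>p\<in>A. R x i p * (\<Sum>r\<in>B. X p r * Y r k)) = (\<Sum>r\<in>B. (\<Sum>s\<in>B. X i s * S x s r) * Y r k)"
    unfolding sum_mult_assoc using X x ik by (intro sum.cong) (auto simp: equi_def)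
  also have "\<dots> = (\<Sum>s\<in>B. X i s * (\<Sum>t\<in>C. Y s t * T x t k))"
    unfolding sum_mult_assoc[symmetric] using Y x ik by (intro sum.cong) (auto simp: equi_def)
  finally show "(\<Sum>p\<in>A. R x i p * (\<Sum>r\<in>B. X p r * Y r k)) = (\<Sum>t\<in>C. (\<Sum>s\<in>B. X i s * Y s t) * T x t k)"
    by (simp only: sum_mult_assoc)
qed

text \<open>SL(2) is closed under transposition, so the intertwining relation may be used at the
  transpose of \<open>x\<close> and then transposed as a whole. This turns a splitting vertex into a
  fusing one.\<close>

lemma equi_transpose:
  assumes X: "equi A R B S X" and R: "\<And>x i p. R (transpose x) i p = R x p i"
    and S: "\<And>x i p. S (transpose x) i p = S x p i"
  shows "equi B S A R (\<lambda>i k. X k i)"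
  unfolding equi_def
proof (intro allI impI ballI)
  fix x :: "complex^2^2" and i k assume x: "det x = 1" and ik: "i \<in> B" "k \<in> A"
  have "(\<Sum>p\<in>A. R (transpose x) k p * X p i) = (\<Sum>r\<in>B. X k r * S (transpose x) r i)"
    using X x ik by (auto simp: equi_def det_transpose)
  then show "(\<Sum>p\<in>B. S x i p * X k p) = (\<Sum>r\<in>A. X r i * R x r k)"
    by (simp add: R S mult.commute)
qed

text \<open>The first of two test elements for Schur's lemma. It acts on the \<open>i\<close>-th
  basis vector of \<open>V_n\<close> by 2^(n - 2i), so its eigenvalues separate weights. The second,
  \<open>unip_elem\<close>, sends \<open>e_1\<close> to \<open>e_1 + e_2\<close>, so it spreads the
  highest weight vector over all basis vectors with nonzero coefficients.\<close>

definition diag_elem :: "complex^2^2" where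
  "diag_elem = vector [vector [2, 0], vector [0, 1/2]]"

definition unip_elem :: "complex^2^2" where
  "unip_elem = vector [vector [1, 0], vector [1, 1]]"

lemma det_diag_elem: "det diag_elem = 1"
  by (simp add: diag_elem_def det_2)

lemma det_unip_elem: "det unip_elem = 1"
  by (simp add: unip_elem_def det_2)

lemma rho_diag_elem:
  assumes "i \<le> n" "k \<le> n"
  shows "rho n diag_elem i k = (if i = k then 2 ^ (n - k) * (1 / 2) ^ k else 0)"
proof -
  have "(\<Sum>i\<le>n. grp n diag_elem i k * z ^ i)
      = (\<Sum>i\<le>n. (if i = k then of_nat (n choose k) * (2 ^ (n - k) * (1 / 2) ^ k) else 0) * z ^ i)" for z
    using assms by (simp add: grp_col if_distrib[of "\<lambda>y. y * _"] cong: if_cong)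
      (simp add: diag_elem_def power_divide)
  then have "grp n diag_elem i k = (if i = k then of_nat (n choose k) * (2 ^ (n - k) * (1 / 2) ^ k) else 0)"
    using assms(1) polyfun_eq_coeffs[of "\<lambda>i. grp n diag_elem i k" n
      "\<lambda>i. if i = k then of_nat (n choose k) * (2 ^ (n - k) * (1 / 2) ^ k) else 0"] by blast
  then show ?thesis
    using assms sqrt_choose_nonzero[of k n] by (simp add: rho_def of_nat_choose)
qed

lemma rho_unip_elem:
  assumes "i \<le> n"
  shows "rho n unip_elem i 0 = of_real (sqrt_choose n i)"
proof -
  have "(\<Sum>i\<le>n. grp n unip_elem i 0 * z ^ i) = (\<Sum>i\<le>n. of_nat (n choose i) * z ^ i)" for z
    using binomial_ring[of z 1 n] by (simp add: grp_col add.commute) (simp add: unip_elem_def add.commute)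
  then have "grp n unip_elem i 0 = of_nat (n choose i)"
    using assms polyfun_eq_coeffs[of "\<lambda>i. grp n unip_elem i 0" n "\<lambda>i. of_nat (n choose i)"] by blast
  also have "\<dots> = of_real (sqrt_choose n i) * of_real (sqrt_choose n i)"
    by (rule of_nat_choose)
  finally show ?thesis
    using sqrt_choose_nonzero[OF assms] sqrt_choose_def[of n 0] by (simp add: rho_def)
qed

text \<open>A nonzero entry forces equal eigenvalues of \<open>diag_elem\<close>; the equality of
  weights is written additively to avoid truncated subtraction.\<close>

lemma equi_weight:
  assumes M: "equi {..m} (rho m) {..n} (rho n) M" and "i \<le> m" "k \<le> n" "M i k \<noteq> 0"
  shows "n + 2 * i = m + 2 * k"
proof -
  have "(\<Sum>p\<le>m. rho m diag_elem i p * M p k) = (\<Sum>r\<le>n. M i r * rho n diag_elem r k)"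
    using M assms(2,3) det_diag_elem by (auto simp: equi_def)
  moreover have "(\<Sum>p\<le>m. rho m diag_elem i p * M p k) = 2 ^ (m - i) * (1 / 2) ^ i * M i k"
    using assms(2) by (simp add: rho_diag_elem if_distrib[of "\<lambda>y. y * _"] cong: if_cong)
  moreover have "(\<Sum>r\<le>n. M i r * rho n diag_elem r k) = M i k * (2 ^ (n - k) * (1 / 2) ^ k)"
    using assms(3) by (simp add: rho_diag_elem if_distrib[of "\<lambda>y. _ * y"] cong: if_cong)
  ultimately have "(2::complex) ^ (m - i) * (1 / 2) ^ i = 2 ^ (n - k) * (1 / 2) ^ k"
    using assms(4) by simp
  then have "(2::complex) ^ (m - i + k) = 2 ^ (n - k + i)"
    by (simp add: field_simps power_add)
  then have "complex_of_nat (2 ^ (m - i + k)) = complex_of_nat (2 ^ (n - k + i))"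
    by simp
  then have "(2::nat) ^ (m - i + k) = 2 ^ (n - k + i)"
    by (simp only: of_nat_eq_iff)
  then have "m - i + k = n - k + i"
    by simp
  then show ?thesis using assms(2,3) by simp
qed

text \<open>\<open>V_n\<close> has a highest weight that \<open>V_m\<close> lacks, so column 0
  vanishes; the unipotent element carries this over to the other columns.\<close>

lemma schur_gt:
  assumes M: "equi {..m} (rho m) {..n} (rho n) M" and ik: "i \<le> m" "k \<le> n" and "m < n"
  shows "M i k = 0"
proof (rule ccontr)
  assume nz: "M i k \<noteq> 0"
  have z: "M p 0 = 0" if "p \<le> m" for p
    using equi_weight[OF M that, of 0] \<open>m < n\<close> by fastforce
  have "(\<Sum>r\<le>n. M i r * rho n unip_elem r 0) = (\<Sum>p\<le>m. rho m unip_elem i p * M p 0)"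
    using M[unfolded equi_def, rule_format, OF det_unip_elem, of i 0] ik by simp
  also have "\<dots> = 0" using z by simp
  \<comment> \<open>By weights at most one term of row \<open>i\<close> survives, the one at
    \<open>k\<close>.\<close>
  also have "(\<Sum>r\<le>n. M i r * rho n unip_elem r 0) = (\<Sum>r\<le>n. if r = k then M i k * of_real (sqrt_choose n k) else 0)"
    using equi_weight[OF M ik(1)] equi_weight[OF M ik nz] by (intro sum.cong) (fastforce simp: rho_unip_elem)+
  finally show False using nz ik sqrt_choose_nonzero[of k n] by simp
qed

text \<open>For \<open>m = n\<close> the weights make \<open>M\<close> diagonal, and comparing both
  sides on the highest weight vector under \<open>unip_elem\<close> makes the diagonal constant. The
  case \<open>n < m\<close> is the case \<open>m < n\<close> for the transpose.\<close>

lemma schur: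
  assumes M: "equi {..m} (rho m) {..n} (rho n) M" and ik: "i \<le> m" "k \<le> n"
  shows "M i k = (if m = n \<and> i = k then M 0 0 else 0)"
proof (rule linorder_cases[of m n])
  assume "m < n"
  then show ?thesis using schur_gt[OF M ik] by simp
next
  assume "n < m"
  then show ?thesis
    using schur_gt[OF equi_transpose[OF M rho_transpose rho_transpose] ik(2,1)] by simp
next
  assume [simp]: "m = n"
  have off: "M i r = 0" if "r \<le> n" "r \<noteq> i" "i \<le> n" for i r
    using equi_weight[OF M, of i r] that by fastforce
  have "(\<Sum>r\<le>n. M i r * rho n unip_elem r 0) = (\<Sum>p\<le>m. rho m unip_elem i p * M p 0)"
    using M[unfolded equi_def, rule_format, OF det_unip_elem, of i 0] ik by simp
  moreover have "(\<Sum>r\<le>n. M i r * rho n unip_elem r 0) = (\<Sum>r\<le>n. if r = i then M i i * of_real (sqrt_choose n i) else 0)"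
    using off ik by (intro sum.cong) (auto simp: rho_unip_elem)
  moreover have "(\<Sum>p\<le>m. rho m unip_elem i p * M p 0) = (\<Sum>p\<le>m. if p = 0 then of_real (sqrt_choose n i) * M 0 0 else 0)"
    using off ik by (intro sum.cong) (auto simp: rho_unip_elem)
  ultimately have "M i i = M 0 0"
    using ik sqrt_choose_nonzero[of i n] by simp
  then show ?thesis using off[of k i] ik by auto
qed

section \<open>Orthogonality and completeness\<close>

definition rep2 :: "nat \<Rightarrow> nat \<Rightarrow> complex^2^2 \<Rightarrow> nat \<times> nat \<Rightarrow> nat \<times> nat \<Rightarrow> complex" where
  "rep2 a b x = (\<lambda>(i, j) (i', j'). rho a x i i' * rho b x j j')"

definition rep3 :: "nat \<Rightarrow> nat \<Rightarrow> nat \<Rightarrow> complex^2^2 \<Rightarrow> nat \<times> nat \<times> nat \<Rightarrow> nat \<times> nat \<times> nat \<Rightarrow> complex" where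
  "rep3 a b c x = (\<lambda>(i, j, k) (i', j', k'). rho a x i i' * rho b x j j' * rho c x k k')"

lemma rep2_transpose: "rep2 a b (transpose x) i p = rep2 a b x p i"
  by (simp add: rep2_def rho_transpose split_def)

lemma rep3_transpose: "rep3 a b c (transpose x) i p = rep3 a b c x p i"
  by (simp add: rep3_def rho_transpose split_def)

lemma equi_cg:
  "equi ({..a} \<times> {..b}) (rep2 a b) {..c} (rho c) (\<lambda>(i, j) k. of_real (cg a b c i j k))"
  unfolding equi_def rep2_def
proof (intro allI impI ballI)
  fix x :: "complex^2^2" and k u assume x: "det x = 1" "u \<in> {..a} \<times> {..b}" "k \<in> {..c}"
  obtain i j where u: "u = (i, j)" by (cases u)
  show "(\<Sum>p\<in>{..a} \<times> {..b}. (case u of (i, j) \<Rightarrow> \<lambda>(i', j'). rho a x i i' * rho b x j j') p *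
       (case p of (i, j) \<Rightarrow> \<lambda>k. complex_of_real (cg a b c i j k)) k) =
      (\<Sum>r\<le>c. (case u of (i, j) \<Rightarrow> \<lambda>k. complex_of_real (cg a b c i j k)) r * rho c x r k)"
    using cg_equivariant[of x i a j b k c] x by (simp add: u sum.cartesian_product split_def)
qed

text \<open>The delta in \<open>i\<close>, \<open>i'\<close> is the identity of \<open>V_p\<close>,
  beside the vertex \<open>iota q r e\<close>. Together with \<open>equi_cg_id\<close> this supplies
  the intertwiners on threefold products from which the recoupling is built.\<close>

lemma equi_id_cg:
  "equi ({..p} \<times> {..q} \<times> {..r}) (rep3 p q r) ({..p} \<times> {..e}) (rep2 p e)
     (\<lambda>(i, j, k) (i', y). if i = i' then of_real (cg q r e j k y) else 0)"
  unfolding equi_def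
proof (intro allI impI ballI)
  fix x :: "complex^2^2" and s t
  assume x: "det x = 1" and st: "s \<in> {..p} \<times> {..q} \<times> {..r}" "t \<in> {..p} \<times> {..e}"
  obtain i j k i' y where e: "s = (i, j, k)" "t = (i', y)" by (cases s, cases t)
  then have r: "i' \<in> {..p}" "y \<in> {..e}" "i \<in> {..p}" "j \<in> {..q}" "k \<in> {..r}"
    using st by auto
  have "(\<Sum>u\<in>{..p} \<times> {..q} \<times> {..r}. rep3 p q r x (i, j, k) u *
        (case u of (i, j, k) \<Rightarrow> \<lambda>(i', y). if i = i' then of_real (cg q r e j k y) else 0) (i', y))
     = (\<Sum>u\<le>p. \<Sum>v\<le>q. \<Sum>w\<le>r. rho p x i u * rho q x j v * rho r x k w *
         (if u = i' then of_real (cg q r e v w y) else 0))"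
    by (simp only: e sum.cartesian_product rep3_def split_def fst_conv snd_conv)
  also have "\<dots> = (\<Sum>u\<le>p. if u = i' then rho p x i i' * (\<Sum>v\<le>q. \<Sum>w\<le>r. rho q x j v * rho r x k w *
         of_real (cg q r e v w y)) else 0)"
    by (intro sum.cong refl) (simp add: sum_distrib_left mult.assoc)
  also have "\<dots> = rho p x i i' * (\<Sum>s\<le>e. of_real (cg q r e j k s) * rho e x s y)"
    using r x by (simp add: cg_equivariant)
  also have "\<dots> = (\<Sum>u\<le>p. \<Sum>s\<le>e. (if i = u then of_real (cg q r e j k s) else 0) * (rho p x u i' * rho e x s y))"
  proof -
    have "(\<Sum>u\<le>p. \<Sum>s\<le>e. (if i = u then of_real (cg q r e j k s) else 0) * (rho p x u i' * rho e x s y))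
      = (\<Sum>u\<le>p. if i = u then rho p x i i' * (\<Sum>s\<le>e. of_real (cg q r e j k s) * rho e x s y) else 0)"
      by (intro sum.cong refl) (simp add: sum_distrib_left mult_ac)
    then show ?thesis using r by simp
  qed
  also have "\<dots> = (\<Sum>u\<in>{..p} \<times> {..e}. (case (i, j, k) of (i, j, k) \<Rightarrow>
        \<lambda>(i', y). if i = i' then of_real (cg q r e j k y) else 0) u * rep2 p e x u (i', y))"
    by (simp only: e sum.cartesian_product rep2_def split_def fst_conv snd_conv)
  finally show "(\<Sum>u\<in>{..p} \<times> {..q} \<times> {..r}. rep3 p q r x s u *
        (case u of (i, j, k) \<Rightarrow> \<lambda>(i', y). if i = i' then of_real (cg q r e j k y) else 0) t)
     = (\<Sum>u\<in>{..p} \<times> {..e}. (case s of (i, j, k) \<Rightarrow>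
        \<lambda>(i', y). if i = i' then of_real (cg q r e j k y) else 0) u * rep2 p e x u t)"
    unfolding e .
qed

lemma equi_cg_id:
  "equi ({..p} \<times> {..q} \<times> {..r}) (rep3 p q r) ({..f} \<times> {..r}) (rep2 f r)
     (\<lambda>(i, j, k) (y, k'). if k = k' then of_real (cg p q f i j y) else 0)"
  unfolding equi_def
proof (intro allI impI ballI)
  fix x :: "complex^2^2" and s t
  assume x: "det x = 1" and st: "s \<in> {..p} \<times> {..q} \<times> {..r}" "t \<in> {..f} \<times> {..r}"
  obtain i j k y k' where e: "s = (i, j, k)" "t = (y, k')" by (cases s, cases t)
  then have r: "y \<in> {..f}" "k' \<in> {..r}" "i \<in> {..p}" "j \<in> {..q}" "k \<in> {..r}"
    using st by auto
  have "(\<Sum>u\<in>{..p} \<times> {..q} \<times> {..r}. rep3 p q r x (i, j, k) u *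
        (case u of (i, j, k) \<Rightarrow> \<lambda>(y, k'). if k = k' then of_real (cg p q f i j y) else 0) (y, k'))
     = (\<Sum>u\<le>p. \<Sum>v\<le>q. \<Sum>w\<le>r. rho p x i u * rho q x j v * rho r x k w *
         (if w = k' then of_real (cg p q f u v y) else 0))"
    by (simp only: e sum.cartesian_product rep3_def split_def fst_conv snd_conv)
  also have "\<dots> = (\<Sum>u\<le>p. \<Sum>v\<le>q. \<Sum>w\<le>r. if w = k' then rho p x i u * rho q x j v * of_real (cg p q f u v y) * rho r x k k'
         else 0)"
    by (intro sum.cong refl) auto
  also have "\<dots> = (\<Sum>u\<le>p. \<Sum>v\<le>q. rho p x i u * rho q x j v * of_real (cg p q f u v y)) * rho r x k k'"
    using r by (simp add: sum_distrib_right)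
  also have "\<dots> = (\<Sum>s\<le>f. of_real (cg p q f i j s) * rho f x s y) * rho r x k k'"
    using r x by (simp add: cg_equivariant)
  also have "\<dots> = (\<Sum>s\<le>f. \<Sum>w\<le>r. if k = w then of_real (cg p q f i j s) * rho f x s y * rho r x k k' else 0)"
    using r by (simp add: sum_distrib_right)
  also have "\<dots> = (\<Sum>s\<le>f. \<Sum>w\<le>r. (if k = w then of_real (cg p q f i j s) else 0) * (rho f x s y * rho r x w k'))"
    by (intro sum.cong refl) auto
  also have "\<dots> = (\<Sum>u\<in>{..f} \<times> {..r}. (case (i, j, k) of (i, j, k) \<Rightarrow>
        \<lambda>(y, k'). if k = k' then of_real (cg p q f i j y) else 0) u * rep2 f r x u (y, k'))"
    by (simp only: e sum.cartesian_product rep2_def split_def fst_conv snd_conv)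
  finally show "(\<Sum>u\<in>{..p} \<times> {..q} \<times> {..r}. rep3 p q r x s u *
        (case u of (i, j, k) \<Rightarrow> \<lambda>(y, k'). if k = k' then of_real (cg p q f i j y) else 0) t)
     = (\<Sum>u\<in>{..f} \<times> {..r}. (case s of (i, j, k) \<Rightarrow>
        \<lambda>(y, k'). if k = k' then of_real (cg p q f i j y) else 0) u * rep2 f r x u t)"
    unfolding e .
qed

text \<open>The squared Euclidean norm of the vertex. For admissible triples it equals
  \<open>\<Theta>\<close> by \<open>Theta_eq\<close>, and in this form positivity is a matter of one
  nonzero entry.\<close>

definition theta :: "nat \<Rightarrow> nat \<Rightarrow> nat \<Rightarrow> real" where
  "theta a b c = (\<Sum>i\<le>a. \<Sum>j\<le>b. \<Sum>k\<le>c. (cg a b c i j k)\<^sup>2)"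

lemma cg_nonzero:
  assumes "admissible a b c"
  obtains i j k where "i \<le> a" "j \<le> b" "k \<le> c" "cg a b c i j k \<noteq> 0"
proof -
  obtain \<alpha> \<beta> \<gamma> where e: "a = \<beta> + \<gamma>" "b = \<alpha> + \<gamma>" "c = \<alpha> + \<beta>"
    using assms by (rule admissibleE)
  \<comment> \<open>At the extreme entry \<open>i = a\<close>, \<open>j = 0\<close> only
    \<open>s = \<beta>\<close>, \<open>t = \<gamma>\<close>, \<open>u = 0\<close> contribute, so
    nothing can cancel.\<close>
  have "cg_coeff \<alpha> \<beta> \<gamma> (\<beta> + \<gamma>) 0 \<beta> = (\<Sum>q\<in>{..\<beta>} \<times> {..\<gamma>} \<times> {..\<alpha>}. if q = (\<beta>, \<gamma>, 0) then (- 1) ^ \<gamma> else 0)"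
    unfolding cg_coeff_def by (intro sum.cong refl) (auto split: if_splits)
  also have "\<dots> = (- 1) ^ \<gamma>"
    by (subst sum.delta) auto
  finally have "cg a b c a 0 \<beta> \<noteq> 0"
    using sqrt_choose_nonzero[of \<beta> "\<alpha> + \<beta>"] sqrt_choose_nonzero[of 0 "\<alpha> + \<gamma>"] sqrt_choose_nonzero[of "\<beta> + \<gamma>" "\<beta> + \<gamma>"] by (simp add: e cg_eq)
  then show ?thesis
    by (intro that[of a 0 \<beta>]) (auto simp: e)
qed

lemma theta_pos:
  assumes "admissible a b c"
  shows "theta a b c > 0"
proof -
  obtain i j k where *: "i \<le> a" "j \<le> b" "k \<le> c" "cg a b c i j k \<noteq> 0"
    using assms by (rule cg_nonzero)
  have "0 < (\<Sum>k\<le>c. (cg a b c i j k)\<^sup>2)"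
    using * by (intro sum_pos2[of "{..c}" k "\<lambda>k. (cg a b c i j k)\<^sup>2"]) auto
  then have "0 < (\<Sum>j\<le>b. \<Sum>k\<le>c. (cg a b c i j k)\<^sup>2)"
    using * by (intro sum_pos2[of "{..b}" j "\<lambda>j. \<Sum>k\<le>c. (cg a b c i j k)\<^sup>2"]) (auto intro: sum_nonneg)
  then show ?thesis
    unfolding theta_def using * by (intro sum_pos2[of "{..a}" i "\<lambda>i. \<Sum>j\<le>b. \<Sum>k\<le>c. (cg a b c i j k)\<^sup>2"]) (auto intro!: sum_nonneg)
qed

text \<open>Removal of a bubble: fusing after splitting is an intertwiner between
  \<open>V_c'\<close> and \<open>V_c\<close>, so Schur's lemma leaves a scalar. Its trace is
  \<open>theta a b c\<close>, shared equally by the \<open>Suc c\<close> basis vectors.\<close>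

lemma cg_orthogonal:
  assumes "k \<le> c" "k' \<le> c'"
  shows "(\<Sum>i\<le>a. \<Sum>j\<le>b. cg a b c i j k * cg a b c' i j k')
    = (if c = c' \<and> k = k' then theta a b c / of_nat (Suc c) else 0)"
proof -
  define M where "M c c' k k' = (\<Sum>i\<le>a. \<Sum>j\<le>b. cg a b c i j k * cg a b c' i j k')" for c c' k k'
  have M: "equi {..c} (rho c) {..c'} (rho c') (\<lambda>k k'. complex_of_real (M c c' k k'))" for c c'
    using equi_compose[OF equi_transpose[OF equi_cg[of a b c] rep2_transpose rho_transpose] equi_cg[of a b c']]
    by (simp add: M_def sum.cartesian_product split_def)
  have s: "M c c' k k' = (if c = c' \<and> k = k' then M c c' 0 0 else 0)"
    if "k \<le> c" "k' \<le> c'" for c c' k k'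
  proof -
    have "complex_of_real (M c c' k k') = of_real (if c = c' \<and> k = k' then M c c' 0 0 else 0)"
      by (subst schur[OF M that]) simp
    then show ?thesis by (simp only: of_real_eq_iff)
  qed
  have "theta a b c = (\<Sum>k\<le>c. M c c k k)"
    unfolding theta_def M_def power2_eq_square by (rule sum_swap3[symmetric])
  also have "\<dots> = (\<Sum>k\<le>c. M c c 0 0)"
  proof (rule sum.cong[OF refl])
    fix k assume "k \<in> {..c}"
    then show "M c c k k = M c c 0 0"
      using s[of k c k c] by simp
  qed
  finally show ?thesis
    using s[OF assms] by (auto simp: M_def)
qed

section \<open>Dimension count and resolution of the identity\<close>

lemma finite_admissible: "finite {c. admissible a b c}"
  by (rule finite_subset[of _ "{..a + b}"]) (auto simp: admissible_iff)

text \<open>The Clebsch-Gordan dimension count: the admissible \<open>c\<close> are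
  \<open>a + b - 2 * g\<close> with \<open>g\<close> up to \<open>min a b\<close>, one for each
  number of cups.\<close>

lemma sum_Suc_admissible: "(\<Sum>c | admissible a b c. Suc c) = Suc a * Suc b"
proof -
  have "(\<Sum>c | admissible a b c. Suc c) = (\<Sum>g\<le>min a b. Suc (a + b - 2 * g))"
    by (rule sum.reindex_bij_witness[of _ "\<lambda>g. a + b - 2 * g" "\<lambda>c. (a + b - c) div 2"])
       (auto simp: admissible_iff)
  also have "\<dots> = Suc (min a b) * (a + b - min a b + 1)"
  proof -
    have "2 * n \<le> s \<Longrightarrow> (\<Sum>g\<le>n. Suc (s - 2 * g)) = Suc n * (s - n + 1)" for n s :: nat
    proof (induction n)
      case (Suc n)
      then obtain t where "s = 2 * Suc n + t" using le_Suc_ex by blast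
      with Suc show ?case by (simp add: algebra_simps)
    qed simp
    then show ?thesis by simp
  qed
  also have "\<dots> = Suc a * Suc b"
    by (simp add: min_def)
  finally show ?thesis .
qed

lemma orthonormal_complete:
  fixes v :: "'b \<Rightarrow> 'a \<Rightarrow> real"
  assumes fin: "finite A" "finite B" and card: "card A = card B"
    and orth: "\<And>b b'. b \<in> B \<Longrightarrow> b' \<in> B \<Longrightarrow> (\<Sum>x\<in>A. v b x * v b' x) = (if b = b' then 1 else 0)"
    and xy: "x \<in> A" "y \<in> A"
  shows "(\<Sum>b\<in>B. v b x * v b y) = (if x = y then 1 else 0)"
proof -
  \<comment> \<open>\<open>Q = 1 - P\<close> is an orthogonal projection of trace \<open>card A - card B = 0\<close>, hence zero.\<close>
  define P where "P x y = (\<Sum>b\<in>B. v b x * v b y)" for x y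
  define Q where "Q x y = (if x = y then 1 else 0) - P x y" for x y
  have PP: "(\<Sum>y\<in>A. P x y * P x y) = P x x" for x
  proof -
    have "(\<Sum>y\<in>A. P x y * P x y) = (\<Sum>y\<in>A. \<Sum>b\<in>B. \<Sum>b'\<in>B. v b x * v b' x * (v b y * v b' y))"
      unfolding P_def sum_product by (simp only: mult_ac)
    also have "\<dots> = (\<Sum>b\<in>B. \<Sum>b'\<in>B. v b x * v b' x * (\<Sum>y\<in>A. v b y * v b' y))"
      unfolding sum_distrib_left by (rule sum_swap3)
    also have "\<dots> = (\<Sum>b\<in>B. \<Sum>b'\<in>B. if b = b' then v b x * v b' x else 0)"
      by (intro sum.cong refl) (simp add: orth)
    also have "\<dots> = P x x"
      using fin by (simp add: P_def)
    finally show ?thesis .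
  qed
  have QQ: "(\<Sum>y\<in>A. (Q x y)\<^sup>2) = Q x x" if "x \<in> A" for x
  proof -
    have "(\<Sum>y\<in>A. (Q x y)\<^sup>2) = (\<Sum>y\<in>A. (if x = y then 1 - 2 * P x y else 0) + P x y * P x y)"
      by (intro sum.cong refl) (simp add: Q_def power2_eq_square algebra_simps)
    also have "\<dots> = Q x x"
      using that fin by (simp add: sum.distrib PP Q_def)
    finally show ?thesis .
  qed
  have "(\<Sum>x\<in>A. P x x) = (\<Sum>b\<in>B. \<Sum>x\<in>A. v b x * v b x)"
    unfolding P_def by (rule sum.swap)
  also have "\<dots> = card A"
    by (simp add: orth card)
  finally have "(\<Sum>x\<in>A. Q x x) = 0"
    by (simp add: Q_def sum_subtractf)
  then have "(\<Sum>x\<in>A. \<Sum>y\<in>A. (Q x y)\<^sup>2) = 0"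
    using QQ by simp
  then have "\<forall>x\<in>A. (\<Sum>y\<in>A. (Q x y)\<^sup>2) = 0"
    using fin by (subst (asm) sum_nonneg_eq_0_iff) (auto intro: sum_nonneg)
  then have "(Q x y)\<^sup>2 = 0"
    using fin xy by (subst (asm) sum_nonneg_eq_0_iff) auto
  then show ?thesis by (simp add: Q_def P_def)
qed

text \<open>The columns of all vertices, divided by their norms, are orthonormal in
  \<open>V_a \<otimes> V_b\<close>, and by the dimension count there are exactly enough of them for
  a basis. The count stands in for complete reducibility.\<close>

lemma cg_complete:
  assumes "i \<le> a" "j \<le> b" "i' \<le> a" "j' \<le> b"
  shows "(\<Sum>c | admissible a b c. of_nat (Suc c) / theta a b c * (\<Sum>k\<le>c. cg a b c i j k * cg a b c i' j' k))
    = (if i = i' \<and> j = j' then 1 else 0)"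
proof -
  let ?A = "{..a} \<times> {..b}" and ?B = "Sigma {c. admissible a b c} (\<lambda>c. {..c})"
  \<comment> \<open>Each column has squared norm \<open>theta a b c / Suc c\<close>, hence this
    factor.\<close>
  define v where "v = (\<lambda>(c, k) (i, j). sqrt (of_nat (Suc c) / theta a b c) * cg a b c i j k)"
  have sq: "sqrt (of_nat (Suc c) / theta a b c) * sqrt (of_nat (Suc c) / theta a b c) = of_nat (Suc c) / theta a b c"
    if "admissible a b c" for c
    using theta_pos[OF that] by simp
  have "(\<Sum>q\<in>?B. v q (i, j) * v q (i', j')) = (if (i, j) = (i', j') then 1 else 0)"
  proof (rule orthonormal_complete)
    show "card ?A = card ?B"
      using sum_Suc_admissible[of a b] finite_admissible[of a b]
      by (simp add: card_cartesian_product card_SigmaI)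
    show "(\<Sum>x\<in>?A. v q x * v q' x) = (if q = q' then 1 else 0)" if q: "q \<in> ?B" "q' \<in> ?B" for q q'
    proof -
      obtain c k c' k' where e: "q = (c, k)" "q' = (c', k')" by (cases q, cases q')
      have "(\<Sum>x\<in>?A. v q x * v q' x) = sqrt (of_nat (Suc c) / theta a b c) * sqrt (of_nat (Suc c') / theta a b c') *
          (\<Sum>i\<le>a. \<Sum>j\<le>b. cg a b c i j k * cg a b c' i j k')"
        unfolding sum_distrib_left by (simp add: sum.cartesian_product v_def e split_def mult_ac)
      also have "\<dots> = (if q = q' then 1 else 0)"
        using q theta_pos[of a b c] sq[of c] by (auto simp: e cg_orthogonal)
      finally show ?thesis .
    qed
  qed (use assms finite_admissible in auto)
  moreover have "(\<Sum>q\<in>?B. v q (i, j) * v q (i', j'))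
      = (\<Sum>c | admissible a b c. of_nat (Suc c) / theta a b c * (\<Sum>k\<le>c. cg a b c i j k * cg a b c i' j' k))"
  proof -
    have "(\<Sum>q\<in>?B. v q (i, j) * v q (i', j'))
      = (\<Sum>c | admissible a b c. \<Sum>k\<le>c. v (c, k) (i, j) * v (c, k) (i', j'))"
      using finite_admissible[of a b] by (subst sum.Sigma) (auto simp: split_def)
    also have "\<dots> = (\<Sum>c | admissible a b c. of_nat (Suc c) / theta a b c * (\<Sum>k\<le>c. cg a b c i j k * cg a b c i' j' k))"
    proof (intro sum.cong refl)
      fix c assume "c \<in> {c. admissible a b c}"
      then have w: "sqrt (of_nat (Suc c) / theta a b c) * sqrt (of_nat (Suc c) / theta a b c) = of_nat (Suc c) / theta a b c"
        by (intro sq) simp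
      have "v (c, k) (i, j) * v (c, k) (i', j') = sqrt (of_nat (Suc c) / theta a b c) *
          sqrt (of_nat (Suc c) / theta a b c) * (cg a b c i j k * cg a b c i' j' k)" for k
        unfolding v_def by (simp only: prod.case mult_ac)
      note this[unfolded w]
      then show "(\<Sum>k\<le>c. v (c, k) (i, j) * v (c, k) (i', j')) =
          of_nat (Suc c) / theta a b c * (\<Sum>k\<le>c. cg a b c i j k * cg a b c i' j' k)"
        by (simp add: sum_distrib_left)
    qed
    finally show ?thesis .
  qed
  ultimately show ?thesis by simp
qed

section \<open>Recoupling\<close>

lemma sum_delta2:
  fixes f :: "nat \<Rightarrow> nat \<Rightarrow> 'a::comm_semiring_1"
  assumes "i \<le> a" "j \<le> b"
  shows "(\<Sum>i'\<le>a. \<Sum>j'\<le>b. (if i = i' \<and> j = j' then 1 else 0) * f i' j') = f i j"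
proof -
  have "(\<Sum>i'\<le>a. \<Sum>j'\<le>b. (if i = i' \<and> j = j' then 1 else 0) * f i' j')
    = (\<Sum>i'\<le>a. if i = i' then \<Sum>j'\<le>b. if j = j' then f i' j' else 0 else 0)"
    by (intro sum.cong refl) (auto simp: if_distrib[of "\<lambda>x. x * _"] cong: if_cong)
  also have "\<dots> = f i j" using assms by simp
  finally show ?thesis .
qed

text \<open>The resolution of the identity applied to an arbitrary array. When \<open>f\<close>
  comes from an intertwiner, the inner double sum does too and becomes accessible to Schur's
  lemma.\<close>

lemma cg_expand:
  fixes f :: "nat \<Rightarrow> nat \<Rightarrow> complex"
  assumes "i \<le> a" "j \<le> b"
  shows "f i j = (\<Sum>c | admissible a b c. of_real (of_nat (Suc c) / theta a b c) *
    (\<Sum>k\<le>c. of_real (cg a b c i j k) * (\<Sum>i'\<le>a. \<Sum>j'\<le>b. of_real (cg a b c i' j' k) * f i' j')))"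
proof -
  let ?w = "\<lambda>c. complex_of_real (of_nat (Suc c) / theta a b c)"
  have "f i j = (\<Sum>i'\<le>a. \<Sum>j'\<le>b. (if i = i' \<and> j = j' then 1 else 0) * f i' j')"
    using assms by (simp add: sum_delta2)
  also have "\<dots> = (\<Sum>i'\<le>a. \<Sum>j'\<le>b. \<Sum>c | admissible a b c. \<Sum>k\<le>c.
      ?w c * (of_real (cg a b c i j k) * (of_real (cg a b c i' j' k) * f i' j')))"
  proof (intro sum.cong refl)
    fix i' j' assume "i' \<in> {..a}" "j' \<in> {..b}"
    then have "(if i = i' \<and> j = j' then 1 else 0 :: complex) = of_real
        (\<Sum>c | admissible a b c. of_nat (Suc c) / theta a b c * (\<Sum>k\<le>c. cg a b c i j k * cg a b c i' j' k))"
      using assms by (subst cg_complete) auto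
    then show "(if i = i' \<and> j = j' then 1 else 0) * f i' j' = (\<Sum>c | admissible a b c. \<Sum>k\<le>c.
      ?w c * (of_real (cg a b c i j k) * (of_real (cg a b c i' j' k) * f i' j')))"
      by (simp only: of_real_sum of_real_mult sum_distrib_left sum_distrib_right mult.assoc)
  qed
  also have "\<dots> = (\<Sum>c | admissible a b c. \<Sum>i'\<le>a. \<Sum>j'\<le>b. \<Sum>k\<le>c.
      ?w c * (of_real (cg a b c i j k) * (of_real (cg a b c i' j' k) * f i' j')))"
    by (rule sum_swap3[symmetric])
  also have "\<dots> = (\<Sum>c | admissible a b c. \<Sum>k\<le>c. \<Sum>i'\<le>a. \<Sum>j'\<le>b.
      ?w c * (of_real (cg a b c i j k) * (of_real (cg a b c i' j' k) * f i' j')))"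
    by (rule sum.cong[OF refl], rule sum_swap3[symmetric])
  finally show ?thesis
    by (simp only: sum_distrib_left)
qed

lemma equi_cong:
  assumes "\<And>i k. i \<in> A \<Longrightarrow> k \<in> B \<Longrightarrow> X i k = Y i k"
  shows "equi A R B S X \<longleftrightarrow> equi A R B S Y"
  unfolding equi_def using assms by (simp cong: sum.cong)

text \<open>Multiplicity one: in the expansion over all \<open>V_c\<close> the coefficient matrices
  are intertwiners from \<open>V_d\<close> to \<open>V_c\<close>, so only \<open>c = d\<close>
  survives, and it contributes a scalar.\<close>

lemma equi_multiple:
  assumes N: "equi ({..a} \<times> {..b}) (rep2 a b) {..d} (rho d) N"
  obtains l where "\<And>i j z. i \<le> a \<Longrightarrow> j \<le> b \<Longrightarrow> z \<le> d \<Longrightarrow> N (i, j) z = l * of_real (cg a b d i j z)"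
proof
  define M where "M c k z = (\<Sum>i\<le>a. \<Sum>j\<le>b. of_real (cg a b c i j k) * N (i, j) z)" for c k z
  have "equi {..c} (rho c) {..d} (rho d) (M c)" for c
    using equi_compose[OF equi_transpose[OF equi_cg[of a b c] rep2_transpose rho_transpose] N]
    by (simp add: M_def[abs_def] sum.cartesian_product split_def)
  note M = schur[OF this]
  define l where "l = of_real (of_nat (Suc d) / theta a b d) * M d 0 0"
  fix i j z assume ij: "i \<le> a" "j \<le> b" "z \<le> d"
  have "N (i, j) z = (\<Sum>c | admissible a b c. of_real (of_nat (Suc c) / theta a b c) *
      (\<Sum>k\<le>c. of_real (cg a b c i j k) * M c k z))"
    unfolding M_def by (rule cg_expand[OF ij(1,2), of "\<lambda>i j. N (i, j) z"])
  also have "\<dots> = (\<Sum>c | admissible a b c. if c = d then l * of_real (cg a b d i j z) else 0)"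
  proof (intro sum.cong refl)
    fix c
    have "(\<Sum>k\<le>c. of_real (cg a b c i j k) * M c k z)
        = (\<Sum>k\<le>c. if k = z then (if c = d then of_real (cg a b d i j z) * M d 0 0 else 0) else 0)"
    proof (intro sum.cong refl)
      fix k assume "k \<in> {..c}"
      then show "of_real (cg a b c i j k) * M c k z
          = (if k = z then (if c = d then of_real (cg a b d i j z) * M d 0 0 else 0) else 0)"
        using M[of k c z] ij by simp
    qed
    also have "\<dots> = (if c = d then of_real (cg a b d i j z) * M d 0 0 else 0)"
      using ij by simp
    finally show "of_real (of_nat (Suc c) / theta a b c) * (\<Sum>k\<le>c. of_real (cg a b c i j k) * M c k z)
        = (if c = d then l * of_real (cg a b d i j z) else 0)"
      by (simp add: l_def)
  qed
  \<comment> \<open>If \<open>(a, b, d)\<close> is not admissible, no \<open>c\<close> equals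
    \<open>d\<close>, and both sides are zero since \<open>cg\<close> vanishes there.\<close>
  also have "\<dots> = l * of_real (cg a b d i j z)"
    using finite_admissible[of a b] by (simp add: cg_def)
  finally show "N (i, j) z = l * of_real (cg a b d i j z)" .
qed

text \<open>Projecting the left-hand map onto \<open>V_f\<close> inside
  \<open>V_p \<otimes> V_q\<close> leaves an intertwiner from \<open>V_d\<close> to
  \<open>V_f \<otimes> V_r\<close>, a multiple \<open>l f\<close> of the vertex by multiplicity one.
  Expanding over \<open>f\<close> with the resolution of the identity gives the
  coefficients.\<close>

lemma recoupling_exists:
  "\<exists>S. \<forall>i\<le>p. \<forall>j\<le>q. \<forall>k\<le>r. \<forall>z\<le>d.
    (\<Sum>y\<le>e. of_real (cg q r e j k y) * of_real (cg p e d i y z))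
    = (\<Sum>f\<in>sixj_range p q r d. S f *
        (\<Sum>y\<le>f. of_real (cg p q f i j y) * complex_of_real (cg f r d y k z)))"
proof -
  define L where "L i j k z = (\<Sum>y\<le>e. complex_of_real (cg q r e j k y) * of_real (cg p e d i y z))"
    for i j k z
  define N where "N f y k z = (\<Sum>i\<le>p. \<Sum>j\<le>q. of_real (cg p q f i j y) * L i j k z)" for f y k z
  have L: "equi ({..p} \<times> {..q} \<times> {..r}) (rep3 p q r) {..d} (rho d) (\<lambda>(i, j, k). L i j k)"
  proof (rule iffD1[OF equi_cong equi_compose[OF equi_id_cg[of p q r e] equi_cg[of p e d]]])
    fix s z assume s: "s \<in> {..p} \<times> {..q} \<times> {..r}"
    obtain i j k where e: "s = (i, j, k)" by (cases s)
    have "(\<Sum>t\<in>{..p} \<times> {..e}. (case s of (i, j, k) \<Rightarrow> \<lambda>(i', y). if i = i' then of_real (cg q r e j k y) else 0) t *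
         (case t of (i, j) \<Rightarrow> \<lambda>k. complex_of_real (cg p e d i j k)) z)
      = (\<Sum>i'\<le>p. \<Sum>y\<le>e. (if i = i' then of_real (cg q r e j k y) else 0) * complex_of_real (cg p e d i' y z))"
      by (simp only: e sum.cartesian_product split_def fst_conv snd_conv)
    also have "\<dots> = (\<Sum>i'\<le>p. if i = i' then L i j k z else 0)"
      by (intro sum.cong refl) (auto simp: L_def)
    finally show "(\<Sum>t\<in>{..p} \<times> {..e}. (case s of (i, j, k) \<Rightarrow> \<lambda>(i', y). if i = i' then of_real (cg q r e j k y) else 0) t *
         (case t of (i, j) \<Rightarrow> \<lambda>k. complex_of_real (cg p e d i j k)) z) = (case s of (i, j, k) \<Rightarrow> L i j k) z"
      using s e by simp
  qed
  have "equi ({..f} \<times> {..r}) (rep2 f r) {..d} (rho d) (\<lambda>(y, k). N f y k)" for f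
  proof (rule iffD1[OF equi_cong equi_compose[OF equi_transpose[OF equi_cg_id[of p q r f] rep3_transpose rep2_transpose] L]])
    fix t z assume t: "t \<in> {..f} \<times> {..r}"
    obtain y k' where e: "t = (y, k')" by (cases t)
    have "(\<Sum>s\<in>{..p} \<times> {..q} \<times> {..r}. (case s of (i, j, k) \<Rightarrow> \<lambda>(y, k'). if k = k' then of_real (cg p q f i j y) else 0) t *
         (case s of (i, j, k) \<Rightarrow> L i j k) z)
      = (\<Sum>i\<le>p. \<Sum>j\<le>q. \<Sum>k\<le>r. (if k = k' then of_real (cg p q f i j y) else 0) * L i j k z)"
      by (simp only: e sum.cartesian_product split_def fst_conv snd_conv)
    also have "\<dots> = (\<Sum>i\<le>p. \<Sum>j\<le>q. \<Sum>k\<le>r. if k = k' then of_real (cg p q f i j y) * L i j k' z else 0)"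
      by (intro sum.cong refl) auto
    finally show "(\<Sum>s\<in>{..p} \<times> {..q} \<times> {..r}. (case s of (i, j, k) \<Rightarrow> \<lambda>(y, k'). if k = k' then of_real (cg p q f i j y) else 0) t *
         (case s of (i, j, k) \<Rightarrow> L i j k) z) = (case t of (y, k) \<Rightarrow> N f y k) z"
      using t e by (simp add: N_def)
  qed
  then have "\<exists>l. \<forall>y\<le>f. \<forall>k\<le>r. \<forall>z\<le>d. N f y k z = l * of_real (cg f r d y k z)" for f
    by (rule equi_multiple) auto
  then obtain l where l: "\<And>f y k z. y \<le> f \<Longrightarrow> k \<le> r \<Longrightarrow> z \<le> d \<Longrightarrow> N f y k z = l f * of_real (cg f r d y k z)"
    by metis
  show ?thesis
  proof (intro exI[of _ "\<lambda>f. of_real (of_nat (Suc f) / theta p q f) * l f"] allI impI)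
    fix i j k z assume r: "i \<le> p" "j \<le> q" "k \<le> r" "z \<le> d"
    have "L i j k z = (\<Sum>f | admissible p q f. of_real (of_nat (Suc f) / theta p q f) *
        (\<Sum>y\<le>f. of_real (cg p q f i j y) * N f y k z))"
      unfolding N_def by (rule cg_expand[OF r(1,2), of "\<lambda>i j. L i j k z"])
    also have "\<dots> = (\<Sum>f | admissible p q f. of_real (of_nat (Suc f) / theta p q f) * l f *
        (\<Sum>y\<le>f. of_real (cg p q f i j y) * complex_of_real (cg f r d y k z)))"
      using r by (intro sum.cong refl) (simp add: l sum_distrib_left mult_ac)
    \<comment> \<open>Those \<open>f\<close> for which \<open>(f, r, d)\<close> is not admissible
      drop out because \<open>cg f r d\<close> is zero.\<close>
    also have "\<dots> = (\<Sum>f\<in>sixj_range p q r d. of_real (of_nat (Suc f) / theta p q f) * l f *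
        (\<Sum>y\<le>f. of_real (cg p q f i j y) * complex_of_real (cg f r d y k z)))"
      using finite_admissible[of p q]
      by (intro sum.mono_neutral_right) (auto simp: sixj_range_def cg_def)
    finally show "(\<Sum>y\<le>e. of_real (cg q r e j k y) * of_real (cg p e d i y z))
      = (\<Sum>f\<in>sixj_range p q r d. of_real (of_nat (Suc f) / theta p q f) * l f *
        (\<Sum>y\<le>f. of_real (cg p q f i j y) * complex_of_real (cg f r d y k z)))"
      by (simp only: L_def)
  qed
qed

lemma finite_sixj_range: "finite (sixj_range p q r d)"
  by (rule finite_subset[OF _ finite_admissible[of p q]]) (auto simp: sixj_range_def)

text \<open>Pairing with column \<open>x\<close> of the vertex \<open>(p, q, g)\<close> isolates the
  term \<open>f = g\<close> by orthogonality, and the entry \<open>(x, k, z)\<close> is chosen where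
  the remaining vertex is nonzero.\<close>

lemma recoupling_unique:
  assumes z: "\<And>i j k z. i \<le> p \<Longrightarrow> j \<le> q \<Longrightarrow> k \<le> r \<Longrightarrow> z \<le> d \<Longrightarrow>
    (\<Sum>f\<in>sixj_range p q r d. D f *
        (\<Sum>y\<le>f. of_real (cg p q f i j y) * complex_of_real (cg f r d y k z))) = 0"
    and g: "g \<in> sixj_range p q r d"
  shows "D g = 0"
proof -
  obtain x k z where x: "x \<le> g" "k \<le> r" "z \<le> d" "cg g r d x k z \<noteq> 0"
    using g unfolding sixj_range_def by (auto elim: cg_nonzero)
  have orth: "(\<Sum>i\<le>p. \<Sum>j\<le>q. complex_of_real (cg p q g i j x) * of_real (cg p q f i j y))
      = (if f = g \<and> y = x then of_real (theta p q g / of_nat (Suc g)) else 0)" if "y \<le> f" for f y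
    using cg_orthogonal[OF x(1) that, of p q] by (auto simp flip: of_real_mult of_real_sum)
  have "0 = (\<Sum>i\<le>p. \<Sum>j\<le>q. of_real (cg p q g i j x) * (\<Sum>f\<in>sixj_range p q r d. D f *
        (\<Sum>y\<le>f. of_real (cg p q f i j y) * complex_of_real (cg f r d y k z))))"
    using x by (simp add: z)
  also have "\<dots> = (\<Sum>i\<le>p. \<Sum>j\<le>q. \<Sum>f\<in>sixj_range p q r d. \<Sum>y\<le>f. D f * of_real (cg f r d y k z) *
        (of_real (cg p q g i j x) * of_real (cg p q f i j y)))"
    by (simp add: sum_distrib_left mult_ac)
  also have "\<dots> = (\<Sum>f\<in>sixj_range p q r d. \<Sum>i\<le>p. \<Sum>j\<le>q. \<Sum>y\<le>f. D f * of_real (cg f r d y k z) *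
        (of_real (cg p q g i j x) * of_real (cg p q f i j y)))"
    by (rule sum_swap3[symmetric])
  also have "\<dots> = (\<Sum>f\<in>sixj_range p q r d. \<Sum>y\<le>f. D f * of_real (cg f r d y k z) *
        (\<Sum>i\<le>p. \<Sum>j\<le>q. of_real (cg p q g i j x) * of_real (cg p q f i j y)))"
    unfolding sum_distrib_left by (rule sum.cong[OF refl], rule sum_swap3[symmetric])
  also have "\<dots> = (\<Sum>f\<in>sixj_range p q r d. \<Sum>y\<le>f. if y = x then
      (if f = g then D g * of_real (cg g r d x k z) * of_real (theta p q g / of_nat (Suc g)) else 0) else 0)"
    by (intro sum.cong refl) (auto simp: orth)
  also have "\<dots> = (\<Sum>f\<in>sixj_range p q r d.
      if f = g then D g * of_real (cg g r d x k z) * of_real (theta p q g / of_nat (Suc g)) else 0)"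
    using x by (intro sum.cong refl) auto
  also have "\<dots> = D g * of_real (cg g r d x k z) * of_real (theta p q g / of_nat (Suc g))"
    using g finite_sixj_range by simp
  finally show ?thesis
    using x(4) theta_pos[of p q g] g by (auto simp: sixj_range_def simp del: of_nat_Suc)
qed

section \<open>Linear maps on tensor powers\<close>

lemma sum_fun_apply [simp]: "(\<Sum>i\<in>A. f i :: 'a \<Rightarrow> 'b::comm_monoid_add) x = (\<Sum>i\<in>A. f i x)"
  by (induction A rule: infinite_finite_induct) auto

lemma tscale_apply [simp]: "tscale c t w = c * t w"
  by (simp add: tscale_def)

definition word_tensor :: "2 list \<Rightarrow> tensor" where
  "word_tensor w = pure (map std w)"

lemma word_tensor_apply: "word_tensor w v = (if v = w then 1 else 0)"
proof (cases "v = w")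
  case False
  show ?thesis
  proof (cases "length v = length w")
    case True
    then obtain i where i: "i < length w" "v ! i \<noteq> w ! i"
      using False by (auto simp: list_eq_iff_nth_eq)
    then have "map std w ! i $ v ! i = 0"
      by (simp add: std_def axis_def)
    with i(1) have "(\<Prod>j<length (map std w). map std w ! j $ v ! j) = 0"
      by (intro prod_zero) auto
    then show ?thesis
      using False True by (simp only: word_tensor_def pure_def length_map if_cancel if_False)
  qed (use False in \<open>simp add: word_tensor_def pure_def\<close>)
next
  case True
  have "map std w ! i $ w ! i = 1" if "i < length w" for i
    using that by (simp add: std_def)
  then show ?thesis
    using True by (simp add: word_tensor_def pure_def)
qed

text \<open>Linearity on the whole type \<open>tensor\<close>: \<open>lin_ext n\<close> reads only
  the words of length \<open>n\<close>, so every map built by it is linear on all tensors.\<close>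

definition tlinear :: "(tensor \<Rightarrow> tensor) \<Rightarrow> bool" where
  "tlinear f \<longleftrightarrow> (\<forall>s t. f (s + t) = f s + f t) \<and> (\<forall>c t. f (tscale c t) = tscale c (f t))"

lemma tlinear_sum:
  assumes "tlinear f"
  shows "f (\<Sum>i\<in>A. tscale (c i) (g i)) = (\<Sum>i\<in>A. tscale (c i) (f (g i)))"
proof -
  have "tscale 0 t = 0" for t by (simp add: fun_eq_iff)
  moreover have "f (tscale 0 0) = tscale 0 (f 0)"
    using assms unfolding tlinear_def by blast
  ultimately have "f 0 = 0" by simp
  then show ?thesis
    using assms by (induction A rule: infinite_finite_induct) (auto simp: tlinear_def)
qed

lemma tlinear_sum_plain: "tlinear f \<Longrightarrow> f (\<Sum>i\<in>A. g i) = (\<Sum>i\<in>A. f (g i))"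
  using tlinear_sum[of f "\<lambda>_. 1" g A] by simp

lemma tlinear_scale: "tlinear f \<Longrightarrow> f (tscale c t) = tscale c (f t)"
  by (simp add: tlinear_def)

lemma tlinear_compose: "tlinear f \<Longrightarrow> tlinear g \<Longrightarrow> tlinear (f \<circ> g)"
  by (simp add: tlinear_def)

lemma tlinear_id: "tlinear id"
  by (simp add: tlinear_def)

lemma lin_ext_apply: "lin_ext n F t v = (\<Sum>w\<in>words n. t w * F w v)"
  by (simp add: lin_ext_def words_def)

lemma tlinear_lin_ext: "tlinear (lin_ext n F)"
  by (auto simp: tlinear_def fun_eq_iff lin_ext_apply sum.distrib algebra_simps sum_distrib_left)

lemma lin_ext_word_tensor: "w \<in> words n \<Longrightarrow> lin_ext n F (word_tensor w) = F w"
  by (auto simp: fun_eq_iff lin_ext_apply word_tensor_apply if_distrib[of "\<lambda>y. y * _"] cong: if_cong)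

lemma tlinear_tmap: "tlinear (tmap m n f g)"
  unfolding tmap_def by (rule tlinear_lin_ext)

lemma tlinear_symmetrizer: "tlinear (symmetrizer n)"
  unfolding symmetrizer_def by (rule tlinear_lin_ext)

lemma tlinear_id_tmap_id: "tlinear (id_tmap_id k m n f)"
  unfolding id_tmap_id_def by (rule tlinear_tmap)

lemma tlinear_cap: "tlinear (cap n)"
proof (induction n)
  case (Suc n)
  then show ?case
    unfolding cap.simps by (intro tlinear_compose tlinear_id_tmap_id)
qed (simp only: cap.simps tlinear_id)

lemma tlinear_iota: "tlinear (iota a b c)"
  unfolding iota_def Let_def by (intro tlinear_compose tlinear_tmap tlinear_id_tmap_id)

lemma tlinear_proj: "tlinear (proj a b c)"
  unfolding proj_def Let_def by (intro tlinear_compose tlinear_symmetrizer tlinear_id_tmap_id)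

lemma tlinear_group: "tlinear (group_power x n)"
  unfolding group_power_def by (rule tlinear_lin_ext)

lemma tprod_sum_left: "(\<Sum>i\<in>A. tscale (c i) (s i)) \<otimes>\<^sub>T t = (\<Sum>i\<in>A. tscale (c i) (s i \<otimes>\<^sub>T t))"
proof
  fix w
  have "((\<Sum>i\<in>A. tscale (c i) (s i)) \<otimes>\<^sub>T t) w = (\<Sum>l\<le>length w. \<Sum>i\<in>A. c i * (s i (take l w) * t (drop l w)))"
    by (simp add: tprod_def sum_distrib_right mult.assoc)
  also have "\<dots> = (\<Sum>i\<in>A. \<Sum>l\<le>length w. c i * (s i (take l w) * t (drop l w)))"
    by (rule sum.swap)
  finally show "((\<Sum>i\<in>A. tscale (c i) (s i)) \<otimes>\<^sub>T t) w = (\<Sum>i\<in>A. tscale (c i) (s i \<otimes>\<^sub>T t)) w"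
    by (simp add: tprod_def sum_distrib_left)
qed

lemma tprod_sum_right: "t \<otimes>\<^sub>T (\<Sum>i\<in>A. tscale (c i) (s i)) = (\<Sum>i\<in>A. tscale (c i) (t \<otimes>\<^sub>T s i))"
proof
  fix w
  have "(t \<otimes>\<^sub>T (\<Sum>i\<in>A. tscale (c i) (s i))) w = (\<Sum>l\<le>length w. \<Sum>i\<in>A. c i * (t (take l w) * s i (drop l w)))"
    by (simp add: tprod_def sum_distrib_left mult_ac)
  also have "\<dots> = (\<Sum>i\<in>A. \<Sum>l\<le>length w. c i * (t (take l w) * s i (drop l w)))"
    by (rule sum.swap)
  finally show "(t \<otimes>\<^sub>T (\<Sum>i\<in>A. tscale (c i) (s i))) w = (\<Sum>i\<in>A. tscale (c i) (t \<otimes>\<^sub>T s i)) w"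
    by (simp add: tprod_def sum_distrib_left)
qed

lemma tprod_scale: "tscale c s \<otimes>\<^sub>T t = tscale c (s \<otimes>\<^sub>T t)" "s \<otimes>\<^sub>T tscale c t = tscale c (s \<otimes>\<^sub>T t)"
  by (simp_all add: tprod_def fun_eq_iff sum_distrib_left mult_ac)

lemma tprod_apply:
  assumes "s \<in> tensor_power m"
  shows "(s \<otimes>\<^sub>T t) w = (if m \<le> length w then s (take m w) * t (drop m w) else 0)"
proof -
  have "(s \<otimes>\<^sub>T t) w = (\<Sum>i\<le>length w. if i = m then s (take m w) * t (drop m w) else 0)"
    unfolding tprod_def using assms by (intro sum.cong refl) (auto simp: tensor_power_def)
  then show ?thesis by simp
qed

lemma word_tensor_in_tensor_power: "w \<in> words n \<Longrightarrow> word_tensor w \<in> tensor_power n"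
  by (auto simp: tensor_power_def word_tensor_apply words_def)

lemma word_tensor_append: "word_tensor u \<otimes>\<^sub>T word_tensor v = word_tensor (u @ v)"
proof
  fix w
  have "take (length u) w = u \<and> drop (length u) w = v \<longleftrightarrow> w = u @ v"
    by (metis append_eq_conv_conj)
  moreover have "length u \<le> length w" if "w = u @ v" using that by simp
  ultimately show "(word_tensor u \<otimes>\<^sub>T word_tensor v) w = word_tensor (u @ v) w"
    by (subst tprod_apply[OF word_tensor_in_tensor_power[of _ "length u"]]) (auto simp: words_def word_tensor_apply)
qed

lemma tensor_expand:
  assumes "t \<in> tensor_power n"
  shows "t = (\<Sum>w\<in>words n. tscale (t w) (word_tensor w))"
proof
  fix v
  have "(\<Sum>w\<in>words n. tscale (t w) (word_tensor w)) v = (\<Sum>w\<in>words n. t w * word_tensor w v)"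
    by simp
  also have "\<dots> = (\<Sum>w\<in>words n. if v = w then t v else 0)"
    by (intro sum.cong refl) (auto simp: word_tensor_apply)
  also have "\<dots> = (if v \<in> words n then t v else 0)"
    by simp
  also have "\<dots> = t v"
    using assms by (simp add: tensor_power_def words_def)
  finally show "t v = (\<Sum>w\<in>words n. tscale (t w) (word_tensor w)) v" ..
qed

lemma tmap_word_tensor:
  assumes "u \<in> words m" "v \<in> words n"
  shows "tmap m n f g (word_tensor (u @ v)) = f (word_tensor u) \<otimes>\<^sub>T g (word_tensor v)"
  using assms unfolding tmap_def
  by (subst lin_ext_word_tensor) (auto simp: words_def simp flip: word_tensor_def)

lemma tmap_tprod:
  assumes "s \<in> tensor_power m" "t \<in> tensor_power n" "tlinear f" "tlinear g"
  shows "tmap m n f g (s \<otimes>\<^sub>T t) = f s \<otimes>\<^sub>T g t"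
proof -
  have "s \<otimes>\<^sub>T t = (\<Sum>u\<in>words m. tscale (s u) (\<Sum>v\<in>words n. tscale (t v) (word_tensor (u @ v))))"
    by (subst tensor_expand[OF assms(1)], subst tensor_expand[OF assms(2)])
       (simp only: tprod_sum_left, simp only: tprod_sum_right word_tensor_append)
  then have "tmap m n f g (s \<otimes>\<^sub>T t) = (\<Sum>u\<in>words m. tscale (s u) (\<Sum>v\<in>words n. tscale (t v) (f (word_tensor u) \<otimes>\<^sub>T g (word_tensor v))))"
    by (simp add: tlinear_sum[OF tlinear_tmap] tmap_word_tensor)
  also have "\<dots> = (\<Sum>u\<in>words m. tscale (s u) (f (word_tensor u))) \<otimes>\<^sub>T (\<Sum>v\<in>words n. tscale (t v) (g (word_tensor v)))"
    by (simp only: tprod_sum_left) (simp only: tprod_sum_right)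
  also have "\<dots> = f s \<otimes>\<^sub>T g t"
    by (simp only: tlinear_sum[OF assms(3), symmetric] tlinear_sum[OF assms(4), symmetric]
         tensor_expand[OF assms(1), symmetric] tensor_expand[OF assms(2), symmetric])
  finally show ?thesis .
qed

lemma id_tmap_id_word_tensor:
  assumes "p \<in> words k" "q \<in> words m" "r \<in> words n"
  shows "id_tmap_id k m n f (word_tensor (p @ q @ r)) = word_tensor p \<otimes>\<^sub>T f (word_tensor q) \<otimes>\<^sub>T word_tensor r"
  using assms by (simp add: id_tmap_id_def tmap_word_tensor words_def)

section \<open>Orbit sums, unit vectors and the symmetrizer\<close>

definition cls_sum :: "nat \<Rightarrow> nat \<Rightarrow> tensor" where
  "cls_sum n k = (\<lambda>w. if length w = n \<and> ht w = k then 1 else 0)"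

text \<open>An orbit sum of \<open>n choose k\<close> words has Euclidean norm
  \<open>sqrt_choose n k\<close>; these are the unit vectors in which \<open>iota\<close> and
  \<open>proj\<close> are transposes.\<close>

definition sbasis :: "nat \<Rightarrow> nat \<Rightarrow> tensor" where
  "sbasis n k = tscale (1 / of_real (sqrt_choose n k)) (cls_sum n k)"

lemma cls_sum_eq: "cls_sum n k = (\<Sum>w\<in>cls n k. word_tensor w)"
proof
  fix v
  have "(\<Sum>w\<in>cls n k. word_tensor w) v = (\<Sum>w\<in>cls n k. if v = w then 1 else 0)"
    by (simp add: word_tensor_apply)
  also have "\<dots> = (if v \<in> cls n k then 1 else 0)"
    by simp
  also have "\<dots> = cls_sum n k v"
    by (simp add: cls_sum_def cls_def words_def)
  finally show "cls_sum n k v = (\<Sum>w\<in>cls n k. word_tensor w) v" ..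
qed

lemma cls_sum_sbasis: "k \<le> n \<Longrightarrow> cls_sum n k = tscale (of_real (sqrt_choose n k)) (sbasis n k)"
  using sqrt_choose_nonzero[of k n] by (simp add: sbasis_def fun_eq_iff)

lemma sbasis_in_tensor_power: "sbasis n k \<in> tensor_power n"
  by (simp add: tensor_power_def sbasis_def cls_sum_def)

text \<open>A permutation of positions taking \<open>v\<close> to \<open>v'\<close> exists because
  both have the same letters. Composing with it maps the permutations that produce \<open>v\<close>
  injectively to those that produce \<open>v'\<close>; exchanging \<open>v\<close> and
  \<open>v'\<close> gives equality.\<close>

lemma card_permute_to:
  assumes v: "v \<in> words n" "v' \<in> words n" "ht v = ht v'"
  shows "card {\<sigma>. \<sigma> permutes {..<n} \<and> permute_list \<sigma> w = v} = card {\<sigma>. \<sigma> permutes {..<n} \<and> permute_list \<sigma> w = v'}"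
    (is "card (?S v) = card (?S v')")
proof -
  have le: "card (?S v) \<le> card (?S v')" if v: "v \<in> words n" "v' \<in> words n" "ht v = ht v'" and w: "w \<in> words n" for v v'
  proof -
    have "count (mset v) i = count (mset v') i" for i
    proof -
      have "length v = count_list v 1 + count_list v 2" for v :: "2 list"
      proof -
        have "set v \<subseteq> {1, 2}" by (simp flip: UNIV_2)
        from sum_count_set[OF this] show ?thesis by simp
      qed
      then have "count_list v 1 = count_list v' 1"
        using v by (metis add_right_cancel length_words)
      then show ?thesis using exhaust_2[of i] v(3) by (auto simp: count_mset)
    qed
    then have "mset v' = mset v" by (simp add: multiset_eq_iff)
    then obtain \<tau> where \<tau>: "\<tau> permutes {..<length v}" "permute_list \<tau> v = v'"
      by (rule mset_eq_permutation)
    have n: "length v = n" "length w = n" using v w by (auto simp: words_def)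
    show ?thesis
    proof (rule card_inj_on_le[of "\<lambda>\<sigma>. \<sigma> \<circ> \<tau>"])
      show "inj_on (\<lambda>\<sigma>. \<sigma> \<circ> \<tau>) (?S v)"
        using permutes_surj[OF \<tau>(1)] by (auto intro!: inj_onI simp: fun_eq_iff) (metis surjD)
      show "(\<lambda>\<sigma>. \<sigma> \<circ> \<tau>) ` ?S v \<subseteq> ?S v'"
      proof clarify
        fix \<sigma> assume \<sigma>: "\<sigma> permutes {..<n}" "v = permute_list \<sigma> w"
        then show "\<sigma> \<circ> \<tau> permutes {..<n} \<and> permute_list (\<sigma> \<circ> \<tau>) w = v'"
          using \<tau> n by (auto simp: permute_list_compose intro: permutes_compose)
      qed
      show "finite (?S v')"
        by (rule finite_subset[OF _ finite_permutations[of "{..<n}"]]) auto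
    qed
  qed
  show ?thesis
  proof (cases "w \<in> words n")
    case True
    then show ?thesis using le[of v v'] le[of v' v] v by simp
  next
    case False
    then have "?S v = {}" "?S v' = {}" using v by (auto simp: words_def)
    then show ?thesis by (simp only:)
  qed
qed

text \<open>The permutations spread the word evenly over its orbit, by
  \<open>card_permute_to\<close>.\<close>

lemma symmetrizer_word_tensor:
  assumes w: "w \<in> words n"
  shows "symmetrizer n (word_tensor w) = tscale (1 / of_nat (n choose ht w)) (cls_sum n (ht w))"
proof
  fix v
  define N where "N v = card {\<sigma>. \<sigma> permutes {..<n} \<and> permute_list \<sigma> w = v}" for v
  have fin: "finite {\<sigma>. \<sigma> permutes {..<n}}" by (rule finite_permutations) simp
  have ht: "v \<in> cls n (ht w)" if "\<sigma> permutes {..<n}" "permute_list \<sigma> w = v" for \<sigma> v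
  proof -
    have "mset v = mset w" using that w by (auto simp: words_def)
    then show ?thesis using w unfolding cls_def words_def
      by (metis (mono_tags, lifting) count_mset mem_Collect_eq size_mset)
  qed
  have "symmetrizer n (word_tensor w) v = 1 / fact n * (\<Sum>\<sigma> | \<sigma> permutes {..<n}. word_tensor (permute_list \<sigma> w) v)"
    unfolding symmetrizer_def lin_ext_word_tensor[OF w]
    by (simp add: word_tensor_def) (intro disjI2 sum.cong refl, use w in \<open>auto simp: permute_list_map words_def\<close>)
  also have "(\<Sum>\<sigma> | \<sigma> permutes {..<n}. word_tensor (permute_list \<sigma> w) v) = of_nat (N v)"
  proof -
    have "(\<Sum>\<sigma> | \<sigma> permutes {..<n}. word_tensor (permute_list \<sigma> w) v)
       = (\<Sum>\<sigma> | \<sigma> permutes {..<n}. if permute_list \<sigma> w = v then 1 else 0)"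
      by (intro sum.cong refl) (auto simp: word_tensor_apply)
    also have "\<dots> = (\<Sum>\<sigma>\<in>{\<sigma>\<in>{\<sigma>. \<sigma> permutes {..<n}}. permute_list \<sigma> w = v}. 1)"
      by (rule sum.inter_filter[symmetric, OF fin])
    finally show ?thesis by (simp add: N_def)
  qed
  finally have sym: "symmetrizer n (word_tensor w) v = of_nat (N v) / fact n" by simp
  show "symmetrizer n (word_tensor w) v = tscale (1 / of_nat (n choose ht w)) (cls_sum n (ht w)) v"
  proof (cases "v \<in> cls n (ht w)")
    case True
    have "fact n = card {\<sigma>. \<sigma> permutes {..<n}}"
      by (simp add: card_permutations)
    also have "{\<sigma>. \<sigma> permutes {..<n}} = (\<Union>v\<in>cls n (ht w). {\<sigma>. \<sigma> permutes {..<n} \<and> permute_list \<sigma> w = v})"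
      using ht by auto
    also have "card \<dots> = (\<Sum>v\<in>cls n (ht w). N v)"
      unfolding N_def by (rule card_UN_disjoint) (auto intro: finite_subset[OF _ fin])
    also have "\<dots> = (\<Sum>v'\<in>cls n (ht w). N v)"
      unfolding N_def by (intro sum.cong refl card_permute_to) (use True in \<open>auto simp: cls_def\<close>)
    finally have "fact n = (n choose ht w) * N v" by (simp add: card_cls)
    moreover have "n choose ht w > 0" using w ht_le_words[of w n] by simp
    ultimately have "complex_of_nat (N v) * of_nat (n choose ht w) = fact n"
      "complex_of_nat (n choose ht w) \<noteq> 0"
      by (metis mult.commute of_nat_mult of_nat_fact, simp)
    then have "of_nat (N v) / fact n = 1 / (of_nat (n choose ht w) :: complex)"
      by (simp add: frac_eq_eq)
    then show ?thesis
      using True by (simp add: sym cls_sum_def cls_def words_def)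
  next
    case False
    then have "{\<sigma>. \<sigma> permutes {..<n} \<and> permute_list \<sigma> w = v} = {}" using ht by auto
    then have "N v = 0" by (simp only: N_def card.empty)
    then show ?thesis using False by (auto simp add: sym cls_sum_def cls_def words_def)
  qed
qed

section \<open>The maps iota and proj in coordinates\<close>

text \<open>Nested cups join strands in mirror order and their two ends carry opposite letters,
  hence the reversal and the exchange of letters.\<close>

definition dual_word :: "2 list \<Rightarrow> 2 list" where
  "dual_word w = rev (map (\<lambda>i. if i = 1 then 2 else 1) w)"

lemma dual_word_in_words: "q \<in> words n \<Longrightarrow> dual_word q \<in> words n"
  by (simp add: dual_word_def words_def)

lemma ht_dual_word: "ht (dual_word q) = length q - ht q"
proof -
  have "ht (dual_word q) + ht q = length q"
  proof (induction q)
    case (Cons i q)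
    then show ?case using exhaust_2[of i] by (auto simp: dual_word_def)
  qed (simp add: dual_word_def)
  then show ?thesis by simp
qed

lemma dual_word_snoc: "dual_word (q @ [1]) = 2 # dual_word q" "dual_word (q @ [2]) = 1 # dual_word q"
  by (simp_all add: dual_word_def)

lemma sum_words_snoc:
  fixes f :: "2 list \<Rightarrow> 'a::comm_monoid_add"
  shows "(\<Sum>w\<in>words (Suc n). f w) = (\<Sum>w\<in>words n. f (w @ [1]) + f (w @ [2]))"
  using sum_words_append[of f n 1] by (simp add: sum_words_Suc)

lemma det_std: "det (transpose (vector [std 1, std 2])) = 1" "det (transpose (vector [std 2, std 1])) = - 1"
  "det (transpose (vector [std i, std i])) = 0"
  by (simp_all add: det_2 transpose_def std_def axis_def)

lemma cup1_word_tensor: "cup1 (word_tensor []) = word_tensor [1, 2] - word_tensor [2, 1]"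
  unfolding cup1_def by (subst lin_ext_word_tensor) (simp_all add: word_tensor_def)

lemma cap1_word_tensor: "cap1 (word_tensor [i, j]) = tscale (det (transpose (vector [std i, std j]))) (word_tensor [])"
  unfolding cap1_def by (subst lin_ext_word_tensor) (simp_all add: word_tensor_def words_def)

lemma tprod_diff: "(s - s') \<otimes>\<^sub>T t = s \<otimes>\<^sub>T t - s' \<otimes>\<^sub>T t" "t \<otimes>\<^sub>T (s - s') = t \<otimes>\<^sub>T s - t \<otimes>\<^sub>T s'"
  by (simp_all add: tprod_def fun_eq_iff algebra_simps sum_subtractf)

text \<open>The cup added last is the innermost one, so the left word grows at its end and the right
  word at its front. A factor -1 belongs to every cup whose left end carries the letter 2.\<close>

lemma cup_word_tensor: "cup n (word_tensor []) = (\<Sum>q\<in>words n. tscale ((- 1) ^ ht q) (word_tensor (q @ dual_word q)))"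
proof (induction n)
  case (Suc n)
  have "cup (Suc n) (word_tensor []) = (\<Sum>q\<in>words n. tscale ((- 1) ^ ht q) (id_tmap_id n 0 n cup1 (word_tensor (q @ [] @ dual_word q))))"
    by (simp only: cup.simps comp_apply Suc.IH tlinear_sum[OF tlinear_id_tmap_id] append_Nil)
  also have "\<dots> = (\<Sum>q\<in>words n. tscale ((- 1) ^ ht (q @ [1])) (word_tensor ((q @ [1]) @ dual_word (q @ [1]))) +
      tscale ((- 1) ^ ht (q @ [2])) (word_tensor ((q @ [2]) @ dual_word (q @ [2]))))"
  proof (rule sum.cong[OF refl])
    fix q assume q: "q \<in> words n"
    have m: "id_tmap_id n 0 n cup1 (word_tensor (q @ [] @ dual_word q)) = word_tensor (q @ [1, 2] @ dual_word q) - word_tensor (q @ [2, 1] @ dual_word q)"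
      using q dual_word_in_words[OF q] by (subst id_tmap_id_word_tensor) (simp_all add: cup1_word_tensor tprod_diff word_tensor_append)
    show "tscale ((- 1) ^ ht q) (id_tmap_id n 0 n cup1 (word_tensor (q @ [] @ dual_word q))) =
        tscale ((- 1) ^ ht (q @ [1])) (word_tensor ((q @ [1]) @ dual_word (q @ [1]))) +
        tscale ((- 1) ^ ht (q @ [2])) (word_tensor ((q @ [2]) @ dual_word (q @ [2])))"
      unfolding m by (simp add: dual_word_snoc fun_eq_iff algebra_simps)
  qed
  also have "\<dots> = (\<Sum>q\<in>words (Suc n). tscale ((- 1) ^ ht q) (word_tensor (q @ dual_word q)))"
    by (simp only: sum_words_snoc)
  finally show ?case .
qed (simp add: dual_word_def fun_eq_iff)

text \<open>The innermost cap is applied first, to the last letter of \<open>q\<close> and the first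
  letter of \<open>q'\<close>; \<open>det_std\<close> gives its sign, or zero for equal
  letters.\<close>

lemma cap_word_tensor:
  "q \<in> words n \<Longrightarrow> q' \<in> words n \<Longrightarrow>
    cap n (word_tensor (q @ q')) = tscale (if q' = dual_word q then (- 1) ^ ht q else 0) (word_tensor [])"
proof (induction n arbitrary: q q')
  case 0
  then show ?case by (simp add: dual_word_def fun_eq_iff)
next
  case (Suc n)
  obtain u i where q: "q = u @ [i]" and u: "u \<in> words n"
    using Suc.prems(1) by (cases q rule: rev_cases) (auto simp: words_def)
  obtain j v where q': "q' = j # v" and v: "v \<in> words n"
    using Suc.prems(2) by (cases q') (auto simp: words_def)
  have "id_tmap_id n 2 n cap1 (word_tensor (u @ [i, j] @ v)) = tscale (det (transpose (vector [std i, std j]))) (word_tensor (u @ v))"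
    using u v by (subst id_tmap_id_word_tensor) (auto simp: words_def cap1_word_tensor tprod_scale word_tensor_append)
  then have "cap (Suc n) (word_tensor (q @ q')) = tscale (det (transpose (vector [std i, std j]))) (cap n (word_tensor (u @ v)))"
    by (simp add: q q' tlinear_scale[OF tlinear_cap])
  also have "\<dots> = tscale (if q' = dual_word q then (- 1) ^ ht q else 0) (word_tensor [])"
    unfolding Suc.IH[OF u v] using exhaust_2[of i] exhaust_2[of j]
    by (elim disjE; simp only: q q' dual_word_snoc det_std; simp add: fun_eq_iff)
  finally show ?case .
qed

text \<open>Passage from words to letter counts: \<open>p\<close>, \<open>q\<close>,
  \<open>r\<close> are the letters on the left strands, on the left ends of the cups and on the
  right strands, and the binomials in \<open>cg_coeff\<close> count the words with given
  counts.\<close>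

lemma sum_words3:
  fixes F :: "nat \<Rightarrow> nat \<Rightarrow> nat \<Rightarrow> complex"
  shows "(\<Sum>p\<in>words \<beta>. \<Sum>q\<in>words \<gamma>. \<Sum>r\<in>words \<alpha>. (- 1) ^ ht q * F (ht p + ht q) (ht r + (\<gamma> - ht q)) (ht p + ht r))
    = (\<Sum>i\<le>\<beta>+\<gamma>. \<Sum>j\<le>\<alpha>+\<gamma>. \<Sum>k\<le>\<alpha>+\<beta>. of_real (cg_coeff \<alpha> \<beta> \<gamma> i j k) * F i j k)"
proof -
  have "(\<Sum>p\<in>words \<beta>. \<Sum>q\<in>words \<gamma>. \<Sum>r\<in>words \<alpha>. (- 1) ^ ht q * F (ht p + ht q) (ht r + (\<gamma> - ht q)) (ht p + ht r))
     = (\<Sum>s\<le>\<beta>. of_nat (\<beta> choose s) * (\<Sum>t\<le>\<gamma>. of_nat (\<gamma> choose t) * (\<Sum>u\<le>\<alpha>. of_nat (\<alpha> choose u) *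
       ((- 1) ^ t * F (s + t) (u + (\<gamma> - t)) (s + u)))))"
    by (simp only: sum_words_ht[of "\<lambda>u. (- 1) ^ _ * F (_ + _) (u + _) (_ + u)" \<alpha>]
      sum_words_ht[of "\<lambda>t. \<Sum>u\<le>\<alpha>. of_nat (\<alpha> choose u) * ((- 1) ^ t * F (_ + t) (u + (\<gamma> - t)) (_ + u))" \<gamma>]
      sum_words_ht[of "\<lambda>s. \<Sum>t\<le>\<gamma>. of_nat (\<gamma> choose t) * (\<Sum>u\<le>\<alpha>. of_nat (\<alpha> choose u) *
       ((- 1) ^ t * F (s + t) (u + (\<gamma> - t)) (s + u)))" \<beta>])
  also have "\<dots> = (\<Sum>s\<le>\<beta>. \<Sum>t\<le>\<gamma>. \<Sum>u\<le>\<alpha>. (- 1) ^ t * of_nat (\<beta> choose s) * of_nat (\<gamma> choose t) *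
        of_nat (\<alpha> choose u) * F (s + t) (u + (\<gamma> - t)) (s + u))"
    unfolding sum_distrib_left by (intro sum.cong refl) (simp only: mult_ac)
  finally show ?thesis by (simp only: cg_contract)
qed

lemma iota_word_tensor:
  assumes p: "p \<in> words \<beta>" and r: "r \<in> words \<alpha>"
  shows "iota (\<beta> + \<gamma>) (\<alpha> + \<gamma>) (\<alpha> + \<beta>) (word_tensor (p @ r)) = (\<Sum>q\<in>words \<gamma>. tscale ((- 1) ^ ht q)
    (tscale (1 / of_nat (\<beta> + \<gamma> choose (ht p + ht q))) (cls_sum (\<beta> + \<gamma>) (ht p + ht q)) \<otimes>\<^sub>T
     tscale (1 / of_nat (\<alpha> + \<gamma> choose (ht r + (\<gamma> - ht q)))) (cls_sum (\<alpha> + \<gamma>) (ht r + (\<gamma> - ht q)))))"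
proof -
  have e: "(\<alpha> + \<gamma> + (\<alpha> + \<beta>) - (\<beta> + \<gamma>)) div 2 = \<alpha>" "(\<beta> + \<gamma> + (\<alpha> + \<beta>) - (\<alpha> + \<gamma>)) div 2 = \<beta>"
    "(\<beta> + \<gamma> + (\<alpha> + \<gamma>) - (\<alpha> + \<beta>)) div 2 = \<gamma>"
    by auto
  have "id_tmap_id \<beta> 0 \<alpha> (cup \<gamma>) (word_tensor (p @ [] @ r)) = (\<Sum>q\<in>words \<gamma>. tscale ((- 1) ^ ht q) (word_tensor ((p @ q) @ (dual_word q @ r))))"
    using p r by (subst id_tmap_id_word_tensor) (simp_all add: cup_word_tensor tprod_sum_left tprod_sum_right word_tensor_append)
  then have "iota (\<beta> + \<gamma>) (\<alpha> + \<gamma>) (\<alpha> + \<beta>) (word_tensor (p @ r)) = (\<Sum>q\<in>words \<gamma>. tscale ((- 1) ^ ht q)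
      (tmap (\<beta> + \<gamma>) (\<alpha> + \<gamma>) (symmetrizer (\<beta> + \<gamma>)) (symmetrizer (\<alpha> + \<gamma>)) (word_tensor ((p @ q) @ (dual_word q @ r)))))"
    unfolding iota_def Let_def e comp_apply by (simp only: append_Nil tlinear_sum[OF tlinear_tmap])
  also have "\<dots> = (\<Sum>q\<in>words \<gamma>. tscale ((- 1) ^ ht q)
    (tscale (1 / of_nat (\<beta> + \<gamma> choose (ht p + ht q))) (cls_sum (\<beta> + \<gamma>) (ht p + ht q)) \<otimes>\<^sub>T
     tscale (1 / of_nat (\<alpha> + \<gamma> choose (ht r + (\<gamma> - ht q)))) (cls_sum (\<alpha> + \<gamma>) (ht r + (\<gamma> - ht q)))))"
  proof (rule sum.cong[OF refl])
    fix q assume q: "q \<in> words \<gamma>"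
    have w: "p @ q \<in> words (\<beta> + \<gamma>)" "dual_word q @ r \<in> words (\<alpha> + \<gamma>)"
      using p q r dual_word_in_words[OF q] by (auto simp: words_def)
    have h: "ht (p @ q) = ht p + ht q" "ht (dual_word q @ r) = ht r + (\<gamma> - ht q)"
      using q by (simp_all add: ht_dual_word words_def)
    show "tscale ((- 1) ^ ht q) (tmap (\<beta> + \<gamma>) (\<alpha> + \<gamma>) (symmetrizer (\<beta> + \<gamma>)) (symmetrizer (\<alpha> + \<gamma>)) (word_tensor ((p @ q) @ (dual_word q @ r))))
      = tscale ((- 1) ^ ht q)
    (tscale (1 / of_nat (\<beta> + \<gamma> choose (ht p + ht q))) (cls_sum (\<beta> + \<gamma>) (ht p + ht q)) \<otimes>\<^sub>T
     tscale (1 / of_nat (\<alpha> + \<gamma> choose (ht r + (\<gamma> - ht q)))) (cls_sum (\<alpha> + \<gamma>) (ht r + (\<gamma> - ht q))))"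
      by (simp only: tmap_word_tensor[OF w] symmetrizer_word_tensor[OF w(1)] symmetrizer_word_tensor[OF w(2)] h)
  qed
  finally show ?thesis .
qed

lemma sum_cls_words:
  fixes f :: "2 list \<Rightarrow> complex"
  shows "(\<Sum>w\<in>cls n k. f w) = (\<Sum>w\<in>words n. (if ht w = k then 1 else 0) * f w)"
proof -
  have "(\<Sum>w\<in>cls n k. f w) = (\<Sum>w\<in>words n. if ht w = k then f w else 0)"
    unfolding cls_def by (rule sum.inter_filter) simp
  also have "\<dots> = (\<Sum>w\<in>words n. (if ht w = k then 1 else 0) * f w)"
    by (intro sum.cong refl) auto
  finally show ?thesis .
qed

text \<open>Symmetrizing the outputs divides by the binomials of \<open>a\<close> and
  \<open>b\<close>, while the input orbit is not divided. In unit vectors one square root of each of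
  the three binomials remains, which treats inputs and outputs alike; hence the same array serves in
  \<open>proj_sbasis\<close>.\<close>

lemma iota_sbasis:
  assumes "admissible a b c" and "k \<le> c"
  shows "iota a b c (sbasis c k)
    = (\<Sum>i\<le>a. \<Sum>j\<le>b. tscale (of_real (cg a b c i j k)) (sbasis a i \<otimes>\<^sub>T sbasis b j))"
proof
  fix v
  obtain \<alpha> \<beta> \<gamma> where e: "a = \<beta> + \<gamma>" "b = \<alpha> + \<gamma>" "c = \<alpha> + \<beta>"
    using assms(1) by (rule admissibleE)
  define G where "G i j = (tscale (1 / of_nat (a choose i)) (cls_sum a i) \<otimes>\<^sub>T
      tscale (1 / of_nat (b choose j)) (cls_sum b j)) v" for i j
  define F :: "nat \<Rightarrow> nat \<Rightarrow> nat \<Rightarrow> complex" where "F i j k' = (if k' = k then 1 else 0) * G i j" for i j k'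
  have "iota a b c (cls_sum c k) v = (\<Sum>w\<in>words (\<beta> + \<alpha>). (if ht w = k then 1 else 0) * iota a b c (word_tensor w) v)"
    by (simp add: cls_sum_eq tlinear_sum_plain[OF tlinear_iota] sum_cls_words e add.commute)
  also have "\<dots> = (\<Sum>p\<in>words \<beta>. \<Sum>r\<in>words \<alpha>. \<Sum>q\<in>words \<gamma>. (- 1) ^ ht q *
      F (ht p + ht q) (ht r + (\<gamma> - ht q)) (ht p + ht r))"
    unfolding sum_words_append
  proof (intro sum.cong refl)
    fix p r assume pr: "p \<in> words \<beta>" "r \<in> words \<alpha>"
    have "iota a b c (word_tensor (p @ r)) v = (\<Sum>q\<in>words \<gamma>. (- 1) ^ ht q * G (ht p + ht q) (ht r + (\<gamma> - ht q)))"
      unfolding e iota_word_tensor[OF pr] G_def by simp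
    then show "(if ht (p @ r) = k then 1 else 0) * iota a b c (word_tensor (p @ r)) v
        = (\<Sum>q\<in>words \<gamma>. (- 1) ^ ht q * F (ht p + ht q) (ht r + (\<gamma> - ht q)) (ht p + ht r))"
      by (simp add: F_def)
  qed
  also have "\<dots> = (\<Sum>p\<in>words \<beta>. \<Sum>q\<in>words \<gamma>. \<Sum>r\<in>words \<alpha>. (- 1) ^ ht q *
      F (ht p + ht q) (ht r + (\<gamma> - ht q)) (ht p + ht r))"
    by (rule sum.cong[OF refl], rule sum.swap)
  also have "\<dots> = (\<Sum>i\<le>a. \<Sum>j\<le>b. \<Sum>k'\<le>c. of_real (cg_coeff \<alpha> \<beta> \<gamma> i j k') * F i j k')"
    unfolding e by (rule sum_words3)
  also have "\<dots> = (\<Sum>i\<le>a. \<Sum>j\<le>b. of_real (cg_coeff \<alpha> \<beta> \<gamma> i j k) * G i j)"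
    using assms(2) by (intro sum.cong refl)
      (simp add: F_def if_distrib[of "\<lambda>y. y * _"] if_distrib[of "\<lambda>y. _ * y"] cong: if_cong)
  also have "\<dots> = of_real (sqrt_choose c k) * (\<Sum>i\<le>a. \<Sum>j\<le>b. of_real (cg a b c i j k) * (sbasis a i \<otimes>\<^sub>T sbasis b j) v)"
    unfolding sum_distrib_left
  proof (intro sum.cong refl)
    fix i j assume ij: "i \<in> {..a}" "j \<in> {..b}"
    have nz: "sqrt_choose a i \<noteq> 0" "sqrt_choose b j \<noteq> 0" "sqrt_choose c k \<noteq> 0"
      using ij assms(2) by (auto simp: sqrt_choose_nonzero)
    have "cg_coeff \<alpha> \<beta> \<gamma> i j k = sqrt_choose c k * cg a b c i j k * sqrt_choose a i * sqrt_choose b j"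
      using nz unfolding e by (simp add: cg_eq)
    then show "of_real (cg_coeff \<alpha> \<beta> \<gamma> i j k) * G i j
        = of_real (sqrt_choose c k) * (of_real (cg a b c i j k) * (sbasis a i \<otimes>\<^sub>T sbasis b j) v)"
      using nz by (simp add: G_def of_nat_choose sbasis_def tprod_scale)
  qed
  finally have "iota a b c (cls_sum c k) v
      = of_real (sqrt_choose c k) * (\<Sum>i\<le>a. \<Sum>j\<le>b. of_real (cg a b c i j k) * (sbasis a i \<otimes>\<^sub>T sbasis b j) v)" .
  then show "iota a b c (sbasis c k) v
      = (\<Sum>i\<le>a. \<Sum>j\<le>b. tscale (of_real (cg a b c i j k)) (sbasis a i \<otimes>\<^sub>T sbasis b j)) v"
    using sqrt_choose_nonzero[OF assms(2)] by (simp add: sbasis_def[of c] tlinear_scale[OF tlinear_iota])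
qed

lemma proj_word_tensor:
  assumes p: "p \<in> words \<beta>" and q: "q \<in> words \<gamma>" "q' \<in> words \<gamma>" and r: "r \<in> words \<alpha>"
  shows "proj (\<beta> + \<gamma>) (\<alpha> + \<gamma>) (\<alpha> + \<beta>) (word_tensor ((p @ q) @ (q' @ r))) =
    tscale (if q' = dual_word q then (- 1) ^ ht q else 0)
      (tscale (1 / of_nat (\<alpha> + \<beta> choose (ht p + ht r))) (cls_sum (\<alpha> + \<beta>) (ht p + ht r)))"
proof -
  have e: "(\<alpha> + \<gamma> + (\<alpha> + \<beta>) - (\<beta> + \<gamma>)) div 2 = \<alpha>" "(\<beta> + \<gamma> + (\<alpha> + \<beta>) - (\<alpha> + \<gamma>)) div 2 = \<beta>"
    "(\<beta> + \<gamma> + (\<alpha> + \<gamma>) - (\<alpha> + \<beta>)) div 2 = \<gamma>"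
    by auto
  have qq: "q @ q' \<in> words (2 * \<gamma>)" using q by (simp add: words_def)
  have pr: "p @ r \<in> words (\<alpha> + \<beta>)" using p r by (simp add: words_def)
  have "id_tmap_id \<beta> (2 * \<gamma>) \<alpha> (cap \<gamma>) (word_tensor (p @ (q @ q') @ r)) = tscale (if q' = dual_word q then (- 1) ^ ht q else 0) (word_tensor (p @ r))"
    by (simp only: id_tmap_id_word_tensor[OF p qq r] cap_word_tensor[OF q] tprod_scale word_tensor_append append_Nil)
  then have "proj (\<beta> + \<gamma>) (\<alpha> + \<gamma>) (\<alpha> + \<beta>) (word_tensor ((p @ q) @ (q' @ r))) =
    tscale (if q' = dual_word q then (- 1) ^ ht q else 0) (symmetrizer (\<alpha> + \<beta>) (word_tensor (p @ r)))"
    unfolding proj_def Let_def e comp_apply by (simp only: append_assoc tlinear_scale[OF tlinear_symmetrizer])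
  then show ?thesis
    by (simp only: symmetrizer_word_tensor[OF pr] count_list_append)
qed

lemma proj_sbasis:
  assumes "admissible a b c" and ij: "i \<le> a" "j \<le> b"
  shows "proj a b c (sbasis a i \<otimes>\<^sub>T sbasis b j)
    = (\<Sum>k\<le>c. tscale (of_real (cg a b c i j k)) (sbasis c k))"
proof
  fix v
  obtain \<alpha> \<beta> \<gamma> where e: "a = \<beta> + \<gamma>" "b = \<alpha> + \<gamma>" "c = \<alpha> + \<beta>"
    using assms(1) by (rule admissibleE)
  define G where "G k = tscale (1 / of_nat (c choose k)) (cls_sum c k) v" for k
  define F :: "nat \<Rightarrow> nat \<Rightarrow> nat \<Rightarrow> complex" where
    "F i' j' k = (if i' = i then 1 else 0) * ((if j' = j then 1 else 0) * G k)" for i' j' k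
  have "cls_sum a i \<otimes>\<^sub>T cls_sum b j = (\<Sum>u\<in>cls a i. \<Sum>w\<in>cls b j. word_tensor (u @ w))"
  proof -
    have "cls_sum a i \<otimes>\<^sub>T cls_sum b j = (\<Sum>u\<in>cls a i. word_tensor u \<otimes>\<^sub>T cls_sum b j)"
      using tprod_sum_left[of "\<lambda>_. 1" word_tensor "cls a i"] by (simp add: cls_sum_eq[of a])
    also have "\<dots> = (\<Sum>u\<in>cls a i. \<Sum>w\<in>cls b j. word_tensor (u @ w))"
      using tprod_sum_right[of _ "\<lambda>_. 1" word_tensor "cls b j"] by (simp add: cls_sum_eq[of b] word_tensor_append)
    finally show ?thesis .
  qed
  then have "proj a b c (cls_sum a i \<otimes>\<^sub>T cls_sum b j) v = (\<Sum>u\<in>words (\<beta> + \<gamma>). \<Sum>w\<in>words (\<gamma> + \<alpha>).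
      (if ht u = i then 1 else 0) * ((if ht w = j then 1 else 0) * proj a b c (word_tensor (u @ w)) v))"
    by (simp add: tlinear_sum_plain[OF tlinear_proj] sum_cls_words sum_distrib_left)
       (simp only: e add.commute)
  also have "\<dots> = (\<Sum>p\<in>words \<beta>. \<Sum>q\<in>words \<gamma>. \<Sum>q'\<in>words \<gamma>. \<Sum>r\<in>words \<alpha>.
      (if ht (p @ q) = i then 1 else 0) * ((if ht (q' @ r) = j then 1 else 0) * proj a b c (word_tensor ((p @ q) @ (q' @ r))) v))"
    by (simp only: sum_words_append)
  also have "\<dots> = (\<Sum>p\<in>words \<beta>. \<Sum>q\<in>words \<gamma>. \<Sum>r\<in>words \<alpha>. (- 1) ^ ht q *
      F (ht p + ht q) (ht r + (\<gamma> - ht q)) (ht p + ht r))"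
  proof (rule sum.cong[OF refl], rule sum.cong[OF refl])
    fix p q assume pq: "p \<in> words \<beta>" "q \<in> words \<gamma>"
    \<comment> \<open>The caps force \<open>q' = dual_word q\<close>, so the sum over
      \<open>q'\<close> collapses.\<close>
    have "(\<Sum>q'\<in>words \<gamma>. \<Sum>r\<in>words \<alpha>. (if ht (p @ q) = i then 1 else 0) *
        ((if ht (q' @ r) = j then 1 else 0) * proj a b c (word_tensor ((p @ q) @ (q' @ r))) v))
      = (\<Sum>q'\<in>words \<gamma>. if q' = dual_word q then \<Sum>r\<in>words \<alpha>. (- 1) ^ ht q *
          F (ht p + ht q) (ht r + (\<gamma> - ht q)) (ht p + ht r) else 0)"
    proof (rule sum.cong[OF refl])
      fix q' assume q': "q' \<in> words \<gamma>"
      have "proj a b c (word_tensor ((p @ q) @ (q' @ r))) v = (if q' = dual_word q then (- 1) ^ ht q else 0) * G (ht p + ht r)"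
        if "r \<in> words \<alpha>" for r
        unfolding e proj_word_tensor[OF pq q' that] G_def by simp
      moreover have "ht (dual_word q @ r) = ht r + (\<gamma> - ht q)" for r
        using pq by (simp add: ht_dual_word words_def)
      ultimately show "(\<Sum>r\<in>words \<alpha>. (if ht (p @ q) = i then 1 else 0) *
          ((if ht (q' @ r) = j then 1 else 0) * proj a b c (word_tensor ((p @ q) @ (q' @ r))) v))
        = (if q' = dual_word q then \<Sum>r\<in>words \<alpha>. (- 1) ^ ht q *
          F (ht p + ht q) (ht r + (\<gamma> - ht q)) (ht p + ht r) else 0)"
        by (cases "q' = dual_word q") (auto simp: F_def intro!: sum.cong sum.neutral)
    qed
    also have "\<dots> = (\<Sum>r\<in>words \<alpha>. (- 1) ^ ht q * F (ht p + ht q) (ht r + (\<gamma> - ht q)) (ht p + ht r))"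
      using dual_word_in_words[OF pq(2)] by simp
    finally show "(\<Sum>q'\<in>words \<gamma>. \<Sum>r\<in>words \<alpha>. (if ht (p @ q) = i then 1 else 0) *
        ((if ht (q' @ r) = j then 1 else 0) * proj a b c (word_tensor ((p @ q) @ (q' @ r))) v))
      = (\<Sum>r\<in>words \<alpha>. (- 1) ^ ht q * F (ht p + ht q) (ht r + (\<gamma> - ht q)) (ht p + ht r))" .
  qed
  also have "\<dots> = (\<Sum>i'\<le>a. \<Sum>j'\<le>b. \<Sum>k\<le>c. of_real (cg_coeff \<alpha> \<beta> \<gamma> i' j' k) * F i' j' k)"
    unfolding e by (rule sum_words3)
  also have "\<dots> = (\<Sum>i'\<le>a. if i' = i then (\<Sum>j'\<le>b. if j' = j then (\<Sum>k\<le>c. of_real (cg_coeff \<alpha> \<beta> \<gamma> i j k) * G k) else 0) else 0)"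
  proof (rule sum.cong[OF refl])
    fix i'
    have "(\<Sum>j'\<le>b. \<Sum>k\<le>c. of_real (cg_coeff \<alpha> \<beta> \<gamma> i j' k) * ((if j' = j then 1 else 0) * G k))
      = (\<Sum>j'\<le>b. if j' = j then (\<Sum>k\<le>c. of_real (cg_coeff \<alpha> \<beta> \<gamma> i j k) * G k) else 0)"
      by (rule sum.cong[OF refl]) simp
    then show "(\<Sum>j'\<le>b. \<Sum>k\<le>c. of_real (cg_coeff \<alpha> \<beta> \<gamma> i' j' k) * F i' j' k) = (if i' = i then
        (\<Sum>j'\<le>b. if j' = j then (\<Sum>k\<le>c. of_real (cg_coeff \<alpha> \<beta> \<gamma> i j k) * G k) else 0) else 0)"
      by (cases "i' = i") (simp_all only: F_def simp_thms if_True if_False mult_1_left mult_zero_left mult_zero_right sum.neutral_const)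
  qed
  also have "\<dots> = (\<Sum>k\<le>c. of_real (cg_coeff \<alpha> \<beta> \<gamma> i j k) * G k)"
    using ij by simp
  also have "\<dots> = of_real (sqrt_choose a i) * of_real (sqrt_choose b j) * (\<Sum>k\<le>c. of_real (cg a b c i j k) * sbasis c k v)"
    unfolding sum_distrib_left
  proof (intro sum.cong refl)
    fix k assume k: "k \<in> {..c}"
    have nz: "sqrt_choose a i \<noteq> 0" "sqrt_choose b j \<noteq> 0" "sqrt_choose c k \<noteq> 0"
      using ij k by (auto simp: sqrt_choose_nonzero)
    have "cg_coeff \<alpha> \<beta> \<gamma> i j k = sqrt_choose c k * cg a b c i j k * sqrt_choose a i * sqrt_choose b j"
      using nz unfolding e by (simp add: cg_eq)
    then show "of_real (cg_coeff \<alpha> \<beta> \<gamma> i j k) * G k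
        = of_real (sqrt_choose a i) * of_real (sqrt_choose b j) * (of_real (cg a b c i j k) * sbasis c k v)"
      using nz by (simp add: G_def of_nat_choose sbasis_def)
  qed
  finally have "proj a b c (cls_sum a i \<otimes>\<^sub>T cls_sum b j) v
      = of_real (sqrt_choose a i) * of_real (sqrt_choose b j) * (\<Sum>k\<le>c. of_real (cg a b c i j k) * sbasis c k v)" .
  then show "proj a b c (sbasis a i \<otimes>\<^sub>T sbasis b j) v = (\<Sum>k\<le>c. tscale (of_real (cg a b c i j k)) (sbasis c k)) v"
    using sqrt_choose_nonzero[OF ij(1)] sqrt_choose_nonzero[OF ij(2)]
    by (simp add: sbasis_def[of a] sbasis_def[of b] tprod_scale tlinear_scale[OF tlinear_proj])
qed

section \<open>Traces on symmetric tensors\<close>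

text \<open>One word from each orbit: evaluating a symmetric tensor there reads off a coordinate, up
  to normalisation.\<close>

definition rep_word :: "nat \<Rightarrow> nat \<Rightarrow> 2 list" where
  "rep_word n k = replicate (n - k) 1 @ replicate k 2"

lemma rep_word: "k \<le> n \<Longrightarrow> length (rep_word n k) = n" "k \<le> n \<Longrightarrow> ht (rep_word n k) = k"
proof -
  have "count_list (replicate m (x::2)) y = (if x = y then m else 0)" for m x y
    by (induction m) auto
  then show "k \<le> n \<Longrightarrow> ht (rep_word n k) = k" by (simp add: rep_word_def)
qed (simp add: rep_word_def)

lemma sbasis_rep_word:
  assumes "k \<le> n" "l \<le> n"
  shows "sbasis n l (rep_word n k) = (if k = l then 1 / of_real (sqrt_choose n k) else 0)"
  using assms by (simp add: sbasis_def cls_sum_def rep_word)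

lemma group_power_word_tensor:
  assumes "length v = n" "w \<in> words n"
  shows "group_power x n (word_tensor w) v = ent x v w"
proof -
  have "(x *v std j) $ i = x $ i $ j" for i j
    by (simp add: matrix_vector_mult_def std_def axis_def if_distrib[of "\<lambda>y. _ * y"] cong: if_cong)
  then show ?thesis
    using assms unfolding group_power_def
    by (simp add: lin_ext_word_tensor) (simp add: pure_def ent_def words_def)
qed

text \<open>A row sum over an orbit depends on \<open>v\<close> through \<open>ht v\<close> only,
  because its generating polynomial does. Hence the block sum \<open>grp\<close> is
  \<open>n choose ht v\<close> times any one row sum.\<close>

lemma sum_ent_cls:
  assumes v: "v \<in> words n" and k: "k \<le> n"
  shows "(\<Sum>w\<in>cls n k. ent x v w) = grp n x (ht v) k / of_nat (n choose ht v)"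
proof -
  have poly: "(\<Sum>k\<le>n. (\<Sum>w\<in>cls n k. ent x v w) * z ^ k)
      = (x $ 1 $ 1 + x $ 1 $ 2 * z) ^ (n - ht v) * (x $ 2 $ 1 + x $ 2 $ 2 * z) ^ ht v"
    if v: "v \<in> words n" for v z
  proof -
    have "(\<Sum>k\<le>n. (\<Sum>w\<in>cls n k. ent x v w) * z ^ k) = (\<Sum>k\<le>n. \<Sum>w\<in>cls n k. ent x v w * z ^ ht w)"
      unfolding sum_distrib_right by (intro sum.cong refl) (simp add: cls_def)
    also have "\<dots> = (\<Sum>w\<in>words n. ent (transpose x) w v * z ^ ht w)"
      unfolding sum_words_cls[symmetric] using v by (intro sum.cong refl) (simp add: ent_transpose words_def)
    also have "\<dots> = (x $ 1 $ 1 + x $ 1 $ 2 * z) ^ (n - ht v) * (x $ 2 $ 1 + x $ 2 $ 2 * z) ^ ht v"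
      using sum_ent[of "transpose x" v 1 z] v by (simp add: words_def) (simp add: transpose_def)
    finally show ?thesis .
  qed
  have eq: "(\<Sum>w\<in>cls n k. ent x v' w) = (\<Sum>w\<in>cls n k. ent x v w)" if "v' \<in> cls n (ht v)" for v'
  proof -
    have "(\<Sum>k\<le>n. (\<Sum>w\<in>cls n k. ent x v' w) * z ^ k) = (\<Sum>k\<le>n. (\<Sum>w\<in>cls n k. ent x v w) * z ^ k)" for z
    proof -
      have "v' \<in> words n" "ht v' = ht v" using that by (auto simp: cls_def)
      then show ?thesis using v by (simp add: poly)
    qed
    then show ?thesis
      using k polyfun_eq_coeffs[of "\<lambda>k. \<Sum>w\<in>cls n k. ent x v' w" n "\<lambda>k. \<Sum>w\<in>cls n k. ent x v w"] by blast
  qed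
  have "grp n x (ht v) k = of_nat (n choose ht v) * (\<Sum>w\<in>cls n k. ent x v w)"
    unfolding grp_def by (simp add: eq card_cls)
  then show ?thesis
    using ht_le_words[OF v] by simp
qed

lemma group_sbasis:
  assumes k: "k \<le> n"
  shows "group_power x n (sbasis n k) = (\<Sum>i\<le>n. tscale (rho n x i k) (sbasis n i))"
proof
  fix v
  have nz: "sqrt_choose n k \<noteq> 0" using k by (rule sqrt_choose_nonzero)
  have "group_power x n (cls_sum n k) v = of_real (sqrt_choose n k) * (\<Sum>i\<le>n. rho n x i k * sbasis n i v)"
  proof (cases "v \<in> words n")
    case True
    then have h: "ht v \<le> n" and l: "length v = n" by (auto simp: ht_le_words words_def)
    have "group_power x n (cls_sum n k) v = (\<Sum>w\<in>cls n k. ent x v w)"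
      by (simp add: cls_sum_eq tlinear_sum_plain[OF tlinear_group])
         (intro sum.cong refl group_power_word_tensor l, simp add: cls_def)
    also have "\<dots> = of_real (sqrt_choose n k) * (\<Sum>i\<le>n. if i = ht v then rho n x i k / of_real (sqrt_choose n i) else 0)"
      using h nz by (simp add: sum_ent_cls[OF True k] rho_def of_nat_choose)
    also have "(\<Sum>i\<le>n. if i = ht v then rho n x i k / of_real (sqrt_choose n i) else 0) = (\<Sum>i\<le>n. rho n x i k * sbasis n i v)"
      by (intro sum.cong refl) (auto simp: sbasis_def cls_sum_def l)
    finally show ?thesis .
  next
    case False
    have "group_power x n (cls_sum n k) v = 0"
      unfolding group_power_def lin_ext_apply using False
      by (intro sum.neutral) (auto simp: pure_def words_def)
    moreover have "sbasis n i v = 0" for i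
      using False by (auto simp: sbasis_def cls_sum_def words_def)
    ultimately show ?thesis by simp
  qed
  then show "group_power x n (sbasis n k) v = (\<Sum>i\<le>n. tscale (rho n x i k) (sbasis n i)) v"
    using nz by (simp add: sbasis_def[of n k] tlinear_scale[OF tlinear_group])
qed

lemma symmetrizer_sbasis:
  assumes "k \<le> n"
  shows "symmetrizer n (sbasis n k) = sbasis n k"
proof -
  have "symmetrizer n (cls_sum n k) = (\<Sum>w\<in>cls n k. tscale (1 / of_nat (n choose k)) (cls_sum n k))"
    unfolding cls_sum_eq[of n k] tlinear_sum_plain[OF tlinear_symmetrizer]
  proof (rule sum.cong[OF refl])
    fix w assume "w \<in> cls n k"
    then have "w \<in> words n" "ht w = k" by (auto simp: cls_def)
    then show "symmetrizer n (word_tensor w) = tscale (1 / of_nat (n choose k)) (sum word_tensor (cls n k))"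
      using symmetrizer_word_tensor[of w n] by (simp only: cls_sum_eq)
  qed
  also have "\<dots> = cls_sum n k"
    using assms by (simp add: fun_eq_iff card_cls)
  finally show ?thesis
    by (simp add: sbasis_def tlinear_scale[OF tlinear_symmetrizer])
qed

lemma combination_in_range: "(\<Sum>k\<le>n. tscale (c k) (sbasis n k)) \<in> range (\<lambda>c. \<Sum>k\<le>n. tscale (c k) (sbasis n k))"
  by (rule range_eqI[of _ _ c]) (rule refl)

lemma Sym_eq: "Sym n = range (\<lambda>c. \<Sum>k\<le>n. tscale (c k) (sbasis n k))"
proof (intro equalityI subsetI)
  fix t assume "t \<in> Sym n"
  then obtain s where s: "s \<in> tensor_power n" "t = symmetrizer n s"
    by (auto simp: Sym_def)
  have "t = (\<Sum>w\<in>words n. tscale (s w) (symmetrizer n (word_tensor w)))"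
    unfolding s(2) by (subst tensor_expand[OF s(1)]) (simp only: tlinear_sum[OF tlinear_symmetrizer])
  also have "\<dots> = (\<Sum>k\<le>n. \<Sum>w\<in>cls n k. tscale (s w) (symmetrizer n (word_tensor w)))"
    by (rule sum_words_cls)
  also have "\<dots> = (\<Sum>k\<le>n. tscale ((\<Sum>w\<in>cls n k. s w) / of_nat (n choose k) * of_real (sqrt_choose n k)) (sbasis n k))"
  proof (intro sum.cong refl)
    fix k assume k: "k \<in> {..n}"
    have "(\<Sum>w\<in>cls n k. tscale (s w) (symmetrizer n (word_tensor w)))
        = (\<Sum>w\<in>cls n k. tscale (s w / of_nat (n choose k) * of_real (sqrt_choose n k)) (sbasis n k))"
      using k by (intro sum.cong refl) (auto simp: cls_def symmetrizer_word_tensor cls_sum_sbasis fun_eq_iff)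
    then show "(\<Sum>w\<in>cls n k. tscale (s w) (symmetrizer n (word_tensor w)))
        = tscale ((\<Sum>w\<in>cls n k. s w) / of_nat (n choose k) * of_real (sqrt_choose n k)) (sbasis n k)"
      by (simp add: fun_eq_iff sum_divide_distrib sum_distrib_right)
  qed
  finally show "t \<in> range (\<lambda>c. \<Sum>k\<le>n. tscale (c k) (sbasis n k))"
    by (simp only: combination_in_range)
next
  fix t assume "t \<in> range (\<lambda>c. \<Sum>k\<le>n. tscale (c k) (sbasis n k))"
  then obtain c where t: "t = (\<Sum>k\<le>n. tscale (c k) (sbasis n k))" by blast
  have "symmetrizer n t = t"
    unfolding t tlinear_sum[OF tlinear_symmetrizer] by (simp add: symmetrizer_sbasis)
  moreover have "t \<in> tensor_power n"
    using sbasis_in_tensor_power[of n] unfolding t by (simp add: tensor_power_def)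
  ultimately show "t \<in> Sym n"
    unfolding Sym_def by (metis image_eqI)
qed

lemma span_sbasis: "tensor.span (sbasis n ` {..n}) = Sym n"
proof
  have "tensor.subspace (Sym n)"
  proof (rule tensor.subspaceI)
    show "0 \<in> Sym n"
      unfolding Sym_eq by (rule image_eqI[of _ _ "\<lambda>_. 0"]) (auto simp: fun_eq_iff)
    show "s + t \<in> Sym n" if "s \<in> Sym n" "t \<in> Sym n" for s t
    proof -
      obtain c d where "s = (\<Sum>k\<le>n. tscale (c k) (sbasis n k))" "t = (\<Sum>k\<le>n. tscale (d k) (sbasis n k))"
        using \<open>s \<in> Sym n\<close> \<open>t \<in> Sym n\<close> unfolding Sym_eq by blast
      then have "s + t = (\<Sum>k\<le>n. tscale (c k + d k) (sbasis n k))"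
        by (simp add: fun_eq_iff sum.distrib algebra_simps)
      then show ?thesis by (simp only: Sym_eq combination_in_range)
    qed
    show "tscale x t \<in> Sym n" if "t \<in> Sym n" for x t
    proof -
      obtain c where "t = (\<Sum>k\<le>n. tscale (c k) (sbasis n k))"
        using \<open>t \<in> Sym n\<close> unfolding Sym_eq by blast
      then have "tscale x t = (\<Sum>k\<le>n. tscale (x * c k) (sbasis n k))"
        by (simp add: fun_eq_iff sum_distrib_left mult.assoc)
      then show ?thesis by (simp only: Sym_eq combination_in_range)
    qed
  qed
  moreover have "sbasis n k \<in> Sym n" if "k \<le> n" for k
    unfolding Sym_eq using that
    by (intro image_eqI[of _ _ "\<lambda>l. if l = k then 1 else 0"]) (auto simp: fun_eq_iff if_distrib[of "\<lambda>y. y * _"] cong: if_cong)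
  ultimately show "tensor.span (sbasis n ` {..n}) \<subseteq> Sym n"
    by (intro tensor.span_minimal) auto
  show "Sym n \<subseteq> tensor.span (sbasis n ` {..n})"
    unfolding Sym_eq
    by (clarify, rule tensor.span_sum, rule tensor.span_scale, rule tensor.span_base, simp)
qed

lemma sbasis_in_Sym: "k \<le> n \<Longrightarrow> sbasis n k \<in> Sym n"
  unfolding span_sbasis[symmetric] by (intro tensor.span_base) simp

lemma Sym_expand:
  assumes "t \<in> Sym n"
  shows "t = (\<Sum>k\<le>n. tscale (t (rep_word n k) * of_real (sqrt_choose n k)) (sbasis n k))"
proof -
  obtain c where t: "t = (\<Sum>k\<le>n. tscale (c k) (sbasis n k))"
    using assms unfolding Sym_eq by blast
  have "t (rep_word n k) * of_real (sqrt_choose n k) = c k" if "k \<le> n" for k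
  proof -
    have "t (rep_word n k) = (\<Sum>l\<le>n. if k = l then c k / of_real (sqrt_choose n k) else 0)"
      unfolding t sum_fun_apply tscale_apply using that by (intro sum.cong refl) (auto simp: sbasis_rep_word)
    then show ?thesis using that sqrt_choose_nonzero[OF that] by simp
  qed
  then show ?thesis by (subst t) simp
qed

text \<open>\<open>trace_on\<close> uses an unspecified basis \<open>B\<close>, so independence of
  the basis is part of the claim: each \<open>b\<close> is expanded in unit vectors, the sums are
  exchanged, and the representation of \<open>f (sbasis n k)\<close> in \<open>B\<close> is put
  together again before its coordinate is taken.\<close>

lemma trace_on_Sym:
  assumes f: "tlinear f"
    and m: "\<And>k. k \<le> n \<Longrightarrow> f (sbasis n k) = (\<Sum>l\<le>n. tscale (m l k) (sbasis n l))"
  shows "trace_on (Sym n) f = (\<Sum>k\<le>n. m k k)"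
proof -
  define B where "B = (SOME B. tensor.independent B \<and> tensor.span B = Sym n)"
  have "\<exists>B. tensor.independent B \<and> tensor.span B = Sym n"
  proof -
    obtain B where B: "B \<subseteq> Sym n" "tensor.independent B" "Sym n \<subseteq> tensor.span B" "card B = tensor.dim (Sym n)"
      by (rule tensor.basis_exists)
    have "tensor.span B \<subseteq> Sym n"
      using tensor.span_mono[OF B(1)] unfolding span_sbasis[symmetric] tensor.span_span .
    with B show ?thesis by (intro exI[of _ B]) auto
  qed
  from someI_ex[OF this] have B: "tensor.independent B" "tensor.span B = Sym n"
    unfolding B_def by auto
  have BS: "B \<subseteq> Sym n" using B(2) tensor.span_superset by blast
  \<comment> \<open>A sum over an infinite set is zero by convention, so finiteness has to be known:
    \<open>B\<close> is independent inside the span of finitely many vectors.\<close>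
  have fin: "finite B"
    using tensor.independent_span_bound[of "sbasis n ` {..n}" B] B(1) BS by (simp add: span_sbasis)
  \<comment> \<open>On \<open>Sym n\<close> this is the coordinate along \<open>sbasis n k\<close>;
    as an evaluation it is linear on all tensors and passes through sums.\<close>
  define co where "co k t = t (rep_word n k) * of_real (sqrt_choose n k)" for k and t :: tensor
  have fS: "f (sbasis n k) \<in> Sym n" if "k \<le> n" for k
    unfolding m[OF that] Sym_eq by (rule combination_in_range)
  have "trace_on (Sym n) f = (\<Sum>b\<in>B. tensor.representation B (f b) b)"
    by (simp add: trace_on_def B_def Let_def)
  also have "\<dots> = (\<Sum>b\<in>B. \<Sum>k\<le>n. co k b * tensor.representation B (f (sbasis n k)) b)"
  proof (rule sum.cong[OF refl])
    fix b assume b: "b \<in> B"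
    then have e: "b = (\<Sum>k\<le>n. tscale (co k b) (sbasis n k))"
      using Sym_expand[of b n] BS by (auto simp: co_def)
    have fb: "f b = (\<Sum>k\<le>n. tscale (co k b) (f (sbasis n k)))"
      by (rule trans[OF arg_cong[OF e, of f] tlinear_sum[OF f]])
    show "tensor.representation B (f b) b = (\<Sum>k\<le>n. co k b * tensor.representation B (f (sbasis n k)) b)"
    proof -
      have sp: "f (sbasis n k) \<in> tensor.span B" if "k \<in> {..n}" for k
        using fS[of k] that by (simp add: B(2))
      have "tensor.representation B (\<Sum>k\<le>n. tscale (co k b) (f (sbasis n k)))
          = (\<lambda>b'. \<Sum>k\<le>n. tensor.representation B (tscale (co k b) (f (sbasis n k))) b')"
        by (rule tensor.representation_sum[OF B(1)]) (intro tensor.span_scale sp)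
      moreover have "tensor.representation B (tscale (co k b) (f (sbasis n k))) b
          = co k b * tensor.representation B (f (sbasis n k)) b" if "k \<in> {..n}" for k
        by (simp only: tensor.representation_scale[OF B(1) sp[OF that]])
      ultimately show ?thesis
        unfolding fb by simp
    qed
  qed
  also have "\<dots> = (\<Sum>k\<le>n. \<Sum>b\<in>B. tensor.representation B (f (sbasis n k)) b * co k b)"
    by (subst sum.swap) (simp only: mult.commute)
  also have "\<dots> = (\<Sum>k\<le>n. co k (\<Sum>b\<in>B. tscale (tensor.representation B (f (sbasis n k)) b) b))"
    by (simp add: co_def sum_distrib_right mult.assoc)
  also have "\<dots> = (\<Sum>k\<le>n. co k (f (sbasis n k)))"
    using fS B fin by (simp add: tensor.sum_representation_eq)
  also have "\<dots> = (\<Sum>k\<le>n. m k k)"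
  proof (intro sum.cong refl)
    fix k assume k: "k \<in> {..n}"
    have "f (sbasis n k) (rep_word n k) = (\<Sum>l\<le>n. if k = l then m k k / of_real (sqrt_choose n k) else 0)"
    proof -
      have "k \<le> n" using k by simp
      then show ?thesis
        unfolding m[OF \<open>k \<le> n\<close>] sum_fun_apply tscale_apply by (intro sum.cong refl) (auto simp: sbasis_rep_word)
    qed
    then show "co k (f (sbasis n k)) = m k k"
      using k sqrt_choose_nonzero[of k n] by (simp add: co_def)
  qed
  finally show ?thesis .
qed

lemma tlinear_sum2:
  assumes "tlinear f"
  shows "f (\<Sum>i\<in>A. \<Sum>j\<in>B. tscale (c i j) (g i j)) = (\<Sum>i\<in>A. \<Sum>j\<in>B. tscale (c i j) (f (g i j)))"
  using assms by (simp only: tlinear_sum_plain tlinear_scale)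

lemma tmap_group_sbasis:
  assumes "i \<le> a" "j \<le> b"
  shows "tmap a b (group_power x a) (group_power y b) (sbasis a i \<otimes>\<^sub>T sbasis b j)
    = (\<Sum>p\<le>a. \<Sum>q\<le>b. tscale (rho a x p i * rho b y q j) (sbasis a p \<otimes>\<^sub>T sbasis b q))"
proof -
  have "tmap a b (group_power x a) (group_power y b) (sbasis a i \<otimes>\<^sub>T sbasis b j)
     = (\<Sum>p\<le>a. tscale (rho a x p i) (\<Sum>q\<le>b. tscale (rho b y q j) (sbasis a p \<otimes>\<^sub>T sbasis b q)))"
    using assms
    by (simp only: tmap_tprod sbasis_in_tensor_power tlinear_group group_sbasis atMost_iff tprod_sum_left)
       (simp only: tprod_sum_right)
  then show ?thesis
    by (simp add: fun_eq_iff sum_distrib_left mult.assoc)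
qed

lemma central_function_eq:
  assumes "admissible a b c"
  shows "central_function a b c x y = (\<Sum>k\<le>c. \<Sum>i\<le>a. \<Sum>j\<le>b. \<Sum>p\<le>a. \<Sum>q\<le>b.
    of_real (cg a b c p q k) * (rho a x p i * rho b y q j) * of_real (cg a b c i j k))"
  unfolding central_function_def
proof (rule trace_on_Sym[where m = "\<lambda>l k. \<Sum>i\<le>a. \<Sum>j\<le>b. \<Sum>p\<le>a. \<Sum>q\<le>b.
    of_real (cg a b c p q l) * (rho a x p i * rho b y q j) * of_real (cg a b c i j k)"])
  show "tlinear (proj a b c \<circ> tmap a b (group_power x a) (group_power y b) \<circ> iota a b c)"
    by (intro tlinear_compose tlinear_proj tlinear_tmap tlinear_iota)
  fix k assume k: "k \<le> c"
  have "(proj a b c \<circ> tmap a b (group_power x a) (group_power y b) \<circ> iota a b c) (sbasis c k)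
    = (\<Sum>i\<le>a. \<Sum>j\<le>b. tscale (of_real (cg a b c i j k)) (proj a b c
        (tmap a b (group_power x a) (group_power y b) (sbasis a i \<otimes>\<^sub>T sbasis b j))))"
    by (simp only: comp_apply iota_sbasis[OF assms k] tlinear_sum2[OF tlinear_tmap] tlinear_sum2[OF tlinear_proj])
  also have "\<dots> = (\<Sum>i\<le>a. \<Sum>j\<le>b. tscale (of_real (cg a b c i j k)) (\<Sum>p\<le>a. \<Sum>q\<le>b.
      tscale (rho a x p i * rho b y q j) (\<Sum>l\<le>c. tscale (of_real (cg a b c p q l)) (sbasis c l))))"
    by (intro sum.cong refl arg_cong[of _ _ "tscale _"])
       (simp add: tmap_group_sbasis tlinear_sum2[OF tlinear_proj] proj_sbasis[OF assms])
  also have "\<dots> = (\<Sum>l\<le>c. tscale (\<Sum>i\<le>a. \<Sum>j\<le>b. \<Sum>p\<le>a. \<Sum>q\<le>b.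
    of_real (cg a b c p q l) * (rho a x p i * rho b y q j) * of_real (cg a b c i j k)) (sbasis c l))"
  proof
    fix v
    have "(\<Sum>i\<le>a. \<Sum>j\<le>b. tscale (of_real (cg a b c i j k)) (\<Sum>p\<le>a. \<Sum>q\<le>b.
        tscale (rho a x p i * rho b y q j) (\<Sum>l\<le>c. tscale (of_real (cg a b c p q l)) (sbasis c l)))) v
      = (\<Sum>i\<le>a. \<Sum>j\<le>b. \<Sum>p\<le>a. \<Sum>q\<le>b. \<Sum>l\<le>c. of_real (cg a b c p q l) *
          (rho a x p i * rho b y q j) * of_real (cg a b c i j k) * sbasis c l v)"
      by (simp add: sum_distrib_left mult_ac)
    also have "\<dots> = (\<Sum>i\<le>a. \<Sum>j\<le>b. \<Sum>l\<le>c. \<Sum>p\<le>a. \<Sum>q\<le>b. of_real (cg a b c p q l) *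
          (rho a x p i * rho b y q j) * of_real (cg a b c i j k) * sbasis c l v)"
      by (rule sum.cong[OF refl], rule sum.cong[OF refl], rule sum_swap3[symmetric])
    also have "\<dots> = (\<Sum>l\<le>c. \<Sum>i\<le>a. \<Sum>j\<le>b. \<Sum>p\<le>a. \<Sum>q\<le>b. of_real (cg a b c p q l) *
          (rho a x p i * rho b y q j) * of_real (cg a b c i j k) * sbasis c l v)"
      by (rule sum_swap3[symmetric])
    finally show "(\<Sum>i\<le>a. \<Sum>j\<le>b. tscale (of_real (cg a b c i j k)) (\<Sum>p\<le>a. \<Sum>q\<le>b.
        tscale (rho a x p i * rho b y q j) (\<Sum>l\<le>c. tscale (of_real (cg a b c p q l)) (sbasis c l)))) v
      = (\<Sum>l\<le>c. tscale (\<Sum>i\<le>a. \<Sum>j\<le>b. \<Sum>p\<le>a. \<Sum>q\<le>b.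
    of_real (cg a b c p q l) * (rho a x p i * rho b y q j) * of_real (cg a b c i j k)) (sbasis c l)) v"
      by (simp add: sum_distrib_right)
  qed
  finally show "(proj a b c \<circ> tmap a b (group_power x a) (group_power y b) \<circ> iota a b c) (sbasis c k)
    = (\<Sum>l\<le>c. tscale (\<Sum>i\<le>a. \<Sum>j\<le>b. \<Sum>p\<le>a. \<Sum>q\<le>b.
    of_real (cg a b c p q l) * (rho a x p i * rho b y q j) * of_real (cg a b c i j k)) (sbasis c l))" .
qed

text \<open>Since the matrices of \<open>proj\<close> and \<open>iota\<close> are transposes of one
  real array, the trace of their composite is the sum of its squared entries.\<close>

lemma Theta_eq:
  assumes "admissible a b c"
  shows "\<Theta> a b c = of_real (theta a b c)"
proof -
  have "\<Theta> a b c = (\<Sum>k\<le>c. \<Sum>i\<le>a. \<Sum>j\<le>b. of_real (cg a b c i j k) * of_real (cg a b c i j k))"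
    unfolding \<Theta>_def
  proof (rule trace_on_Sym[where m = "\<lambda>l k. \<Sum>i\<le>a. \<Sum>j\<le>b. of_real (cg a b c i j l) * of_real (cg a b c i j k)"])
    show "tlinear (proj a b c \<circ> iota a b c)"
      by (intro tlinear_compose tlinear_proj tlinear_iota)
    fix k assume k: "k \<le> c"
    have "(proj a b c \<circ> iota a b c) (sbasis c k)
      = (\<Sum>i\<le>a. \<Sum>j\<le>b. tscale (of_real (cg a b c i j k)) (\<Sum>l\<le>c. tscale (of_real (cg a b c i j l)) (sbasis c l)))"
      by (simp add: iota_sbasis[OF assms k] tlinear_sum2[OF tlinear_proj] proj_sbasis[OF assms])
    also have "\<dots> = (\<Sum>l\<le>c. tscale (\<Sum>i\<le>a. \<Sum>j\<le>b. of_real (cg a b c i j l) * of_real (cg a b c i j k)) (sbasis c l))"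
    proof
      fix v
      have "(\<Sum>i\<le>a. \<Sum>j\<le>b. tscale (of_real (cg a b c i j k)) (\<Sum>l\<le>c. tscale (of_real (cg a b c i j l)) (sbasis c l))) v
        = (\<Sum>i\<le>a. \<Sum>j\<le>b. \<Sum>l\<le>c. of_real (cg a b c i j l) * of_real (cg a b c i j k) * sbasis c l v)"
        by (simp add: sum_distrib_left mult_ac)
      also have "\<dots> = (\<Sum>l\<le>c. \<Sum>i\<le>a. \<Sum>j\<le>b. of_real (cg a b c i j l) * of_real (cg a b c i j k) * sbasis c l v)"
        by (rule sum_swap3[symmetric])
      finally show "(\<Sum>i\<le>a. \<Sum>j\<le>b. tscale (of_real (cg a b c i j k)) (\<Sum>l\<le>c. tscale (of_real (cg a b c i j l)) (sbasis c l))) v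
        = (\<Sum>l\<le>c. tscale (\<Sum>i\<le>a. \<Sum>j\<le>b. of_real (cg a b c i j l) * of_real (cg a b c i j k)) (sbasis c l)) v"
        by (simp add: sum_distrib_right)
    qed
    finally show "(proj a b c \<circ> iota a b c) (sbasis c k)
      = (\<Sum>l\<le>c. tscale (\<Sum>i\<le>a. \<Sum>j\<le>b. of_real (cg a b c i j l) * of_real (cg a b c i j k)) (sbasis c l))" .
  qed
  also have "\<dots> = of_real (theta a b c)"
    unfolding theta_def power2_eq_square of_real_sum of_real_mult by (rule sum_swap3)
  finally show ?thesis .
qed

section \<open>The 6j-symbols in coordinates\<close>

lemma tprod_in_tensor_power:
  "s \<in> tensor_power m \<Longrightarrow> t \<in> tensor_power n \<Longrightarrow> s \<otimes>\<^sub>T t \<in> tensor_power (m + n)"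
  by (auto simp: tensor_power_def tprod_apply)

lemma tprod_assoc:
  assumes "s \<in> tensor_power m" "t \<in> tensor_power n"
  shows "(s \<otimes>\<^sub>T t) \<otimes>\<^sub>T u = s \<otimes>\<^sub>T t \<otimes>\<^sub>T u"
proof
  fix w
  show "((s \<otimes>\<^sub>T t) \<otimes>\<^sub>T u) w = (s \<otimes>\<^sub>T t \<otimes>\<^sub>T u) w"
    by (auto simp: tprod_apply[OF tprod_in_tensor_power[OF assms]] tprod_apply[OF assms(1)] tprod_apply[OF assms(2)]
        min_def drop_take add.commute)
qed

lemma tprod_sum2_left:
  "(\<Sum>i\<in>A. \<Sum>j\<in>B. tscale (c i j) (s i j)) \<otimes>\<^sub>T t = (\<Sum>i\<in>A. \<Sum>j\<in>B. tscale (c i j) (s i j \<otimes>\<^sub>T t))"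
  using tprod_sum_left[of "\<lambda>_. 1" "\<lambda>i. \<Sum>j\<in>B. tscale (c i j) (s i j)" A t] by (simp add: tprod_sum_left)

lemma tprod_sum2_right:
  "t \<otimes>\<^sub>T (\<Sum>i\<in>A. \<Sum>j\<in>B. tscale (c i j) (s i j)) = (\<Sum>i\<in>A. \<Sum>j\<in>B. tscale (c i j) (t \<otimes>\<^sub>T s i j))"
  using tprod_sum_right[of t "\<lambda>_. 1" "\<lambda>i. \<Sum>j\<in>B. tscale (c i j) (s i j)" A] by (simp add: tprod_sum_right)

lemma iota_iota_right:
  assumes "admissible p e d" "admissible q r e" "z \<le> d"
  shows "tmap p e id (iota q r e) (iota p e d (sbasis d z)) v = (\<Sum>i\<le>p. \<Sum>j\<le>q. \<Sum>k\<le>r.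
    (\<Sum>y\<le>e. of_real (cg q r e j k y) * of_real (cg p e d i y z)) * (sbasis p i \<otimes>\<^sub>T sbasis q j \<otimes>\<^sub>T sbasis r k) v)"
proof -
  have "tmap p e id (iota q r e) (iota p e d (sbasis d z)) = (\<Sum>i\<le>p. \<Sum>y\<le>e. tscale (of_real (cg p e d i y z))
     (\<Sum>j\<le>q. \<Sum>k\<le>r. tscale (of_real (cg q r e j k y)) (sbasis p i \<otimes>\<^sub>T sbasis q j \<otimes>\<^sub>T sbasis r k)))"
    using assms by (simp add: iota_sbasis tlinear_sum2[OF tlinear_tmap] tmap_tprod sbasis_in_tensor_power
        tlinear_id tlinear_iota tprod_sum2_right)
  then have "tmap p e id (iota q r e) (iota p e d (sbasis d z)) v = (\<Sum>i\<le>p. \<Sum>y\<le>e. \<Sum>j\<le>q. \<Sum>k\<le>r.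
      of_real (cg q r e j k y) * of_real (cg p e d i y z) * (sbasis p i \<otimes>\<^sub>T sbasis q j \<otimes>\<^sub>T sbasis r k) v)"
    by (simp add: sum_distrib_left mult_ac)
  also have "\<dots> = (\<Sum>i\<le>p. \<Sum>j\<le>q. \<Sum>k\<le>r. \<Sum>y\<le>e.
      of_real (cg q r e j k y) * of_real (cg p e d i y z) * (sbasis p i \<otimes>\<^sub>T sbasis q j \<otimes>\<^sub>T sbasis r k) v)"
    by (rule sum.cong[OF refl], rule sum_swap3)
  finally show ?thesis by (simp only: sum_distrib_right)
qed

lemma iota_iota_left:
  assumes "admissible p q f" "admissible f r d" "z \<le> d"
  shows "tmap f r (iota p q f) id (iota f r d (sbasis d z)) v = (\<Sum>i\<le>p. \<Sum>j\<le>q. \<Sum>k\<le>r.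
    (\<Sum>y\<le>f. of_real (cg p q f i j y) * of_real (cg f r d y k z)) * (sbasis p i \<otimes>\<^sub>T sbasis q j \<otimes>\<^sub>T sbasis r k) v)"
proof -
  have "tmap f r (iota p q f) id (iota f r d (sbasis d z)) = (\<Sum>y\<le>f. \<Sum>k\<le>r. tscale (of_real (cg f r d y k z))
     (\<Sum>i\<le>p. \<Sum>j\<le>q. tscale (of_real (cg p q f i j y)) (sbasis p i \<otimes>\<^sub>T sbasis q j \<otimes>\<^sub>T sbasis r k)))"
    using assms by (simp add: iota_sbasis tlinear_sum2[OF tlinear_tmap] tmap_tprod sbasis_in_tensor_power
        tlinear_id tlinear_iota tprod_sum2_left tprod_assoc[OF sbasis_in_tensor_power sbasis_in_tensor_power])
  then have "tmap f r (iota p q f) id (iota f r d (sbasis d z)) v = (\<Sum>y\<le>f. \<Sum>k\<le>r. \<Sum>i\<le>p. \<Sum>j\<le>q.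
      of_real (cg p q f i j y) * of_real (cg f r d y k z) * (sbasis p i \<otimes>\<^sub>T sbasis q j \<otimes>\<^sub>T sbasis r k) v)"
    by (simp add: sum_distrib_left mult_ac)
  also have "\<dots> = (\<Sum>i\<le>p. \<Sum>j\<le>q. \<Sum>y\<le>f. \<Sum>k\<le>r.
      of_real (cg p q f i j y) * of_real (cg f r d y k z) * (sbasis p i \<otimes>\<^sub>T sbasis q j \<otimes>\<^sub>T sbasis r k) v)"
    by (rule sum_swap4)
  also have "\<dots> = (\<Sum>i\<le>p. \<Sum>j\<le>q. \<Sum>k\<le>r. \<Sum>y\<le>f.
      of_real (cg p q f i j y) * of_real (cg f r d y k z) * (sbasis p i \<otimes>\<^sub>T sbasis q j \<otimes>\<^sub>T sbasis r k) v)"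
    by (rule sum.cong[OF refl], rule sum.cong[OF refl], rule sum.swap)
  finally show ?thesis by (simp only: sum_distrib_right)
qed

lemma sbasis3_rep_word:
  assumes "i \<le> p" "j \<le> q" "k \<le> r" "i' \<le> p" "j' \<le> q" "k' \<le> r"
  shows "(sbasis p i' \<otimes>\<^sub>T sbasis q j' \<otimes>\<^sub>T sbasis r k') (rep_word p i @ rep_word q j @ rep_word r k)
    = (if i' = i then if j' = j then if k' = k then 1 / of_real (sqrt_choose p i * sqrt_choose q j * sqrt_choose r k) else 0 else 0 else 0)"
  using assms by (simp add: tprod_apply[OF sbasis_in_tensor_power] rep_word sbasis_rep_word)

text \<open>Both sides are linear in \<open>t\<close>, so the unit vectors of \<open>V_d\<close>
  suffice; the triple products of unit vectors are then separated by evaluation at concatenated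
  representative words.\<close>

lemma recoupling_tensor_iff:
  assumes adm: "admissible p e d" "admissible q r e"
  shows "(\<forall>t\<in>Sym d. tmap p e id (iota q r e) (iota p e d t) =
        (\<Sum>f\<in>sixj_range p q r d. tscale (S f) (tmap f r (iota p q f) id (iota f r d t)))) \<longleftrightarrow>
    (\<forall>i\<le>p. \<forall>j\<le>q. \<forall>k\<le>r. \<forall>z\<le>d. (\<Sum>y\<le>e. of_real (cg q r e j k y) * of_real (cg p e d i y z))
      = (\<Sum>f\<in>sixj_range p q r d. S f * (\<Sum>y\<le>f. of_real (cg p q f i j y) * of_real (cg f r d y k z))))"
    (is "(\<forall>t\<in>Sym d. ?l t = ?r t) \<longleftrightarrow> (\<forall>i\<le>p. \<forall>j\<le>q. \<forall>k\<le>r. \<forall>z\<le>d. ?L i j k z = ?R i j k z)")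
proof -
  let ?b = "\<lambda>i j k. sbasis p i \<otimes>\<^sub>T sbasis q j \<otimes>\<^sub>T sbasis r k"
  have l: "?l (sbasis d z) v = (\<Sum>i\<le>p. \<Sum>j\<le>q. \<Sum>k\<le>r. ?L i j k z * ?b i j k v)" if "z \<le> d" for z v
    by (rule iota_iota_right[OF adm that])
  have r: "?r (sbasis d z) v = (\<Sum>i\<le>p. \<Sum>j\<le>q. \<Sum>k\<le>r. ?R i j k z * ?b i j k v)" if "z \<le> d" for z v
  proof -
    have "?r (sbasis d z) v = (\<Sum>f\<in>sixj_range p q r d. S f * (\<Sum>i\<le>p. \<Sum>j\<le>q. \<Sum>k\<le>r.
      (\<Sum>y\<le>f. of_real (cg p q f i j y) * of_real (cg f r d y k z)) * ?b i j k v))"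
      unfolding sum_fun_apply tscale_apply using that
      by (intro sum.cong refl) (simp add: sixj_range_def iota_iota_left)
    also have "\<dots> = (\<Sum>f\<in>sixj_range p q r d. \<Sum>i\<le>p. \<Sum>j\<le>q. \<Sum>k\<le>r. S f *
      (\<Sum>y\<le>f. of_real (cg p q f i j y) * of_real (cg f r d y k z)) * ?b i j k v)"
      by (simp only: sum_distrib_left[of "S _" _ "{..p}"] sum_distrib_left[of "S _" _ "{..q}"]
          sum_distrib_left[of "S _" _ "{..r}"] mult.assoc)
    also have "\<dots> = (\<Sum>i\<le>p. \<Sum>j\<le>q. \<Sum>f\<in>sixj_range p q r d. \<Sum>k\<le>r. S f *
      (\<Sum>y\<le>f. of_real (cg p q f i j y) * of_real (cg f r d y k z)) * ?b i j k v)"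
      by (rule sum_swap3)
    also have "\<dots> = (\<Sum>i\<le>p. \<Sum>j\<le>q. \<Sum>k\<le>r. \<Sum>f\<in>sixj_range p q r d. S f *
      (\<Sum>y\<le>f. of_real (cg p q f i j y) * of_real (cg f r d y k z)) * ?b i j k v)"
      by (rule sum.cong[OF refl], rule sum.cong[OF refl], rule sum.swap)
    finally show ?thesis by (simp only: sum_distrib_right)
  qed
  have ev: "(\<Sum>i'\<le>p. \<Sum>j'\<le>q. \<Sum>k'\<le>r. X i' j' k' * ?b i' j' k' (rep_word p i @ rep_word q j @ rep_word r k))
      = X i j k / of_real (sqrt_choose p i * sqrt_choose q j * sqrt_choose r k)"
    if "i \<le> p" "j \<le> q" "k \<le> r" for X :: "nat \<Rightarrow> nat \<Rightarrow> nat \<Rightarrow> complex" and i j k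
  proof -
    have "(\<Sum>i'\<le>p. \<Sum>j'\<le>q. \<Sum>k'\<le>r. X i' j' k' * ?b i' j' k' (rep_word p i @ rep_word q j @ rep_word r k))
      = (\<Sum>i'\<le>p. \<Sum>j'\<le>q. \<Sum>k'\<le>r. if k' = k then if j' = j then if i' = i then
           X i j k / of_real (sqrt_choose p i * sqrt_choose q j * sqrt_choose r k) else 0 else 0 else 0)"
      using that by (intro sum.cong refl) (auto simp: sbasis3_rep_word)
    then show ?thesis using that by simp
  qed
  have tl: "tlinear ?l"
    using tlinear_compose[OF tlinear_tmap tlinear_iota, of p e id "iota q r e" p e d] by (simp add: comp_def)
  have tr: "tlinear ?r"
  proof -
    have f: "tlinear (\<lambda>t. tmap f r (iota p q f) id (iota f r d t))" for f
      using tlinear_compose[OF tlinear_tmap tlinear_iota, of f r "iota p q f" id f r d] by (simp add: comp_def)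
    then show ?thesis
      unfolding tlinear_def by (auto simp: fun_eq_iff sum.distrib algebra_simps sum_distrib_left)
  qed
  show ?thesis
  proof
    assume eq: "\<forall>t\<in>Sym d. ?l t = ?r t"
    show "\<forall>i\<le>p. \<forall>j\<le>q. \<forall>k\<le>r. \<forall>z\<le>d. ?L i j k z = ?R i j k z"
    proof (intro allI impI)
      fix i j k z assume ijk: "i \<le> p" "j \<le> q" "k \<le> r" and z: "z \<le> d"
      have "?L i j k z / of_real (sqrt_choose p i * sqrt_choose q j * sqrt_choose r k) = ?R i j k z / of_real (sqrt_choose p i * sqrt_choose q j * sqrt_choose r k)"
        using fun_cong[OF bspec[OF eq sbasis_in_Sym[OF z]], of "rep_word p i @ rep_word q j @ rep_word r k"]
        unfolding l[OF z] r[OF z] ev[OF ijk] .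
      then show "?L i j k z = ?R i j k z"
        using ijk sqrt_choose_nonzero[of i p] sqrt_choose_nonzero[of j q] sqrt_choose_nonzero[of k r] by simp
    qed
  next
    assume eq: "\<forall>i\<le>p. \<forall>j\<le>q. \<forall>k\<le>r. \<forall>z\<le>d. ?L i j k z = ?R i j k z"
    have b: "?l (sbasis d z) = ?r (sbasis d z)" if z: "z \<le> d" for z
    proof
      fix v
      show "?l (sbasis d z) v = ?r (sbasis d z) v"
        unfolding l[OF z] r[OF z] using eq z by (intro sum.cong refl) auto
    qed
    show "\<forall>t\<in>Sym d. ?l t = ?r t"
    proof
      fix t assume "t \<in> Sym d"
      then obtain c where t: "t = (\<Sum>k\<le>d. tscale (c k) (sbasis d k))"
        unfolding Sym_eq by blast
      have "?l t = (\<Sum>k\<le>d. tscale (c k) (?l (sbasis d k)))"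
        unfolding t by (rule tlinear_sum[OF tl])
      also have "\<dots> = (\<Sum>k\<le>d. tscale (c k) (?r (sbasis d k)))"
        by (rule sum.cong[OF refl]) (simp only: b atMost_iff)
      also have "\<dots> = ?r t"
        unfolding t by (rule tlinear_sum[OF tr, symmetric])
      finally show "?l t = ?r t" .
    qed
  qed
qed

text \<open>Existence and uniqueness of the recoupling make the description that defines
  \<open>sixj\<close> proper, so that its defining property becomes available.\<close>

lemma sixj_recoupling:
  assumes adm: "admissible p e d" "admissible q r e" and "i \<le> p" "j \<le> q" "k \<le> r" "z \<le> d"
  shows "(\<Sum>y\<le>e. of_real (cg q r e j k y) * of_real (cg p e d i y z))
    = (\<Sum>f\<in>sixj_range p q r d. sixj p q r d e f *
        (\<Sum>y\<le>f. of_real (cg p q f i j y) * complex_of_real (cg f r d y k z)))"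
proof -
  let ?P = "\<lambda>S. (\<forall>f. f \<notin> sixj_range p q r d \<longrightarrow> S f = 0) \<and>
    (\<forall>i\<le>p. \<forall>j\<le>q. \<forall>k\<le>r. \<forall>z\<le>d. (\<Sum>y\<le>e. of_real (cg q r e j k y) * of_real (cg p e d i y z))
      = (\<Sum>f\<in>sixj_range p q r d. S f * (\<Sum>y\<le>f. of_real (cg p q f i j y) * complex_of_real (cg f r d y k z))))"
  obtain S where S: "\<forall>i\<le>p. \<forall>j\<le>q. \<forall>k\<le>r. \<forall>z\<le>d.
    (\<Sum>y\<le>e. of_real (cg q r e j k y) * of_real (cg p e d i y z))
    = (\<Sum>f\<in>sixj_range p q r d. S f *
        (\<Sum>y\<le>f. of_real (cg p q f i j y) * complex_of_real (cg f r d y k z)))"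
    using recoupling_exists[of p q r d e] by (elim exE)
  \<comment> \<open>Extension by zero outside the range, since uniqueness concerns the whole
    function.\<close>
  have ex: "?P (\<lambda>f. if f \<in> sixj_range p q r d then S f else 0)"
    using S by (simp cong: sum.cong)
  have uniq: "S1 = S2" if "?P S1" "?P S2" for S1 S2
  proof
    fix f
    show "S1 f = S2 f"
    proof (cases "f \<in> sixj_range p q r d")
      case True
      have "S1 f - S2 f = 0"
      proof (rule recoupling_unique[OF _ True, where D = "\<lambda>f. S1 f - S2 f"])
        fix i j k z assume *: "i \<le> p" "j \<le> q" "k \<le> r" "z \<le> d"
        have "(\<Sum>f\<in>sixj_range p q r d. S1 f * (\<Sum>y\<le>f. of_real (cg p q f i j y) * complex_of_real (cg f r d y k z)))
          = (\<Sum>f\<in>sixj_range p q r d. S2 f * (\<Sum>y\<le>f. of_real (cg p q f i j y) * complex_of_real (cg f r d y k z)))"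
          by (rule trans[OF conjunct2[OF that(1), rule_format, OF *, symmetric] conjunct2[OF that(2), rule_format, OF *]])
        then show "(\<Sum>f\<in>sixj_range p q r d. (S1 f - S2 f) * (\<Sum>y\<le>f. of_real (cg p q f i j y) * complex_of_real (cg f r d y k z))) = 0"
          by (simp only: left_diff_distrib sum_subtractf diff_self)
      qed
      then show ?thesis by simp
    qed (use that in simp)
  qed
  have P: "?P (THE S. ?P S)"
    by (rule theI[of ?P, OF ex]) (rule uniq[OF _ ex])
  have "sixj p q r d e = (THE S. ?P S)"
    unfolding sixj_def recoupling_tensor_iff[OF adm] ..
  from conjunct2[OF P[folded this], rule_format, OF assms(3-6)] show ?thesis .
qed

section \<open>The product formula\<close>

text \<open>
  The resolution of the identity of \<open>V\<^sub>a \<otimes> V\<^sub>b\<close> turned by a quarter: the two vertices are joined by an edge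
  \<open>V\<^sub>J\<close> that runs across the strands \<open>a\<close> and \<open>b\<close>. The signs of the two rotated vertices cancel.
\<close>

lemma cg_complete_bent:
  assumes "i \<le> a" "i' \<le> a" "j \<le> b" "j' \<le> b"
  shows "(\<Sum>J | admissible a b J. of_nat (Suc J) / theta a b J * (\<Sum>y\<le>J. cg a J b i y j * cg a J b i' y j'))
    = (if i = i' \<and> j = j' then 1 else 0)"
proof -
  have b: "cg a b J (a - i) j y * cg a b J (a - i') j' y = (- 1) ^ (i + i') * (cg a J b i y j * cg a J b i' y j')"
    for J y
    using cg_bend_left[of i a b J j y] cg_bend_left[of i' a b J j' y] assms
    by (simp add: minus_one_power_iff)
  have "(\<Sum>J | admissible a b J. of_nat (Suc J) / theta a b J *
      (\<Sum>y\<le>J. cg a b J (a - i) j y * cg a b J (a - i') j' y)) = (if i = i' \<and> j = j' then 1 else 0)"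
    using assms by (subst cg_complete) auto
  then have *: "(- 1) ^ (i + i') * (\<Sum>J | admissible a b J. of_nat (Suc J) / theta a b J *
      (\<Sum>y\<le>J. cg a J b i y j * cg a J b i' y j')) = (if i = i' \<and> j = j' then 1 else 0)"
    by (simp only: b sum_distrib_left mult_ac)
  show ?thesis
  proof (cases "i = i'")
    case True
    with * show ?thesis by simp
  next
    case False
    with * show ?thesis by simp
  qed
qed

text \<open>The sign left by the rotations in \<open>recouple_second\<close>. The first two summands
  come from exchanging legs at the vertices \<open>(a', b', c')\<close> and
  \<open>(b, b', l)\<close>. The rest has the parity of
  \<open>(a' + J - b) div 2 + (c' + J - l) div 2\<close>, the contribution of bending the leg
  \<open>J\<close>, written so that \<open>J\<close> no longer occurs.\<close>

definition ksign :: "nat \<Rightarrow> nat \<Rightarrow> nat \<Rightarrow> nat \<Rightarrow> nat \<Rightarrow> complex" where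
  "ksign a' b b' c' l = (- 1) ^ ((a' + b' - c') div 2 + (b + b' - l) div 2 + a' + l + (a' + b + c' + l) div 2)"

text \<open>The contracted edge \<open>a'\<close> is an output of both vertices, whereas the
  recoupling identity contracts an output of one vertex with the input of another. So the first
  vertex is rotated to make \<open>a'\<close> its input, the second is mirrored, and the recoupling
  is applied to \<open>b'\<close>, \<open>b\<close>, \<open>J\<close>. Mirroring and rotating the
  result makes \<open>J\<close> an input and \<open>c'\<close> an output, at the price of
  \<open>(- 1) ^ k'\<close>.\<close>

lemma recouple_second:
  assumes adm: "admissible a' b' c'" "admissible a' b J"
    and r: "y \<le> J" "j \<le> b" "j' \<le> b'" "k' \<le> c'"
  shows "(\<Sum>i\<le>a'. of_real (cg a' J b i y j) * complex_of_real (cg a' b' c' i j' k'))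
    = (\<Sum>l\<in>sixj_range b' b J c'. sixj b' b J c' a' l * (ksign a' b b' c' l * (- 1) ^ k') *
        (\<Sum>w\<le>l. of_real (cg b b' l j j' w) * of_real (cg l c' J w (c' - k') y)))"
proof -
  have adm2: "admissible b' a' c'" "admissible b J a'"
    using adm by (auto simp: admissible_iff)
  have l: "(\<Sum>i\<le>a'. of_real (cg a' J b i y j) * complex_of_real (cg a' b' c' i j' k'))
    = (- 1) ^ ((a' + b' - c') div 2 + (y + (a' + J - b) div 2)) *
      (\<Sum>i\<le>a'. of_real (cg b J a' j (J - y) i) * complex_of_real (cg b' a' c' j' i k'))"
  proof -
    have "of_real (cg a' J b i y j) * complex_of_real (cg a' b' c' i j' k')
      = (- 1) ^ ((a' + b' - c') div 2 + (y + (a' + J - b) div 2)) *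
        (of_real (cg b J a' j (J - y) i) * complex_of_real (cg b' a' c' j' i k'))" for i
      unfolding cg_bend_right[OF r(1), of b a' j i] cg_swap[of b' a' c' j' i k']
      by (simp add: power_add mult_ac flip: power_mult_distrib)
    then show ?thesis by (simp only: sum_distrib_left)
  qed
  have s: "(- 1) ^ ((a' + b' - c') div 2 + (y + (a' + J - b) div 2)) *
      (of_real (cg b' b l j' j w) * complex_of_real (cg l J c' w (J - y) k'))
    = ksign a' b b' c' l * (- 1) ^ k' * (of_real (cg b b' l j j' w) * of_real (cg l c' J w (c' - k') y))"
    if lr: "l \<in> sixj_range b' b J c'" for l w
  proof -
    have e1: "cg b' b l j' j w = (- 1) ^ ((b + b' - l) div 2) * cg b b' l j j' w"
      by (rule cg_swap)
    have e2: "cg l J c' w (J - y) k' = (- 1) ^ (y + (c' + J - l) div 2) * cg c' J l k' y w"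
      by (rule cg_bend_right[OF r(1)])
    have e3: "cg l c' J w (c' - k') y = (- 1) ^ k' * cg c' J l k' y w"
      using cg_swap[of l c' J w "c' - k'" y] cg_bend_left[OF r(4), of l J w y]
      by (simp add: power_add mult_ac flip: power_mult_distrib)
    \<comment> \<open>These are the only signs involving \<open>J\<close>: replacing
      \<open>(a' + b + c' + l) div 2\<close> by \<open>u + v + b + l - J\<close> leaves
      \<open>2 * l\<close> and \<open>a' + b + J\<close> beside \<open>u + v\<close>, and both are
      even.\<close>
    have par: "even ((a' + J - b) div 2 + (c' + J - l) div 2) = even (a' + l + (a' + b + c' + l) div 2)"
    proof -
      have "admissible l J c'" using lr by (simp add: sixj_range_def)
      then obtain v where v: "2 * v + l = c' + J"
        unfolding admissible_def by (metis add.commute)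
      obtain u where u: "2 * u + b = a' + J"
        using adm(2) unfolding admissible_def by blast
      have h: "(a' + J - b) div 2 = u" "(c' + J - l) div 2 = v"
        using u v by auto
      obtain t where t: "a' + b + J = 2 * t" using adm(2) by (auto simp: admissible_iff dvd_def)
      have "a' + b + c' + l = 2 * (u + v + b + l - J)" "J \<le> u + v + b + l"
        using u v t by auto
      then have "(a' + b + c' + l) div 2 = u + v + b + l - J" by simp
      with \<open>J \<le> u + v + b + l\<close> have "even (a' + l + (a' + b + c' + l) div 2) = even (a' + l + (u + v + b + l) + J)"
        by (metis add.assoc even_add even_diff_nat le_add_diff_inverse2)
      also have "a' + l + (u + v + b + l) + J = u + v + 2 * (l + t)"
        using t by simp
      finally show ?thesis by (simp add: h)
    qed
    have "(- 1 :: complex) ^ ((a' + b' - c') div 2 + (y + (a' + J - b) div 2)) * (- 1) ^ ((b + b' - l) div 2) *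
        (- 1) ^ (y + (c' + J - l) div 2) = ksign a' b b' c' l"
    proof -
      have "(- 1 :: complex) ^ (A + (y + u)) * (- 1) ^ B * (- 1) ^ (y + v) = (- 1) ^ (A + B) * (- 1) ^ (u + v)" for A B u v
        by (simp add: minus_one_power_iff)
      moreover have "(- 1 :: complex) ^ ((a' + J - b) div 2 + (c' + J - l) div 2) = (- 1) ^ (a' + l + (a' + b + c' + l) div 2)"
        by (simp only: minus_one_power_iff par)
      ultimately show ?thesis
        by (simp only: ksign_def power_add mult.assoc)
    qed
    note sg = this
    have "(- 1) ^ ((a' + b' - c') div 2 + (y + (a' + J - b) div 2)) *
        (of_real (cg b' b l j' j w) * complex_of_real (cg l J c' w (J - y) k'))
      = (- 1) ^ ((a' + b' - c') div 2 + (y + (a' + J - b) div 2)) * (- 1) ^ ((b + b' - l) div 2) *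
        (- 1) ^ (y + (c' + J - l) div 2) * (of_real (cg b b' l j j' w) * of_real (cg c' J l k' y w))"
      unfolding e1 e2 by (simp only: of_real_mult of_real_power of_real_minus of_real_1 mult_ac)
    also have "\<dots> = ksign a' b b' c' l * (of_real (cg b b' l j j' w) * of_real (cg c' J l k' y w))"
      by (simp only: sg)
    also have "\<dots> = ksign a' b b' c' l * (- 1) ^ k' * (of_real (cg b b' l j j' w) * of_real (cg l c' J w (c' - k') y))"
      unfolding e3 by (simp add: minus_one_power_iff)
    finally show ?thesis .
  qed
  show ?thesis
    unfolding l sixj_recoupling[OF adm2 r(3,2) diff_le_self r(4)] sum_distrib_left
    using s by (intro sum.cong refl) (simp add: mult_ac)
qed

section \<open>Expansion of the product of two vertices\<close>

lemma sum_bilinear_contract: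
  fixes s1 :: "'k \<Rightarrow> 'c::comm_semiring_0"
  shows "(\<Sum>y\<in>Y. (\<Sum>k\<in>K. s1 k * (\<Sum>x\<in>X k. A k x * B k x y)) * (\<Sum>l\<in>L. s2 l * (\<Sum>w\<in>W l. C l w * D l w y)))
    = (\<Sum>k\<in>K. \<Sum>l\<in>L. s1 k * s2 l * (\<Sum>x\<in>X k. \<Sum>w\<in>W l. A k x * C l w * (\<Sum>y\<in>Y. D l w y * B k x y)))"
proof -
  have "(\<Sum>y\<in>Y. (\<Sum>k\<in>K. s1 k * (\<Sum>x\<in>X k. A k x * B k x y)) * (\<Sum>l\<in>L. s2 l * (\<Sum>w\<in>W l. C l w * D l w y)))
    = (\<Sum>y\<in>Y. \<Sum>k\<in>K. \<Sum>l\<in>L. s1 k * s2 l * (\<Sum>x\<in>X k. \<Sum>w\<in>W l. A k x * C l w * (D l w y * B k x y)))"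
  proof (rule sum.cong[OF refl])
    fix y
    have "(\<Sum>k\<in>K. s1 k * (\<Sum>x\<in>X k. A k x * B k x y)) * (\<Sum>l\<in>L. s2 l * (\<Sum>w\<in>W l. C l w * D l w y))
      = (\<Sum>k\<in>K. \<Sum>l\<in>L. s1 k * s2 l * ((\<Sum>x\<in>X k. A k x * B k x y) * (\<Sum>w\<in>W l. C l w * D l w y)))"
      unfolding sum_product[of _ K _ L] by (simp only: mult_ac)
    also have "\<dots> = (\<Sum>k\<in>K. \<Sum>l\<in>L. s1 k * s2 l * (\<Sum>x\<in>X k. \<Sum>w\<in>W l. A k x * C l w * (D l w y * B k x y)))"
      by (intro sum.cong refl arg_cong[of _ _ "(*) _"]) (simp only: sum_product, simp only: mult_ac)
    finally show "(\<Sum>k\<in>K. s1 k * (\<Sum>x\<in>X k. A k x * B k x y)) * (\<Sum>l\<in>L. s2 l * (\<Sum>w\<in>W l. C l w * D l w y))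
      = (\<Sum>k\<in>K. \<Sum>l\<in>L. s1 k * s2 l * (\<Sum>x\<in>X k. \<Sum>w\<in>W l. A k x * C l w * (D l w y * B k x y)))" .
  qed
  also have "\<dots> = (\<Sum>k\<in>K. \<Sum>l\<in>L. \<Sum>y\<in>Y. s1 k * s2 l * (\<Sum>x\<in>X k. \<Sum>w\<in>W l. A k x * C l w * (D l w y * B k x y)))"
    by (rule sum_swap3)
  also have "\<dots> = (\<Sum>k\<in>K. \<Sum>l\<in>L. s1 k * s2 l * (\<Sum>x\<in>X k. \<Sum>w\<in>W l. A k x * C l w * (\<Sum>y\<in>Y. D l w y * B k x y)))"
  proof (rule sum.cong[OF refl], rule sum.cong[OF refl])
    fix k l
    have "(\<Sum>y\<in>Y. \<Sum>x\<in>X k. \<Sum>w\<in>W l. A k x * C l w * (D l w y * B k x y))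
      = (\<Sum>x\<in>X k. \<Sum>w\<in>W l. A k x * C l w * (\<Sum>y\<in>Y. D l w y * B k x y))"
      unfolding sum_distrib_left by (rule sum_swap3)
    then show "(\<Sum>y\<in>Y. s1 k * s2 l * (\<Sum>x\<in>X k. \<Sum>w\<in>W l. A k x * C l w * (D l w y * B k x y)))
      = s1 k * s2 l * (\<Sum>x\<in>X k. \<Sum>w\<in>W l. A k x * C l w * (\<Sum>y\<in>Y. D l w y * B k x y))"
      by (simp only: sum_distrib_left[of "s1 k * s2 l" _ Y, symmetric])
  qed
  finally show ?thesis .
qed

lemma sum_product_swap:
  fixes w :: "'c::comm_semiring_0"
  shows "(\<Sum>i\<in>I. \<Sum>j\<in>J. w * (f j * g i)) = w * ((\<Sum>j\<in>J. f j) * (\<Sum>i\<in>I. g i))"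
proof -
  have "(\<Sum>i\<in>I. \<Sum>j\<in>J. w * (f j * g i)) = w * (\<Sum>i\<in>I. \<Sum>j\<in>J. f j * g i)"
    by (simp only: sum_distrib_left)
  also have "\<dots> = w * ((\<Sum>j\<in>J. f j) * (\<Sum>i\<in>I. g i))"
    by (subst sum.swap) (simp only: sum_product)
  finally show ?thesis .
qed

text \<open>The matrix of a composite through \<open>V_m\<close>: three of the factors are read as
  splittings, while \<open>cg c c' m\<close> is read as the transposed vertex, which fuses
  \<open>V_c\<close> and \<open>V_c'\<close>.\<close>

definition coupled :: "nat \<Rightarrow> nat \<Rightarrow> nat \<Rightarrow> nat \<Rightarrow> nat \<Rightarrow> nat \<Rightarrow> nat \<Rightarrow> nat \<Rightarrow> nat \<Rightarrow>
    nat \<times> nat \<Rightarrow> nat \<times> nat \<Rightarrow> nat \<times> nat \<Rightarrow> complex" where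
  "coupled a a' b b' c c' k l m = (\<lambda>(i, i') (j, j') (z, z'). \<Sum>(x, w, n)\<in>{..k} \<times> {..l} \<times> {..m}.
     of_real (cg a a' k i i' x) * of_real (cg b b' l j j' w) * of_real (cg k l m x w n) * of_real (cg c c' m z z' n))"

text \<open>One half of \<open>prod_index\<close>: two elements that agree in
  \<open>(k, l, m)\<close> make up one index of the final sum.\<close>

definition coupling_index :: "nat \<Rightarrow> nat \<Rightarrow> nat \<Rightarrow> nat \<Rightarrow> nat \<Rightarrow> nat \<Rightarrow> (nat \<times> nat \<times> nat \<times> nat) set" where
  "coupling_index a b c a' b' c' = {(J, k, l, m). admissible a' b J \<and> k \<in> sixj_range a a' J c \<and>
     l \<in> sixj_range b' b J c' \<and> m \<in> sixj_range k l c' c}"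

lemma coupling_index_Sigma: "coupling_index a b c a' b' c' = (SIGMA J:{J. admissible a' b J}.
    SIGMA k:sixj_range a a' J c. SIGMA l:sixj_range b' b J c'. sixj_range k l c' c)"
  by (auto simp: coupling_index_def)

lemma finite_coupling_index: "finite (coupling_index a b c a' b' c')"
  unfolding coupling_index_Sigma by (intro finite_SigmaI finite_admissible finite_sixj_range)

text \<open>
  The total sign produced by the rotations. It does not depend on \<open>J\<close>, so it cancels in the product formula, where
  each \<open>(k, l, m)\<close> contributes quadratically.
\<close>

definition csign :: "nat \<Rightarrow> nat \<Rightarrow> nat \<Rightarrow> nat \<Rightarrow> nat \<Rightarrow> nat \<Rightarrow> nat \<Rightarrow> complex" where
  "csign a' b b' c c' l m = ksign a' b b' c' l * (- 1) ^ ((c + c' - m) div 2)"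

lemma csign_square: "csign a' b b' c c' l m * csign a' b b' c c' l m = 1"
  by (simp add: csign_def ksign_def minus_one_power_iff)

text \<open>Once \<open>J\<close> is inserted, the first factor recouples \<open>(a, a', J)\<close>
  under \<open>c\<close> and creates \<open>k\<close>, and the second recouples
  \<open>(b', b, J)\<close> under \<open>c'\<close> and creates \<open>l\<close>. The contraction
  over \<open>V_J\<close> then recouples \<open>(k, l, c')\<close> under \<open>c\<close> and
  creates \<open>m\<close>. The 6j-symbols of \<open>prod_coeff\<close> arise in this order.\<close>

lemma product_expand:
  assumes adm: "admissible a b c" "admissible a' b' c'"
    and r: "i \<le> a" "i' \<le> a'" "j \<le> b" "j' \<le> b'" "z \<le> c" "z' \<le> c'"
  shows "of_real (cg a b c i j z) * of_real (cg a' b' c' i' j' z')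
    = (\<Sum>(J, k, l, m)\<in>coupling_index a b c a' b' c'.
        prod_coeff a b c a' b' c' J k l m * csign a' b b' c c' l m * coupled a a' b b' c c' k l m (i, i') (j, j') (z, z'))"
proof -
  let ?w = "\<lambda>J. complex_of_real (of_nat (Suc J) / theta a' b J)"
  let ?T = "\<lambda>a b c i j k. complex_of_real (cg a b c i j k)"
  have "?T a b c i j z * ?T a' b' c' i' j' z'
    = (\<Sum>i1\<le>a'. \<Sum>j1\<le>b. (if i' = i1 \<and> j = j1 then 1 else 0) * (?T a b c i j1 z * ?T a' b' c' i1 j' z'))"
    using r by (simp add: sum_delta2)
  \<comment> \<open>The Kronecker deltas on the strands \<open>a'\<close> and \<open>b\<close> are
    replaced by the bent resolution of the identity.\<close>
  also have "\<dots> = (\<Sum>i1\<le>a'. \<Sum>j1\<le>b. \<Sum>J | admissible a' b J. \<Sum>y\<le>J.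
      ?w J * ((?T a' J b i' y j1 * ?T a b c i j1 z) * (?T a' J b i1 y j * ?T a' b' c' i1 j' z')))"
  proof (intro sum.cong refl)
    fix i1 j1 assume "i1 \<in> {..a'}" "j1 \<in> {..b}"
    then have "(if i' = i1 \<and> j = j1 then 1 else 0 :: complex) = of_real (\<Sum>J | admissible a' b J.
        of_nat (Suc J) / theta a' b J * (\<Sum>y\<le>J. cg a' J b i' y j1 * cg a' J b i1 y j))"
      using r by (subst cg_complete_bent) auto
    then show "(if i' = i1 \<and> j = j1 then 1 else 0) * (?T a b c i j1 z * ?T a' b' c' i1 j' z')
      = (\<Sum>J | admissible a' b J. \<Sum>y\<le>J.
      ?w J * ((?T a' J b i' y j1 * ?T a b c i j1 z) * (?T a' J b i1 y j * ?T a' b' c' i1 j' z')))"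
      by (simp only: of_real_sum of_real_mult sum_distrib_left sum_distrib_right mult_ac)
  qed
  also have "\<dots> = (\<Sum>J | admissible a' b J. \<Sum>i1\<le>a'. \<Sum>j1\<le>b. \<Sum>y\<le>J.
      ?w J * ((?T a' J b i' y j1 * ?T a b c i j1 z) * (?T a' J b i1 y j * ?T a' b' c' i1 j' z')))"
    by (rule sum_swap3[symmetric])
  also have "\<dots> = (\<Sum>J | admissible a' b J. \<Sum>y\<le>J. \<Sum>i1\<le>a'. \<Sum>j1\<le>b.
      ?w J * ((?T a' J b i' y j1 * ?T a b c i j1 z) * (?T a' J b i1 y j * ?T a' b' c' i1 j' z')))"
    by (rule sum.cong[OF refl], rule sum_swap3[symmetric])
  also have "\<dots> = (\<Sum>J | admissible a' b J. ?w J * (\<Sum>y\<le>J.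
      (\<Sum>j1\<le>b. ?T a' J b i' y j1 * ?T a b c i j1 z) * (\<Sum>i1\<le>a'. ?T a' J b i1 y j * ?T a' b' c' i1 j' z')))"
    by (simp only: sum_product_swap sum_distrib_left[of "?w _" _ "{.._}"])
  also have "\<dots> = (\<Sum>J | admissible a' b J. \<Sum>k\<in>sixj_range a a' J c. \<Sum>l\<in>sixj_range b' b J c'.
      \<Sum>m\<in>sixj_range k l c' c. prod_coeff a b c a' b' c' J k l m * csign a' b b' c c' l m *
        coupled a a' b b' c c' k l m (i, i') (j, j') (z, z'))"
  proof (intro sum.cong refl)
    fix J assume "J \<in> {J. admissible a' b J}"
    then have J: "admissible a' b J" by simp
    then have J': "admissible a' J b" by (auto simp: admissible_iff)
    have "(\<Sum>y\<le>J. (\<Sum>j1\<le>b. ?T a' J b i' y j1 * ?T a b c i j1 z) * (\<Sum>i1\<le>a'. ?T a' J b i1 y j * ?T a' b' c' i1 j' z'))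
      = (\<Sum>y\<le>J. (\<Sum>k\<in>sixj_range a a' J c. sixj a a' J c b k * (\<Sum>x\<le>k. ?T a a' k i i' x * ?T k J c x y z)) *
          (\<Sum>l\<in>sixj_range b' b J c'. sixj b' b J c' a' l * (ksign a' b b' c' l * (- 1) ^ z') *
            (\<Sum>w\<le>l. ?T b b' l j j' w * ?T l c' J w (c' - z') y)))"
      using r by (intro sum.cong refl arg_cong2[of _ _ _ _ "(*)"] sixj_recoupling[OF adm(1) J'] recouple_second[OF adm(2) J]) auto
    also have "\<dots> = (\<Sum>k\<in>sixj_range a a' J c. \<Sum>l\<in>sixj_range b' b J c'.
        sixj a a' J c b k * (sixj b' b J c' a' l * (ksign a' b b' c' l * (- 1) ^ z')) *
        (\<Sum>x\<le>k. \<Sum>w\<le>l. ?T a a' k i i' x * ?T b b' l j j' w * (\<Sum>y\<le>J. ?T l c' J w (c' - z') y * ?T k J c x y z)))"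
      by (rule sum_bilinear_contract)
    finally have main: "(\<Sum>y\<le>J. (\<Sum>j1\<le>b. ?T a' J b i' y j1 * ?T a b c i j1 z) * (\<Sum>i1\<le>a'. ?T a' J b i1 y j * ?T a' b' c' i1 j' z'))
      = (\<Sum>k\<in>sixj_range a a' J c. \<Sum>l\<in>sixj_range b' b J c'.
        sixj a a' J c b k * (sixj b' b J c' a' l * (ksign a' b b' c' l * (- 1) ^ z')) *
        (\<Sum>x\<le>k. \<Sum>w\<le>l. ?T a a' k i i' x * ?T b b' l j j' w * (\<Sum>y\<le>J. ?T l c' J w (c' - z') y * ?T k J c x y z)))" .
    \<comment> \<open>The weight in the resolution of the identity is the first factor of
      \<open>prod_coeff\<close>.\<close>
    have W: "?w J = \<Delta> J / \<Theta> a' b J"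
      by (simp add: \<Delta>_def Theta_eq[OF J])
    show "?w J * (\<Sum>y\<le>J.
      (\<Sum>j1\<le>b. ?T a' J b i' y j1 * ?T a b c i j1 z) * (\<Sum>i1\<le>a'. ?T a' J b i1 y j * ?T a' b' c' i1 j' z'))
      = (\<Sum>k\<in>sixj_range a a' J c. \<Sum>l\<in>sixj_range b' b J c'.
      \<Sum>m\<in>sixj_range k l c' c. prod_coeff a b c a' b' c' J k l m * csign a' b b' c c' l m *
        coupled a a' b b' c c' k l m (i, i') (j, j') (z, z'))"
      unfolding main sum_distrib_left[of "?w J"]
    proof (rule sum.cong[OF refl], rule sum.cong[OF refl])
      fix k l assume k: "k \<in> sixj_range a a' J c" and l: "l \<in> sixj_range b' b J c'"
      have adm': "admissible k J c" "admissible l c' J"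
        using k l by (auto simp: sixj_range_def admissible_iff)
      let ?s = "sixj a a' J c b k * (sixj b' b J c' a' l * ksign a' b b' c' l)"
      have "(- 1) ^ z' * (\<Sum>x\<le>k. \<Sum>w\<le>l. ?T a a' k i i' x * ?T b b' l j j' w *
            (\<Sum>y\<le>J. ?T l c' J w (c' - z') y * ?T k J c x y z))
        = (\<Sum>x\<le>k. \<Sum>w\<le>l. \<Sum>m\<in>sixj_range k l c' c. sixj k l c' c J m * (- 1) ^ ((c + c' - m) div 2) *
            (\<Sum>n\<le>m. ?T a a' k i i' x * ?T b b' l j j' w * ?T k l m x w n * ?T c c' m z z' n))"
        unfolding sum_distrib_left[of _ _ "{..k}"] sum_distrib_left[of _ _ "{..l}"]
      proof (intro sum.cong refl)
        fix x w assume xw: "x \<in> {..k}" "w \<in> {..l}"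
        \<comment> \<open>Turning the leg \<open>c'\<close> back produces a second
          \<open>(- 1) ^ z'\<close>, which cancels the one left by \<open>recouple_second\<close>;
          the factor independent of \<open>z'\<close> enters \<open>csign\<close>.\<close>
        have bend: "?T m c' c n (c' - z') z = (- 1) ^ z' * (- 1) ^ ((c + c' - m) div 2) * ?T c c' m z z' n" for m n
          by (simp add: cg_bend_right[OF r(6)] power_add)
        have "(\<Sum>y\<le>J. ?T l c' J w (c' - z') y * ?T k J c x y z)
          = (\<Sum>m\<in>sixj_range k l c' c. sixj k l c' c J m * (\<Sum>n\<le>m. ?T k l m x w n * ?T m c' c n (c' - z') z))"
          using xw r by (intro sixj_recoupling[OF adm']) auto
        also have "\<dots> = (- 1) ^ z' * (\<Sum>m\<in>sixj_range k l c' c. sixj k l c' c J m * (- 1) ^ ((c + c' - m) div 2) *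
            (\<Sum>n\<le>m. ?T k l m x w n * ?T c c' m z z' n))"
          unfolding sum_distrib_left by (simp only: bend mult_ac)
        finally have "(- 1) ^ z' * (\<Sum>y\<le>J. ?T l c' J w (c' - z') y * ?T k J c x y z)
          = (\<Sum>m\<in>sixj_range k l c' c. sixj k l c' c J m * (- 1) ^ ((c + c' - m) div 2) *
            (\<Sum>n\<le>m. ?T k l m x w n * ?T c c' m z z' n))"
          by (simp add: minus_one_power_iff)
        then have "(- 1) ^ z' * (?T a a' k i i' x * ?T b b' l j j' w * (\<Sum>y\<le>J. ?T l c' J w (c' - z') y * ?T k J c x y z))
          = ?T a a' k i i' x * ?T b b' l j j' w * (\<Sum>m\<in>sixj_range k l c' c. sixj k l c' c J m * (- 1) ^ ((c + c' - m) div 2) *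
            (\<Sum>n\<le>m. ?T k l m x w n * ?T c c' m z z' n))"
          by (simp only: mult.left_commute[of "(- 1) ^ z'"])
        then show "(- 1) ^ z' * (?T a a' k i i' x * ?T b b' l j j' w * (\<Sum>y\<le>J. ?T l c' J w (c' - z') y * ?T k J c x y z))
          = (\<Sum>m\<in>sixj_range k l c' c. sixj k l c' c J m * (- 1) ^ ((c + c' - m) div 2) *
            (\<Sum>n\<le>m. ?T a a' k i i' x * ?T b b' l j j' w * ?T k l m x w n * ?T c c' m z z' n))"
          by (simp only: sum_distrib_left mult_ac)
      qed
      also have "\<dots> = (\<Sum>m\<in>sixj_range k l c' c. sixj k l c' c J m * (- 1) ^ ((c + c' - m) div 2) *
          coupled a a' b b' c c' k l m (i, i') (j, j') (z, z'))"
        by (simp only: coupled_def prod.case sum.cartesian_product[symmetric] sum_distrib_left)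
           (rule sum_swap3[symmetric])
      finally have fin: "(- 1) ^ z' * (\<Sum>x\<le>k. \<Sum>w\<le>l. ?T a a' k i i' x * ?T b b' l j j' w *
            (\<Sum>y\<le>J. ?T l c' J w (c' - z') y * ?T k J c x y z))
        = (\<Sum>m\<in>sixj_range k l c' c. sixj k l c' c J m * (- 1) ^ ((c + c' - m) div 2) *
          coupled a a' b b' c c' k l m (i, i') (j, j') (z, z'))" .
      have "?w J * (sixj a a' J c b k * (sixj b' b J c' a' l * (ksign a' b b' c' l * (- 1) ^ z')) *
        (\<Sum>x\<le>k. \<Sum>w\<le>l. ?T a a' k i i' x * ?T b b' l j j' w * (\<Sum>y\<le>J. ?T l c' J w (c' - z') y * ?T k J c x y z)))
        = ?w J * ?s * ((- 1) ^ z' * (\<Sum>x\<le>k. \<Sum>w\<le>l. ?T a a' k i i' x * ?T b b' l j j' w *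
            (\<Sum>y\<le>J. ?T l c' J w (c' - z') y * ?T k J c x y z)))"
        by (simp only: mult_ac)
      also have "\<dots> = (\<Sum>m\<in>sixj_range k l c' c. prod_coeff a b c a' b' c' J k l m * csign a' b b' c c' l m *
        coupled a a' b b' c c' k l m (i, i') (j, j') (z, z'))"
        unfolding fin unfolding W sum_distrib_left prod_coeff_def csign_def by (simp only: mult_ac)
      finally show "?w J * (sixj a a' J c b k * (sixj b' b J c' a' l * (ksign a' b b' c' l * (- 1) ^ z')) *
        (\<Sum>x\<le>k. \<Sum>w\<le>l. ?T a a' k i i' x * ?T b b' l j j' w * (\<Sum>y\<le>J. ?T l c' J w (c' - z') y * ?T k J c x y z)))
        = (\<Sum>m\<in>sixj_range k l c' c. prod_coeff a b c a' b' c' J k l m * csign a' b b' c c' l m *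
        coupled a a' b b' c c' k l m (i, i') (j, j') (z, z'))" .
    qed
  qed
  also have "\<dots> = (\<Sum>(J, k, l, m)\<in>coupling_index a b c a' b' c'.
        prod_coeff a b c a' b' c' J k l m * csign a' b b' c c' l m * coupled a a' b b' c c' k l m (i, i') (j, j') (z, z'))"
    unfolding coupling_index_Sigma
    by (simp add: sum.Sigma finite_admissible finite_sixj_range split_def)
  finally show ?thesis .
qed

section \<open>The product of central functions as a quadratic form\<close>

lemma quadratic_expand:
  fixes P :: "'z \<Rightarrow> 'a \<Rightarrow> 'c::comm_semiring_0"
  shows "(\<Sum>z\<in>Z. (\<Sum>s\<in>S. P z s) * r z * (\<Sum>t\<in>T. Q z t)) = (\<Sum>s\<in>S. \<Sum>t\<in>T. \<Sum>z\<in>Z. P z s * r z * Q z t)"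
proof -
  have "(\<Sum>s\<in>S. P z s) * r z * (\<Sum>t\<in>T. Q z t) = (\<Sum>s\<in>S. \<Sum>t\<in>T. P z s * r z * Q z t)" for z
    by (simp only: sum_distrib_right[of "P z" S "r z"] sum_product)
  then show ?thesis
    by (simp only: sum_swap3[of _ T S Z])
qed

lemma sum_factor3:
  fixes f :: "'u \<Rightarrow> 'c::comm_semiring_0"
  shows "(\<Sum>(u, v, g)\<in>U \<times> V \<times> G. f u * h v * d g) = (\<Sum>u\<in>U. f u) * (\<Sum>v\<in>V. h v) * (\<Sum>g\<in>G. d g)"
  by (simp only: sum_product3 sum.cartesian_product[symmetric])

text \<open>The group elements pass through the vertex \<open>(a, a', k)\<close> by equivariance and
  act on \<open>V_k\<close> instead; the two vertices that now face each other form a bubble, which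
  orthogonality removes.\<close>

lemma couple_group:
  assumes x: "det x = 1" and r: "n' \<le> k'" "n \<le> k"
  shows "(\<Sum>((p, p'), (i, i'))\<in>({..a} \<times> {..a'}) \<times> ({..a} \<times> {..a'}).
      of_real (cg a a' k' p p' n') * (rho a x p i * rho a' x p' i') * of_real (cg a a' k i i' n))
    = (if k = k' then of_real (theta a a' k / of_nat (Suc k)) * rho k x n' n else 0)"
proof -
  have "(\<Sum>((p, p'), (i, i'))\<in>({..a} \<times> {..a'}) \<times> ({..a} \<times> {..a'}).
      of_real (cg a a' k' p p' n') * (rho a x p i * rho a' x p' i') * of_real (cg a a' k i i' n))
    = (\<Sum>p\<le>a. \<Sum>p'\<le>a'. of_real (cg a a' k' p p' n') *
       (\<Sum>i\<le>a. \<Sum>i'\<le>a'. rho a x p i * rho a' x p' i' * of_real (cg a a' k i i' n)))"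
    by (simp only: sum.cartesian_product' prod.case sum_distrib_left mult.assoc)
  also have "\<dots> = (\<Sum>p\<le>a. \<Sum>p'\<le>a'. of_real (cg a a' k' p p' n') *
       (\<Sum>y\<le>k. of_real (cg a a' k p p' y) * rho k x y n))"
    using r by (intro sum.cong refl) (simp add: cg_equivariant[OF x])
  also have "\<dots> = (\<Sum>p\<le>a. \<Sum>p'\<le>a'. \<Sum>y\<le>k. of_real (cg a a' k' p p' n') * of_real (cg a a' k p p' y) * rho k x y n)"
    by (simp only: sum_distrib_left mult.assoc)
  also have "\<dots> = (\<Sum>y\<le>k. of_real (\<Sum>p\<le>a. \<Sum>p'\<le>a'. cg a a' k' p p' n' * cg a a' k p p' y) * rho k x y n)"
    by (simp only: of_real_sum of_real_mult sum_distrib_right, rule sum_swap3[symmetric])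
  also have "\<dots> = (\<Sum>y\<le>k. if y = n' then (if k = k' then of_real (theta a a' k / of_nat (Suc k)) * rho k x n' n else 0) else 0)"
    using r by (intro sum.cong refl) (simp add: cg_orthogonal del: of_nat_Suc)
  also have "\<dots> = (if k = k' then of_real (theta a a' k / of_nat (Suc k)) * rho k x n' n else 0)"
    using r by simp
  finally show ?thesis .
qed

lemma couple_trivial:
  assumes r: "n' \<le> m'" "n \<le> m"
  shows "(\<Sum>(z, z')\<in>{..c} \<times> {..c'}. of_real (cg c c' m' z z' n') * complex_of_real (cg c c' m z z' n))
    = (if m = m' then if n = n' then of_real (theta c c' m / of_nat (Suc m)) else 0 else 0)"
proof -
  have "(\<Sum>(z, z')\<in>{..c} \<times> {..c'}. of_real (cg c c' m' z z' n') * complex_of_real (cg c c' m z z' n))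
    = complex_of_real (\<Sum>z\<le>c. \<Sum>z'\<le>c'. cg c c' m' z z' n' * cg c c' m z z' n)"
    by (simp only: sum.cartesian_product' prod.case of_real_sum of_real_mult)
  then show ?thesis
    using r by (auto simp: cg_orthogonal)
qed

text \<open>The index of \<open>V_m\<close> is doubled, with a Kronecker delta, to match the shape
  in which \<open>couple_trivial\<close> leaves the pairing.\<close>

lemma central_function_eq_tuple:
  assumes "admissible k l m"
  shows "central_function k l m x y = (\<Sum>(x', w', n')\<in>{..k} \<times> {..l} \<times> {..m}. \<Sum>(x1, w, n)\<in>{..k} \<times> {..l} \<times> {..m}.
    if n = n' then of_real (cg k l m x' w' n') * of_real (cg k l m x1 w n) * (rho k x x' x1 * rho l y w' w) else 0)"
proof -
  let ?f = "\<lambda>n i j p q. of_real (cg k l m p q n) * of_real (cg k l m i j n) * (rho k x p i * rho l y q j)"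
  have "central_function k l m x y = (\<Sum>n\<le>m. \<Sum>i\<le>k. \<Sum>j\<le>l. \<Sum>p\<le>k. \<Sum>q\<le>l. ?f n i j p q)"
    unfolding central_function_eq[OF assms] by (intro sum.cong refl) (simp only: mult_ac)
  also have "\<dots> = (\<Sum>n\<le>m. \<Sum>p\<le>k. \<Sum>q\<le>l. \<Sum>i\<le>k. \<Sum>j\<le>l. ?f n i j p q)"
    by (rule sum.cong[OF refl], rule sum_swap4)
  also have "\<dots> = (\<Sum>p\<le>k. \<Sum>q\<le>l. \<Sum>n\<le>m. \<Sum>i\<le>k. \<Sum>j\<le>l. ?f n i j p q)"
    by (rule sum_swap3)
  also have "\<dots> = (\<Sum>p\<le>k. \<Sum>q\<le>l. \<Sum>n'\<le>m. \<Sum>i\<le>k. \<Sum>j\<le>l. \<Sum>n\<le>m.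
    if n = n' then of_real (cg k l m p q n') * of_real (cg k l m i j n) * (rho k x p i * rho l y q j) else 0)"
    by (intro sum.cong refl) simp
  finally show ?thesis
    by (simp only: sum.cartesian_product' prod.case)
qed

text \<open>With the intermediate indices fixed, the sum over the outer indices factors into an
  \<open>a\<close>-part, a \<open>b\<close>-part and a \<open>c\<close>-part, the group elements
  occurring in the first two. The three bubbles give the quotients of \<open>\<Theta>\<close> by
  \<open>\<Delta>\<close>, and what remains is the quadratic form of the vertex
  \<open>(k, l, m)\<close>.\<close>

lemma coupled_pairing:
  assumes x: "det x = 1" "det y = 1" and adm: "admissible k l m" "admissible a a' k" "admissible b b' l" "admissible c c' m"
  shows "(\<Sum>(u, v, g)\<in>(({..a} \<times> {..a'}) \<times> ({..a} \<times> {..a'})) \<times> (({..b} \<times> {..b'}) \<times> ({..b} \<times> {..b'})) \<times> ({..c} \<times> {..c'}).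
      coupled a a' b b' c c' k' l' m' (fst u) (fst v) g *
      ((case u of ((p, p'), (i, i')) \<Rightarrow> rho a x p i * rho a' x p' i') *
       (case v of ((q, q'), (j, j')) \<Rightarrow> rho b y q j * rho b' y q' j')) *
      coupled a a' b b' c c' k l m (snd u) (snd v) g)
    = (if (k', l', m') = (k, l, m) then \<Theta> a a' k * \<Theta> b b' l * \<Theta> c c' m / (\<Delta> k * \<Delta> l * \<Delta> m) * central_function k l m x y else 0)"
proof -
  let ?U = "({..a} \<times> {..a'}) \<times> ({..a} \<times> {..a'})" and ?V = "({..b} \<times> {..b'}) \<times> ({..b} \<times> {..b'})" and ?G = "{..c} \<times> {..c'}"
  let ?T = "\<lambda>a b c i j k. complex_of_real (cg a b c i j k)"
  define A where "A k n e = ?T a a' k (fst e) (snd e) n" for k n e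
  define B where "B l w e = ?T b b' l (fst e) (snd e) w" for l w e
  define D where "D m n e = ?T c c' m (fst e) (snd e) n" for m n e
  define R1 where "R1 u = (case u of ((p, p'), (i, i')) \<Rightarrow> rho a x p i * rho a' x p' i')" for u
  define R2 where "R2 v = (case v of ((q, q'), (j, j')) \<Rightarrow> rho b y q j * rho b' y q' j')" for v
  define X where "X k l m = {..k} \<times> {..l} \<times> {..m}" for k l m :: nat
  define t where "t k l m e f g = (\<lambda>(x, w, n). A k x e * B l w f * ?T k l m x w n * D m n g)" for k l m e f g
  have cp: "coupled a a' b b' c c' k l m e f g = (\<Sum>s\<in>X k l m. t k l m e f g s)" for k l m e f g
    by (cases e; cases f; cases g) (simp add: coupled_def X_def t_def A_def B_def D_def)
  have "(\<Sum>(u, v, g)\<in>?U \<times> ?V \<times> ?G. coupled a a' b b' c c' k' l' m' (fst u) (fst v) g * (R1 u * R2 v) *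
      coupled a a' b b' c c' k l m (snd u) (snd v) g)
    = (\<Sum>s'\<in>X k' l' m'. \<Sum>s\<in>X k l m. \<Sum>(u, v, g)\<in>?U \<times> ?V \<times> ?G.
        t k' l' m' (fst u) (fst v) g s' * (R1 u * R2 v) * t k l m (snd u) (snd v) g s)"
    unfolding cp split_def by (rule quadratic_expand)
  also have "\<dots> = (\<Sum>(x', w', n')\<in>X k' l' m'. \<Sum>(x1, w, n)\<in>X k l m. ?T k' l' m' x' w' n' * ?T k l m x1 w n *
     ((\<Sum>u\<in>?U. A k' x' (fst u) * R1 u * A k x1 (snd u)) * (\<Sum>v\<in>?V. B l' w' (fst v) * R2 v * B l w (snd v)) *
      (\<Sum>g\<in>?G. D m' n' g * D m n g)))"
  proof (rule sum.cong[OF refl], clarify, rule sum.cong[OF refl], clarify)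
    fix x' w' n' x1 w n
    have "(\<Sum>(u, v, g)\<in>?U \<times> ?V \<times> ?G. t k' l' m' (fst u) (fst v) g (x', w', n') * (R1 u * R2 v) * t k l m (snd u) (snd v) g (x1, w, n))
      = (\<Sum>(u, v, g)\<in>?U \<times> ?V \<times> ?G. ?T k' l' m' x' w' n' * ?T k l m x1 w n *
        ((A k' x' (fst u) * R1 u * A k x1 (snd u)) * (B l' w' (fst v) * R2 v * B l w (snd v)) * (D m' n' g * D m n g)))"
      by (intro sum.cong refl) (simp only: t_def split_def fst_conv snd_conv mult_ac)
    also have "\<dots> = ?T k' l' m' x' w' n' * ?T k l m x1 w n * (\<Sum>(u, v, g)\<in>?U \<times> ?V \<times> ?G.
        ((A k' x' (fst u) * R1 u * A k x1 (snd u)) * (B l' w' (fst v) * R2 v * B l w (snd v)) * (D m' n' g * D m n g)))"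
      by (simp only: sum_distrib_left split_def)
    finally show "(\<Sum>(u, v, g)\<in>?U \<times> ?V \<times> ?G. t k' l' m' (fst u) (fst v) g (x', w', n') * (R1 u * R2 v) * t k l m (snd u) (snd v) g (x1, w, n))
      = ?T k' l' m' x' w' n' * ?T k l m x1 w n *
     ((\<Sum>u\<in>?U. A k' x' (fst u) * R1 u * A k x1 (snd u)) * (\<Sum>v\<in>?V. B l' w' (fst v) * R2 v * B l w (snd v)) *
      (\<Sum>g\<in>?G. D m' n' g * D m n g))"
      by (simp only: sum_factor3)
  qed
  also have "\<dots> = (\<Sum>(x', w', n')\<in>X k' l' m'. \<Sum>(x1, w, n)\<in>X k l m. ?T k' l' m' x' w' n' * ?T k l m x1 w n *
     ((if k = k' then of_real (theta a a' k / of_nat (Suc k)) * rho k x x' x1 else 0) *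
      (if l = l' then of_real (theta b b' l / of_nat (Suc l)) * rho l y w' w else 0) *
      (if m = m' then if n = n' then of_real (theta c c' m / of_nat (Suc m)) else 0 else 0)))"
  proof (rule sum.cong[OF refl], clarify, rule sum.cong[OF refl], clarify)
    fix x' w' n' x1 w n assume "(x', w', n') \<in> X k' l' m'" "(x1, w, n) \<in> X k l m"
    then have r: "x' \<le> k'" "w' \<le> l'" "n' \<le> m'" "x1 \<le> k" "w \<le> l" "n \<le> m" by (auto simp: X_def)
    have 1: "(\<Sum>u\<in>?U. A k' x' (fst u) * R1 u * A k x1 (snd u)) = (if k = k' then of_real (theta a a' k / of_nat (Suc k)) * rho k x x' x1 else 0)"
      using couple_group[OF x(1) r(1,4), of a a'] by (simp only: A_def R1_def split_def)
    have 2: "(\<Sum>v\<in>?V. B l' w' (fst v) * R2 v * B l w (snd v)) = (if l = l' then of_real (theta b b' l / of_nat (Suc l)) * rho l y w' w else 0)"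
      using couple_group[OF x(2) r(2,5), of b b'] by (simp only: B_def R2_def split_def)
    have 3: "(\<Sum>g\<in>?G. D m' n' g * D m n g) = (if m = m' then if n = n' then of_real (theta c c' m / of_nat (Suc m)) else 0 else 0)"
      using couple_trivial[OF r(3,6), of c c'] by (simp only: D_def split_def)
    show "?T k' l' m' x' w' n' * ?T k l m x1 w n *
     ((\<Sum>u\<in>?U. A k' x' (fst u) * R1 u * A k x1 (snd u)) * (\<Sum>v\<in>?V. B l' w' (fst v) * R2 v * B l w (snd v)) *
      (\<Sum>g\<in>?G. D m' n' g * D m n g)) = ?T k' l' m' x' w' n' * ?T k l m x1 w n *
     ((if k = k' then of_real (theta a a' k / of_nat (Suc k)) * rho k x x' x1 else 0) *
      (if l = l' then of_real (theta b b' l / of_nat (Suc l)) * rho l y w' w else 0) *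
      (if m = m' then if n = n' then of_real (theta c c' m / of_nat (Suc m)) else 0 else 0))"
      unfolding 1 2 3 ..
  qed
  also have "\<dots> = (if (k', l', m') = (k, l, m) then \<Theta> a a' k * \<Theta> b b' l * \<Theta> c c' m / (\<Delta> k * \<Delta> l * \<Delta> m) * central_function k l m x y else 0)"
  proof (cases "(k', l', m') = (k, l, m)")
    case True
    have th: "\<Theta> a a' k * \<Theta> b b' l * \<Theta> c c' m / (\<Delta> k * \<Delta> l * \<Delta> m) = of_real (theta a a' k / of_nat (Suc k)) *
       of_real (theta b b' l / of_nat (Suc l)) * of_real (theta c c' m / of_nat (Suc m))"
      by (simp add: \<Delta>_def Theta_eq adm)
    from True have e: "k' = k" "l' = l" "m' = m" by auto
    show ?thesis
      unfolding th central_function_eq_tuple[OF adm(1)] X_def e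
      by (simp only: simp_thms if_True sum_distrib_left split_def)
         (intro sum.cong refl, simp only: mult_ac if_distrib[of "\<lambda>y. _ * y"] mult_zero_left mult_zero_right)
  next
    case False
    then have "k' \<noteq> k \<or> l' \<noteq> l \<or> m' \<noteq> m" by auto
    then show ?thesis using False by (intro trans[OF sum.neutral]) (auto intro!: sum.neutral)
  qed
  finally show ?thesis by (simp only: R1_def R2_def)
qed

lemma admissible_swap: "admissible b a c \<longleftrightarrow> admissible a b c"
  by (auto simp: admissible_iff)

lemma admissible_rev: "admissible c b a \<longleftrightarrow> admissible a b c"
  by (auto simp: admissible_iff)

lemma mem_coupling_index:
  "(J, k, l, m) \<in> coupling_index a b c a' b' c' \<longleftrightarrow> admissible a a' k \<and> admissible b b' l \<and> admissible c c' m \<and>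
    admissible k l m \<and> admissible a' b J \<and> admissible c J k \<and> admissible c' J l"
  unfolding coupling_index_def sixj_range_def
  by (auto simp: admissible_swap[of b' b l] admissible_rev[of k J c] admissible_rev[of l J c'] admissible_rev[of m c' c])

theorem theorem5p10:
  fixes a b c a' b' c' :: nat and x\<^sub>1 x\<^sub>2 :: "complex^2^2"
  assumes "admissible a b c" and "admissible a' b' c'"
    and "x\<^sub>1 \<in> SL2" and "x\<^sub>2 \<in> SL2"
  shows "central_function a b c x\<^sub>1 x\<^sub>2 * central_function a' b' c' x\<^sub>1 x\<^sub>2 =
    (\<Sum>(j\<^sub>1, j\<^sub>2, k, l, m)\<in>prod_index a b c a' b' c'.
       prod_coeff a b c a' b' c' j\<^sub>1 k l m * prod_coeff a b c a' b' c' j\<^sub>2 k l m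
       * (\<Theta> a a' k * \<Theta> b b' l * \<Theta> c c' m / (\<Delta> k * \<Delta> l * \<Delta> m))
       * central_function k l m x\<^sub>1 x\<^sub>2)"
proof -
  let ?U = "({..a} \<times> {..a'}) \<times> ({..a} \<times> {..a'})" and ?V = "({..b} \<times> {..b'}) \<times> ({..b} \<times> {..b'})" and ?G = "{..c} \<times> {..c'}"
  let ?Z = "?U \<times> ?V \<times> ?G" and ?Q = "coupling_index a b c a' b' c'"
  define R1 where "R1 u = (case u of ((p, p'), (i, i')) \<Rightarrow> rho a x\<^sub>1 p i * rho a' x\<^sub>1 p' i')" for u
  define R2 where "R2 v = (case v of ((q, q'), (j, j')) \<Rightarrow> rho b x\<^sub>2 q j * rho b' x\<^sub>2 q' j')" for v
  \<comment> \<open>The entries of the tensor product of the two vertices, with the legs grouped as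
    \<open>(a, a')\<close>, \<open>(b, b')\<close>, \<open>(c, c')\<close>.\<close>
  define H where "H e f g = complex_of_real (cg a b c (fst e) (fst f) (fst g)) * of_real (cg a' b' c' (snd e) (snd f) (snd g))" for e f g
  define C where "C = (\<lambda>(J, k, l, m). prod_coeff a b c a' b' c' J k l m * csign a' b b' c c' l m)"
  define P where "P = (\<lambda>(J :: nat, k, l, m). coupled a a' b b' c c' k l m)"
  define W where "W k l m = \<Theta> a a' k * \<Theta> b b' l * \<Theta> c c' m / (\<Delta> k * \<Delta> l * \<Delta> m) * central_function k l m x\<^sub>1 x\<^sub>2" for k l m
  have x: "det x\<^sub>1 = 1" "det x\<^sub>2 = 1" using assms(3,4) by (auto simp: SL2_def)
  define K where "K a b c = (\<lambda>(z, i, j, p, q). complex_of_real (cg a b c p q z) * (rho a x\<^sub>1 p i * rho b x\<^sub>2 q j) *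
    of_real (cg a b c i j z))" for a b c
  define T where "T a b c = {..c} \<times> {..a} \<times> {..b} \<times> {..a} \<times> {..b}" for a b c :: nat
  have K: "central_function a b c x\<^sub>1 x\<^sub>2 = (\<Sum>t\<in>T a b c. K a b c t)" if "admissible a b c" for a b c
    unfolding central_function_eq[OF that] K_def T_def by (simp only: sum.cartesian_product' prod.case)
  have "central_function a b c x\<^sub>1 x\<^sub>2 * central_function a' b' c' x\<^sub>1 x\<^sub>2
    = (\<Sum>(t, t')\<in>T a b c \<times> T a' b' c'. K a b c t * K a' b' c' t')"
    unfolding K[OF assms(1)] K[OF assms(2)] by (simp only: sum.cartesian_product sum_product)
  also have "\<dots> = (\<Sum>(u, v, g)\<in>?Z. H (fst u) (fst v) g * (R1 u * R2 v) * H (snd u) (snd v) g)"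
    by (rule sum.reindex_bij_witness[of _
        "\<lambda>(((p, p'), (i, i')), ((q, q'), (j, j')), (z, z')). ((z, i, j, p, q), (z', i', j', p', q'))"
        "\<lambda>((z, i, j, p, q), (z', i', j', p', q')). (((p, p'), (i, i')), ((q, q'), (j, j')), (z, z'))"])
      (auto simp: H_def R1_def R2_def K_def T_def)
  also have "\<dots> = (\<Sum>(u, v, g)\<in>?Z. (\<Sum>s\<in>?Q. C s * P s (fst u) (fst v) g) * (R1 u * R2 v) * (\<Sum>s\<in>?Q. C s * P s (snd u) (snd v) g))"
  proof -
    have "H e f g = (\<Sum>s\<in>?Q. C s * P s e f g)"
      if "e \<in> {..a} \<times> {..a'}" "f \<in> {..b} \<times> {..b'}" "g \<in> ?G" for e f g
      using that product_expand[OF assms(1,2), of "fst e" "snd e" "fst f" "snd f" "fst g" "snd g"]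
      by (auto simp: H_def C_def P_def split_def)
    then show ?thesis
      by (intro sum.cong refl) auto
  qed
  also have "\<dots> = (\<Sum>s\<in>?Q. \<Sum>t\<in>?Q. \<Sum>(u, v, g)\<in>?Z. (C s * P s (fst u) (fst v) g) * (R1 u * R2 v) * (C t * P t (snd u) (snd v) g))"
    unfolding split_def by (rule quadratic_expand)
  \<comment> \<open>\<open>J\<close> is absent from \<open>coupled\<close>, so terms with equal
    \<open>(k, l, m)\<close> pair nontrivially whatever their \<open>J\<close>: this is the origin
    of the two independent indices \<open>j\<^sub>1\<close> and \<open>j\<^sub>2\<close>.\<close>
  also have "\<dots> = (\<Sum>s\<in>?Q. \<Sum>t\<in>?Q. if snd s = snd t then C s * C t * (case t of (J, k, l, m) \<Rightarrow> W k l m) else 0)"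
  proof (rule sum.cong[OF refl], rule sum.cong[OF refl])
    fix s t :: "nat \<times> nat \<times> nat \<times> nat" assume t: "t \<in> ?Q"
    obtain J' k' l' m' J k l m where e: "s = (J', k', l', m')" "t = (J, k, l, m)"
      by (cases s, cases t)
    have adm: "admissible k l m" "admissible a a' k" "admissible b b' l" "admissible c c' m"
      using t by (auto simp: e mem_coupling_index)
    have "(\<Sum>(u, v, g)\<in>?Z. (C s * P s (fst u) (fst v) g) * (R1 u * R2 v) * (C t * P t (snd u) (snd v) g))
      = C s * C t * (\<Sum>(u, v, g)\<in>?Z. coupled a a' b b' c c' k' l' m' (fst u) (fst v) g * (R1 u * R2 v) * coupled a a' b b' c c' k l m (snd u) (snd v) g)"
      unfolding sum_distrib_left by (intro sum.cong refl) (simp add: split_def P_def e mult_ac)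
    also have "\<dots> = C s * C t * (if (k', l', m') = (k, l, m) then W k l m else 0)"
      unfolding R1_def R2_def W_def coupled_pairing[OF x adm] ..
    finally show "(\<Sum>(u, v, g)\<in>?Z. (C s * P s (fst u) (fst v) g) * (R1 u * R2 v) * (C t * P t (snd u) (snd v) g))
      = (if snd s = snd t then C s * C t * (case t of (J, k, l, m) \<Rightarrow> W k l m) else 0)"
      by (simp add: e)
  qed
  also have "\<dots> = (\<Sum>(s, t)\<in>{p \<in> ?Q \<times> ?Q. snd (fst p) = snd (snd p)}. C s * C t * (case t of (J, k, l, m) \<Rightarrow> W k l m))"
    unfolding sum.cartesian_product
    by (subst sum.inter_filter) (auto simp: finite_coupling_index intro!: sum.cong)
  also have "\<dots> = (\<Sum>(j\<^sub>1, j\<^sub>2, k, l, m)\<in>prod_index a b c a' b' c'.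
       prod_coeff a b c a' b' c' j\<^sub>1 k l m * prod_coeff a b c a' b' c' j\<^sub>2 k l m * W k l m)"
  proof (rule sum.reindex_bij_witness[of _ "\<lambda>(j1, j2, k, l, m). ((j1, k, l, m), (j2, k, l, m))"
        "\<lambda>((j1, k, l, m), (j2, k', l', m')). (j1, j2, k, l, m)"], goal_cases)
    case (2 p)
    then show ?case
      by (auto simp: mem_coupling_index prod_index_def)
  next
    case (4 p)
    then show ?case
      by (auto simp: mem_coupling_index prod_index_def)
  next
    case (5 p)
    have "C (j1, k, l, m) * C (j2, k, l, m) = prod_coeff a b c a' b' c' j1 k l m * prod_coeff a b c a' b' c' j2 k l m" for j1 j2 k l m
    proof -
      have "C (j1, k, l, m) * C (j2, k, l, m) = prod_coeff a b c a' b' c' j1 k l m * prod_coeff a b c a' b' c' j2 k l m *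
          (csign a' b b' c c' l m * csign a' b b' c c' l m)"
        by (simp add: C_def mult_ac)
      then show ?thesis by (simp add: csign_square)
    qed
    then show ?case using 5 by auto
  qed auto
  finally show ?thesis
    by (simp only: W_def mult.assoc)
qed

end
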